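(* Let $Q = \langle x, y \mid R_1, \dots, R_m \rangle$ be a finitely presented group on two generators with unsolvable word problem, and let $n = m+2$. In Thompson's group $T$ let $u = AC^2A$, $v = A^2C^2$, and put $a = u^2$, $b = v^2$, $c = uvu^{-1}$, $d = vuv^{-1}$. Let $\hat a, \hat b, \hat c, \hat d \in \operatorname{Aut}^+(F)$ be lifts with $\pi(\hat a) = (a,1)$, $\pi(\hat b) = (b,1)$, $\pi(\hat c) = (1,c)$, $\pi(\hat d) = (1,d)$, such that the subgroup they generate is the direct product $\langle \hat a,\hat b\rangle \times \langle \hat c, \hat d\rangle \cong F_2 \times F_2$ of free groups with bases $\{\hat a,\hat b\}$ and $\{\hat c,\hat d\}$. Define $$\widehat{\phi_j} = R_j(\hat c, \hat d)\ (1 \leqslant j \leqslant m), \qquad \widehat{\phi_{m+1}} = \hat a \hat c, \qquad \widehat{\phi_{m+2}} = \hat b \hat d,$$ where $R_j(\hat c,\hat d)$ is obtained from the word $R_j$ by substituting $x \mapsto \hat c$, $y \mapsto \hat d$. Then the group given by the presentation $$G = \left\langle \alpha, \beta, t_1, \dots, t_n \ \middle|\ \begin{array}{l} [\alpha\beta^{-1}, \alpha^{-1}\beta\alpha],\ [\alpha\beta^{-1}, \alpha^{-2}\beta\alpha^2],\\ t_j^{-1}\alpha t_j = \widehat{\phi_j}^{-1}\alpha\,\widehat{\phi_j},\quad t_j^{-1}\beta t_j = \widehat{\phi_j}^{-1}\beta\,\widehat{\phi_j}\quad (j=1,\dots,n)\end{array}\right\rangle$$ is an extension of Thompson's group $F$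 with solvable word problem and unsolvable conjugacy problem. Here each right-hand side $\widehat{\phi_j}^{-1}\alpha\,\widehat{\phi_j}$, $\widehat{\phi_j}^{-1}\beta\,\widehat{\phi_j}$ denotes a word in $\alpha,\beta$ representing that element of $F$.
   Context: Products of maps are compositions, $fg = f\circ g$, and $[g,h]=g^{-1}h^{-1}gh$. $\operatorname{PL}_2(\mathbb R)$ is the group of piecewise linear homeomorphisms of $\mathbb R$ that map $\mathbb Z[1/2]$ to itself, have a discrete (possibly infinite) set of breakpoints, all dyadic, and have slopes $\pm$ powers of $2$. Thompson's group $F$ is viewed as the subgroup of $\operatorname{PL}_2(\mathbb R)$ of orientation-preserving elements $f$ with finitely many breakpoints for which there are $M,N\in\mathbb R$ and $k,l\in\mathbb Z$ with $f(x)=x+k$ for $x>M$ and $f(x)=x+l$ for $x<N$. It is generated by $\alpha(t) = t-1$ and $\beta(t)= t$ for $t\le 0$, $t/2$ for $0\le t\le 2$, $t-1$ for $t\ge 2$; with respect to these generators $F = \langle \alpha,\beta \mid [\alpha\beta^{-1}, \alpha^{-1}\beta\alpha], [\alpha\beta^{-1}, \alpha^{-2}\beta\alpha^2]\rangle$. By Brin's theorem $\operatorname{Aut}(F)$ is identified with the normalizer of $F$ in $\operatorname{PL}_2(\mathbb R)$, acting by conjugation, and $\operatorname{Aut}^+(F)$ is the subgroup of orientation-preserving elements. Every $e\in\operatorname{Aut}^+(F)$ satisfies $e(x+1)=e(x)+1$ outside some bounded interval. Thompson's group $T$ is the group of orientation-preserving piecewise linear homeomorphisms of $S^1 = [0,1]/\{0=1\}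 = \mathbb R/\mathbb Z$ mapping dyadic rationals to dyadic rationals and differentiable, with derivatives powers of $2$, except at finitely many dyadic rationals. The map $\pi : \operatorname{Aut}^+(F) \to T\times T$ is $\pi(e) = (e_-,e_+)$, where $e_-$ (resp. $e_+$) is the element of $T$ induced modulo $\mathbb Z$ by the restriction of $e$ to a length-one interval $(k-1,k]$ sufficiently far to the left (resp. $[l,l+1)$ sufficiently far to the right), with $k,l\in\mathbb Z$. $A, C\in T$ are the standard elements $A(x) = x/2$ on $[0,1/2]$, $x-1/4$ on $[1/2,3/4]$, $2x-1$ on $[3/4,1]$; $C(x) = x/2+3/4$ on $[0,1/2]$, $2x-1$ on $[1/2,3/4]$, $x-1/4$ on $[3/4,1]$. They satisfy $C^3=1$ and $(AC)^2=1$, and $\langle u,v\rangle$ is a free group of rank $2$ with basis $u,v$. An extension of $F$ is a group fitting in a short exact sequence $1\to F\to G\to H\to 1$. The word problem is: decide whether a given word in the generators and their inverses represents $1$; the conjugacy problem is: given words $x,y$, decide whether $y=g^{-1}xg$ for some $g$ in the group. Solvable means decidable by an algorithm. *)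

theory Defs
  imports
    "HOL-Analysis.Analysis"
    "HOL-Algebra.Elementary_Groups"
    "HOL-Algebra.Group_Action"
    "HOL-Library.Nat_Bijection"
begin

section \<open>Words and presentations\<close>

text \<open>The letter \<open>(i, True)\<close> is the generator number \<open>i\<close>, counted from 0, and \<open>(i, False)\<close> is its
  formal inverse.\<close>

type_synonym word = "(nat \<times> bool) list"

definition words :: "nat \<Rightarrow> word set" where
  "words k = {w. fst ` set w \<subseteq> {..<k}}"

definition gen :: "nat \<Rightarrow> word" where
  "gen i = [(i, True)]"

definition winv :: "word \<Rightarrow> word" where
  "winv w = rev (map (\<lambda>(i, e). (i, \<not> e)) w)"

definition wcomm :: "word \<Rightarrow> word \<Rightarrow> word" where
  "wcomm g h = winv g @ winv h @ g @ h"

definition reduced :: "word \<Rightarrow> bool" where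
  "reduced w \<longleftrightarrow> \<not> (\<exists>u i e v. w = u @ [(i, e), (i, \<not> e)] @ v)"

primrec word_val :: "('a, 'b) monoid_scheme \<Rightarrow> 'a list \<Rightarrow> word \<Rightarrow> 'a" where
  "word_val G gs [] = \<one>\<^bsub>G\<^esub>"
| "word_val G gs (l # w) =
     (if snd l then gs ! fst l else inv\<^bsub>G\<^esub> (gs ! fst l)) \<otimes>\<^bsub>G\<^esub> word_val G gs w"

definition free_basis :: "('a, 'b) monoid_scheme \<Rightarrow> 'a list \<Rightarrow> bool" where
  "free_basis G gs \<longleftrightarrow> set gs \<subseteq> carrier G \<and>
     (\<forall>w \<in> words (length gs). reduced w \<and> w \<noteq> [] \<longrightarrow> word_val G gs w \<noteq> \<one>\<^bsub>G\<^esub>)"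

inductive pres_eq :: "nat \<Rightarrow> word set \<Rightarrow> word \<Rightarrow> word \<Rightarrow> bool" for k R where
  refl: "w \<in> words k \<Longrightarrow> pres_eq k R w w"
| sym: "pres_eq k R w w' \<Longrightarrow> pres_eq k R w' w"
| trans: "pres_eq k R w w' \<Longrightarrow> pres_eq k R w' w'' \<Longrightarrow> pres_eq k R w w''"
| cancel: "u \<in> words k \<Longrightarrow> v \<in> words k \<Longrightarrow> i < k \<Longrightarrow>
    pres_eq k R (u @ [(i, e), (i, \<not> e)] @ v) (u @ v)"
| relator: "u \<in> words k \<Longrightarrow> v \<in> words k \<Longrightarrow> r \<in> R \<Longrightarrow> r \<in> words k \<Longrightarrow>
    pres_eq k R (u @ r @ v) (u @ v)"

definition pres_class :: "nat \<Rightarrow> word set \<Rightarrow> word \<Rightarrow> word set" where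
  "pres_class k R w = {w'. pres_eq k R w w'}"

definition presented_group :: "nat \<Rightarrow> word set \<Rightarrow> word set monoid" where
  "presented_group k R =
     \<lparr>carrier = pres_class k R ` words k,
      mult = (\<lambda>X Y. \<Union>x\<in>X. \<Union>y\<in>Y. pres_class k R (x @ y)),
      one = pres_class k R []\<rparr>"

definition pres_gens :: "nat \<Rightarrow> word set \<Rightarrow> word set list" where
  "pres_gens k R = map (\<lambda>i. pres_class k R (gen i)) [0..<k]"

section \<open>Decision problems\<close>

text \<open>Total recursive functions with minimisation restricted to regular functions. A \<open>k\<close>-ary
  function is given by its values on lists of length \<open>k\<close>; its other values are irrelevant, which is
  what the rule \<open>ext\<close> says.\<close>

inductive recursive :: "nat \<Rightarrow> (nat list \<Rightarrow> nat) \<Rightarrow> bool" where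
  zero: "recursive k (\<lambda>_. 0)"
| succ: "recursive 1 (\<lambda>xs. Suc (xs ! 0))"
| proj: "i < k \<Longrightarrow> recursive k (\<lambda>xs. xs ! i)"
| comp: "recursive (length gs) f \<Longrightarrow> \<forall>g \<in> set gs. recursive k g \<Longrightarrow>
    recursive k (\<lambda>xs. f (map (\<lambda>g. g xs) gs))"
| prim_rec: "recursive k f \<Longrightarrow> recursive (Suc (Suc k)) g \<Longrightarrow>
    recursive (Suc k) (\<lambda>xs. rec_nat (f (tl xs)) (\<lambda>n r. g (n # r # tl xs)) (hd xs))"
| minimisation: "recursive (Suc k) f \<Longrightarrow> \<forall>xs. length xs = k \<longrightarrow> (\<exists>n. f (n # xs) = 0) \<Longrightarrow>
    recursive k (\<lambda>xs. LEAST n. f (n # xs) = 0)"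
| ext: "recursive k f \<Longrightarrow> \<forall>xs. length xs = k \<longrightarrow> f xs = g xs \<Longrightarrow> recursive k g"

definition word_code :: "word \<Rightarrow> nat" where
  "word_code w = list_encode (map (\<lambda>(i, e). 2 * i + of_bool e) w)"

text \<open>Here \<open>gs\<close> is a finite list of generators of \<open>G\<close>.\<close>

definition word_problem_solvable :: "('a, 'b) monoid_scheme \<Rightarrow> 'a list \<Rightarrow> bool" where
  "word_problem_solvable G gs \<longleftrightarrow>
     (\<exists>f. recursive 1 f \<and>
       (\<forall>w \<in> words (length gs).
          f [word_code w] = of_bool (word_val G gs w = \<one>\<^bsub>G\<^esub>)))"

definition conjugacy_problem_solvable :: "('a, 'b) monoid_scheme \<Rightarrow> 'a list \<Rightarrow> bool" where
  "conjugacy_problem_solvable G gs \<longleftrightarrow>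
     (\<exists>f. recursive 2 f \<and>
       (\<forall>x \<in> words (length gs). \<forall>y \<in> words (length gs).
          f [word_code x, word_code y] =
            of_bool (\<exists>g \<in> carrier G.
              word_val G gs y = inv\<^bsub>G\<^esub> g \<otimes>\<^bsub>G\<^esub> word_val G gs x \<otimes>\<^bsub>G\<^esub> g)))"

section \<open>Extensions\<close>

text \<open>The quotient \<open>H\<close> may be taken of type \<open>'b set monoid\<close> without loss of generality, being
  isomorphic to a group of cosets of the image of \<open>F\<close>. The library's \<open>short_exact_sequence\<close> is
  not used because it needs all groups to have elements of the same type.\<close>

definition extension_of :: "'a monoid \<Rightarrow> 'b monoid \<Rightarrow> bool" where
  "extension_of F G \<longleftrightarrow> group F \<and> group G \<and>
     (\<exists>(H :: 'b set monoid) i p. group H \<and> i \<in> mon F G \<and> p \<in> epi G H \<and>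
        kernel G H p = i ` carrier F)"

section \<open>Piecewise linear homeomorphisms of the line and Thompson's group F\<close>

definition dyadic :: "real set" where
  "dyadic = {of_int k / 2 ^ n | k n. True}"

text \<open>The set of points near which \<open>f\<close> is not affine is closed, so it is discrete iff it meets every
  bounded interval in a finite set.\<close>

definition breakpoints :: "(real \<Rightarrow> real) \<Rightarrow> real set" where
  "breakpoints f = {x. \<not> (\<exists>a b. \<forall>\<^sub>F y in nhds x. f y = a * y + b)}"

definition PL2 :: "(real \<Rightarrow> real) set" where
  "PL2 = {f. (\<exists>g. homeomorphism UNIV UNIV f g) \<and>
     f ` dyadic = dyadic \<and>
     breakpoints f \<subseteq> dyadic \<and>
     (\<forall>a b. finite (breakpoints f \<inter> {a..b})) \<and>
     (\<forall>x. x \<notin> breakpoints f \<longrightarrow>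
        (\<exists>k::int. (f has_real_derivative 2 powi k) (at x) \<or>
                  (f has_real_derivative - (2 powi k)) (at x)))}"

definition PL2_group :: "(real \<Rightarrow> real) monoid" where
  "PL2_group = \<lparr>carrier = PL2, mult = (\<circ>), one = id\<rparr>"

definition thompson_F :: "(real \<Rightarrow> real) set" where
  "thompson_F = {f \<in> PL2. strict_mono f \<and> finite (breakpoints f) \<and>
     (\<exists>M N (k::int) (l::int). (\<forall>x>M. f x = x + of_int k) \<and> (\<forall>x<N. f x = x + of_int l))}"

definition F_group :: "(real \<Rightarrow> real) monoid" where
  "F_group = PL2_group\<lparr>carrier := thompson_F\<rparr>"

definition alpha :: "real \<Rightarrow> real" where
  "alpha t = t - 1"

definition beta :: "real \<Rightarrow> real" where
  "beta t = (if t \<le> 0 then t else if t \<le> 2 then t / 2 else t - 1)"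

definition Aut_plus_F :: "(real \<Rightarrow> real) set" where
  "Aut_plus_F = {e \<in> normalizer PL2_group thompson_F. strict_mono e}"

section \<open>The circle, Thompson's group T and the map to T x T\<close>

quotient_type circle = real / "\<lambda>x y :: real. x - y \<in> \<int>"
  morphisms rep_circle to_circle
proof (rule equivpI)
  show "reflp (\<lambda>x y :: real. x - y \<in> \<int>)"
    by (simp add: reflp_def)
  show "symp (\<lambda>x y :: real. x - y \<in> \<int>)"
    by (metis (mono_tags, lifting) Ints_minus minus_diff_eq sympI)
  show "transp (\<lambda>x y :: real. x - y \<in> \<int>)"
  proof (rule transpI)
    fix x y z :: real
    assume "x - y \<in> \<int>" "y - z \<in> \<int>"
    then have "(x - y) + (y - z) \<in> \<int>" by (rule Ints_add)
    then show "x - z \<in> \<int>" by simp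
  qed
qed

text \<open>An orientation-preserving homeomorphism of the circle is a map induced by an increasing
  homeomorphism \<open>f\<close> of the line with \<open>f (x + 1) = f x + 1\<close>. By this periodicity, local finiteness
  of the set of breakpoints of \<open>f\<close> is finiteness modulo the integers.\<close>

definition thompson_T :: "(circle \<Rightarrow> circle) set" where
  "thompson_T = {g. \<exists>f \<in> PL2. strict_mono f \<and> (\<forall>x. f (x + 1) = f x + 1) \<and>
     (\<forall>x. g (to_circle x) = to_circle (f x))}"

definition T_group :: "(circle \<Rightarrow> circle) monoid" where
  "T_group = \<lparr>carrier = thompson_T, mult = (\<circ>), one = id\<rparr>"

lemma frac_cong_Ints: "frac x = frac y" if "x - y \<in> \<int>" for x y :: real
proof -
  from that obtain z :: int where "x - y = of_int z" by (rule Ints_cases)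
  then have "x = y + of_int z" by simp
  then show ?thesis by (simp add: frac_def)
qed

lift_definition T_A :: "circle \<Rightarrow> circle" is
  "\<lambda>x. let t = frac x in
     if t \<le> 1/2 then t / 2 else if t \<le> 3/4 then t - 1/4 else 2 * t - 1"
  by (simp add: frac_cong_Ints)

lift_definition T_C :: "circle \<Rightarrow> circle" is
  "\<lambda>x. let t = frac x in
     if t \<le> 1/2 then t / 2 + 3/4 else if t \<le> 3/4 then 2 * t - 1 else t - 1/4"
  by (simp add: frac_cong_Ints)

definition pi_minus :: "(real \<Rightarrow> real) \<Rightarrow> circle \<Rightarrow> circle" where
  "pi_minus e = (THE g. g \<in> thompson_T \<and>
     (\<exists>K::int. \<forall>k\<le>K. \<forall>x \<in> {of_int k - 1<..of_int k}. g (to_circle x) = to_circle (e x)))"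

definition pi_plus :: "(real \<Rightarrow> real) \<Rightarrow> circle \<Rightarrow> circle" where
  "pi_plus e = (THE g. g \<in> thompson_T \<and>
     (\<exists>L::int. \<forall>l\<ge>L. \<forall>x \<in> {of_int l..<of_int l + 1}. g (to_circle x) = to_circle (e x)))"

definition pi_map :: "(real \<Rightarrow> real) \<Rightarrow> (circle \<Rightarrow> circle) \<times> (circle \<Rightarrow> circle)" where
  "pi_map e = (pi_minus e, pi_plus e)"

definition T_u :: "circle \<Rightarrow> circle" where
  "T_u = T_A \<otimes>\<^bsub>T_group\<^esub> T_C [^]\<^bsub>T_group\<^esub> (2::nat) \<otimes>\<^bsub>T_group\<^esub> T_A"

definition T_v :: "circle \<Rightarrow> circle" where
  "T_v = T_A [^]\<^bsub>T_group\<^esub> (2::nat) \<otimes>\<^bsub>T_group\<^esub> T_C [^]\<^bsub>T_group\<^esub> (2::nat)"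

section \<open>Presentations of extensions of F by free groups\<close>

text \<open>Generator 0 is \<open>\<alpha>\<close>, generator 1 is \<open>\<beta>\<close> and the stable letter \<open>t\<close> with (0-based) number \<open>j\<close> is
  generator \<open>j + 2\<close>. The words \<open>wa ! j\<close> and \<open>wb ! j\<close> in \<open>\<alpha>\<close>, \<open>\<beta>\<close> are the prescribed values of
  the conjugates of \<open>\<alpha>\<close> and \<open>\<beta>\<close> by that letter.\<close>

definition F_relators :: "word set" where
  "F_relators =
     (let a = gen 0; b = gen 1 in
      {wcomm (a @ winv b) (winv a @ b @ a),
       wcomm (a @ winv b) (winv a @ winv a @ b @ a @ a)})"

definition extension_relators :: "nat \<Rightarrow> word list \<Rightarrow> word list \<Rightarrow> word set" where
  "extension_relators n wa wb = F_relators \<union>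
     (\<Union>j<n. {winv (gen (j + 2)) @ gen 0 @ gen (j + 2) @ winv (wa ! j),
              winv (gen (j + 2)) @ gen 1 @ gen (j + 2) @ winv (wb ! j)})"

end

theory Submission
  imports Defs
begin

text \<open>
  Write \<open>Q = \<langle>x, y \<bar> R\<^sub>1, \<dots>, R\<^sub>m\<rangle>\<close>. The generator \<open>t\<^sub>j\<close> of \<open>G\<close> acts on \<open>F\<close> by conjugation in the same way as
  the homeomorphism \<open>\<phi>\<^sub>j\<close> of the line, so \<open>G\<close> is a split extension of \<open>F\<close> by a free group, and
  \<open>\<alpha>, \<beta>, t\<^sub>j \<mapsto> \<alpha>, \<beta>, \<phi>\<^sub>j\<close> maps \<open>G\<close> to the group of homeomorphisms.

  \<^bold>\<open>Extension.\<close> That \<open>F\<close> embeds in \<open>G\<close> and that the words in \<open>\<alpha>, \<beta>\<close> form a normal subgroup needs the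
  presentation of \<open>F\<close>: words in \<open>\<alpha>, \<beta>\<close> with the same homeomorphism are equal in any group that
  satisfies the two relators (\<open>F_relations_complete\<close>), and every element of \<open>F\<close> is such a word
  (\<open>F_generated\<close>). Both use the infinite generating set \<open>x\<^sub>0, x\<^sub>1, \<dots>\<close>, for which
  \<open>x\<^sub>k\<^sup>-\<^sup>1 x\<^sub>n x\<^sub>k = x\<^sub>n\<^sub>+\<^sub>1\<close> whenever \<open>k < n\<close>. An element of \<open>F\<close> is a quotient of two maps that carry unit
  cells onto standard dyadic intervals, and such maps are products of these generators. Conversely,
  the relations turn all words into fractions of sorted positive words, and a sorted positive word
  can be read off from its map.

  \<^bold>\<open>Word problem.\<close> Moving all stable letters of a word to the right replaces its letters from \<open>F\<close> by
  words taken from a finite table. The result is trivial iff the stable letters cancel freely and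
  the remaining word in \<open>\<alpha>, \<beta>\<close> is the identity map, which is tested at finitely many points
  (\<open>ev_one_iff\<close>, \<open>F_test_iff\<close>).

  \<^bold>\<open>Conjugacy problem.\<close> Write \<open>a', b', c', d'\<close> for the lifts of \<open>a, b, c, d\<close>. For a word \<open>w\<close> in two
  letters put \<open>e\<^sub>w = w(c', d')\<close>. A word in \<open>\<alpha>, \<beta>\<close> for the element \<open>e\<^sub>w \<alpha> e\<^sub>w\<^sup>-\<^sup>1\<close> of \<open>F\<close> is computable
  from \<open>w\<close>. It is conjugate to \<open>\<alpha>\<close> in \<open>G\<close> iff \<open>w = 1\<close> in \<open>Q\<close>
  (\<open>conj_alpha_conjugate_iff\<close>), so a conjugacy test for \<open>G\<close> would solve the word problem of \<open>Q\<close>.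

  If \<open>w = 1\<close> in \<open>Q\<close>, then \<open>e\<^sub>w\<close> is a product of conjugates of elements \<open>R\<^sub>j(c', d')\<^sup>\<plusminus>\<^sup>1\<close> by elements
  \<open>u(c', d')\<close>. Since \<open>a', b'\<close> commute with \<open>c', d'\<close>, these are also the conjugates by
  \<open>u(a'c', b'd')\<close>, so \<open>e\<^sub>w\<close> is the image of an element of \<open>G\<close>, which conjugates as required
  (\<open>pres_eq_realised\<close>). This is the fibre product construction of Mihailova.

  Conversely, if the two elements are conjugate in \<open>G\<close>, then for the image \<open>V\<close> of some element of \<open>G\<close>
  the map \<open>V e\<^sub>w\<close> commutes with \<open>\<alpha>\<close>, that is, with the unit translation. Hence it has the same germ
  at both ends of the line. The germ of \<open>V\<close> at \<open>-\<infinity>\<close> is a word \<open>p\<close> in \<open>a, b\<close>, its germ at \<open>+\<infinity>\<close> is a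
  word \<open>q\<close> in \<open>c, d\<close>, and \<open>p\<close>, \<open>q\<close> are the same word up to the relators \<open>R\<^sub>j\<close>. So \<open>p(a, b) = (q w)(c, d)\<close> in
  \<open>T\<close>. A ping-pong argument with the four quarters of the circle (\<open>T_ab_cd_words\<close>) shows that \<open>p\<close> and
  \<open>q w\<close> are then freely trivial; therefore \<open>w = q\<^sup>-\<^sup>1 = p\<^sup>-\<^sup>1 = 1\<close> in \<open>Q\<close> (\<open>periodic_trivial\<close>).
\<close>

section \<open>Recursive functions on encoded data\<close>

lemma recursive_comp1:
  assumes "recursive 1 f" "recursive k g"
  shows "recursive k (\<lambda>xs. f [g xs])"
  using recursive.comp[of "[g]" f k] assms by simp

lemma recursive_comp2:
  assumes "recursive 2 f" "recursive k g" "recursive k h"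
  shows "recursive k (\<lambda>xs. f [g xs, h xs])"
  using recursive.comp[of "[g, h]" f k] assms by (simp add: numeral_2_eq_2)

lemma recursive_Suc: "recursive k f \<Longrightarrow> recursive k (\<lambda>xs. Suc (f xs))"
  using recursive_comp1[OF recursive.succ] by simp

lemma recursive_rec2:
  assumes "recursive 1 f" "recursive 3 g"
  shows "recursive 2 (\<lambda>xs. rec_nat (f [xs ! 1]) (\<lambda>n r. g [n, r, xs ! 1]) (xs ! 0))"
proof -
  have "recursive (Suc 1) (\<lambda>xs. rec_nat (f (tl xs)) (\<lambda>n r. g (n # r # tl xs)) (hd xs))"
    using assms by (intro recursive.prim_rec) (auto simp: numeral_3_eq_3)
  then show ?thesis
    unfolding Suc_1 by (rule recursive.ext) (auto simp: length_Suc_conv numeral_2_eq_2)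
qed

lemma recursive_rec1:
  assumes "recursive 2 g"
  shows "recursive 1 (\<lambda>xs. rec_nat c (\<lambda>n r. g [n, r]) (xs ! 0))"
proof -
  have const: "recursive 0 (\<lambda>_. c)"
    by (induction c) (auto intro: recursive.zero recursive_Suc)
  have "recursive (Suc 0) (\<lambda>xs. rec_nat c (\<lambda>n r. g (n # r # tl xs)) (hd xs))"
    using assms recursive.prim_rec[OF const, of g] by (simp add: numeral_2_eq_2)
  then show ?thesis
    unfolding One_nat_def by (rule recursive.ext) (auto simp: length_Suc_conv)
qed

lemma recursive_proj0: "0 < k \<Longrightarrow> recursive k (\<lambda>xs. xs ! 0)"
  and recursive_proj1: "1 < k \<Longrightarrow> recursive k (\<lambda>xs. xs ! 1)"
  and recursive_proj2: "2 < k \<Longrightarrow> recursive k (\<lambda>xs. xs ! 2)"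
  by (rule recursive.proj, simp)+

lemma recursive_add:
  assumes "recursive k f" "recursive k g"
  shows "recursive k (\<lambda>xs. f xs + g xs)"
proof -
  have "recursive 2 (\<lambda>xs. rec_nat ([xs ! 1] ! 0) (\<lambda>n r. Suc ([n, r, xs ! 1] ! 1)) (xs ! 0))"
    by (intro recursive_rec2 recursive_Suc recursive_proj0 recursive_proj1) auto
  moreover have "rec_nat b (\<lambda>n. Suc) a = a + b" for a b :: nat
    by (induction a) auto
  ultimately have "recursive 2 (\<lambda>xs. xs ! 0 + xs ! 1)" by simp
  from recursive_comp2[OF this assms] show ?thesis by simp
qed

lemma recursive_pred:
  assumes "recursive k f"
  shows "recursive k (\<lambda>xs. f xs - 1)"
proof -
  have "recursive 1 (\<lambda>xs. rec_nat 0 (\<lambda>n r. [n, r] ! 0) (xs ! 0))"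
    by (intro recursive_rec1 recursive_proj0) auto
  moreover have "rec_nat 0 (\<lambda>n r. n) a = a - 1" for a :: nat
    by (induction a) auto
  ultimately have "recursive 1 (\<lambda>xs. xs ! 0 - 1)" by simp
  from recursive_comp1[OF this assms] show ?thesis by simp
qed

lemma recursive_diff:
  assumes "recursive k f" "recursive k g"
  shows "recursive k (\<lambda>xs. f xs - g xs)"
proof -
  have "recursive 2 (\<lambda>xs. rec_nat ([xs ! 1] ! 0) (\<lambda>n r. [n, r, xs ! 1] ! 1 - 1) (xs ! 0))"
    by (intro recursive_rec2 recursive_pred recursive_proj0 recursive_proj1) auto
  moreover have "rec_nat b (\<lambda>n r. r - 1) a = b - a" for a b :: nat
    by (induction a) auto
  ultimately have "recursive 2 (\<lambda>xs. xs ! 1 - xs ! 0)" by simp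
  from recursive_comp2[OF this assms(2,1)] show ?thesis by simp
qed

lemma recursive_mult:
  assumes "recursive k f" "recursive k g"
  shows "recursive k (\<lambda>xs. f xs * g xs)"
proof -
  have "recursive 2 (\<lambda>xs. rec_nat 0 (\<lambda>n r. [n, r, xs ! 1] ! 1 + [n, r, xs ! 1] ! 2) (xs ! 0))"
    by (intro recursive_rec2 recursive_add recursive.zero recursive_proj1 recursive_proj2) auto
  moreover have "rec_nat 0 (\<lambda>n r. r + b) a = a * b" for a b :: nat
    by (induction a) auto
  ultimately have "recursive 2 (\<lambda>xs. xs ! 0 * xs ! 1)" by simp
  from recursive_comp2[OF this assms] show ?thesis by simp
qed

lemma recursive_triangle:
  assumes "recursive k f"
  shows "recursive k (\<lambda>xs. triangle (f xs))"
proof -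
  have "recursive 1 (\<lambda>xs. rec_nat 0 (\<lambda>n r. [n, r] ! 1 + Suc ([n, r] ! 0)) (xs ! 0))"
    by (intro recursive_rec1 recursive_add recursive_Suc recursive_proj0 recursive_proj1) auto
  moreover have "rec_nat 0 (\<lambda>n r. r + Suc n) a = triangle a" for a :: nat
    by (induction a) auto
  ultimately have "recursive 1 (\<lambda>xs. triangle (xs ! 0))" by simp
  from recursive_comp1[OF this assms] show ?thesis by simp
qed

lemma triangle_mono: "a \<le> b \<Longrightarrow> triangle a \<le> triangle b"
  by (induction rule: dec_induct) auto

text \<open>The sum of the components of a pair is the number of the diagonal that contains its code.\<close>

lemma diagonal_prod_encode: "(LEAST s. Suc (prod_encode (m, n)) - triangle (Suc s) = 0) = m + n"
proof (rule Least_equality)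
  show "Suc (prod_encode (m, n)) - triangle (Suc (m + n)) = 0"
    by (simp add: prod_encode_def)
  fix s assume s: "Suc (prod_encode (m, n)) - triangle (Suc s) = 0"
  show "m + n \<le> s"
  proof (rule ccontr)
    assume "\<not> m + n \<le> s"
    then have "triangle (Suc s) \<le> triangle (m + n)" by (intro triangle_mono) auto
    with s show False by (simp add: prod_encode_def)
  qed
qed

lemma recursive_diagonal:
  "recursive 1 (\<lambda>xs. fst (prod_decode (xs ! 0)) + snd (prod_decode (xs ! 0)))"
proof -
  have "recursive 2 (\<lambda>xs. Suc (xs ! 1) - triangle (Suc (xs ! 0)))"
    by (intro recursive_diff recursive_Suc recursive_triangle recursive_proj0 recursive_proj1) auto
  then have "recursive 1 (\<lambda>xs. LEAST n. Suc ((n # xs) ! 1) - triangle (Suc ((n # xs) ! 0)) = 0)"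
  proof (intro recursive.minimisation allI impI)
    fix xs :: "nat list"
    show "\<exists>n. Suc ((n # xs) ! 1) - triangle (Suc ((n # xs) ! 0)) = 0"
      by (rule exI[of _ "xs ! 0"]) simp
  qed (simp add: numeral_2_eq_2)
  moreover have "(LEAST n. Suc z - triangle (Suc n) = 0) = fst (prod_decode z) + snd (prod_decode z)"
    for z
    using diagonal_prod_encode[of "fst (prod_decode z)" "snd (prod_decode z)"] by simp
  ultimately show ?thesis by simp
qed

lemma recursive_fst_decode:
  assumes "recursive k f"
  shows "recursive k (\<lambda>xs. fst (prod_decode (f xs)))"
proof -
  have "recursive 1 (\<lambda>xs. xs ! 0 - triangle (fst (prod_decode (xs ! 0)) + snd (prod_decode (xs ! 0))))"
    by (intro recursive_diff recursive_triangle recursive_diagonal recursive_proj0) auto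
  moreover have "z - triangle (fst (prod_decode z) + snd (prod_decode z)) = fst (prod_decode z)" for z
  proof -
    have "prod_encode (fst (prod_decode z), snd (prod_decode z)) = z" by simp
    then show ?thesis unfolding prod_encode_def by (simp add: case_prod_beta)
  qed
  ultimately have "recursive 1 (\<lambda>xs. fst (prod_decode (xs ! 0)))" by simp
  from recursive_comp1[OF this assms] show ?thesis by simp
qed

lemma recursive_snd_decode:
  assumes "recursive k f"
  shows "recursive k (\<lambda>xs. snd (prod_decode (f xs)))"
proof -
  have "recursive 1 (\<lambda>xs. fst (prod_decode (xs ! 0)) + snd (prod_decode (xs ! 0))
      - fst (prod_decode (xs ! 0)))"
    by (intro recursive_diff recursive_fst_decode recursive_diagonal recursive_proj0) auto
  then have "recursive 1 (\<lambda>xs. snd (prod_decode (xs ! 0)))" by simp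
  from recursive_comp1[OF this assms] show ?thesis by simp
qed

lemma recursive_prod_encode:
  assumes "recursive k f" "recursive k g"
  shows "recursive k (\<lambda>xs. prod_encode (f xs, g xs))"
  unfolding prod_encode_def using assms by (auto intro!: recursive_add recursive_triangle)

definition rec1 :: "(nat \<Rightarrow> nat) \<Rightarrow> bool" where
  "rec1 f \<longleftrightarrow> recursive 1 (\<lambda>xs. f (xs ! 0))"

lemma rec1_id: "rec1 (\<lambda>x. x)"
  unfolding rec1_def by (rule recursive_proj0) simp

lemma rec1_const: "rec1 (\<lambda>_. c)"
  unfolding rec1_def by (induction c) (auto intro: recursive.zero recursive_Suc)

lemma rec1_comp: "rec1 f \<Longrightarrow> rec1 g \<Longrightarrow> rec1 (\<lambda>x. f (g x))"
  unfolding rec1_def using recursive_comp1[of "\<lambda>xs. f (xs ! 0)" 1 "\<lambda>xs. g (xs ! 0)"] by simp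

lemma rec1_Suc: "rec1 f \<Longrightarrow> rec1 (\<lambda>x. Suc (f x))"
  unfolding rec1_def by (rule recursive_Suc)

lemma rec1_arith:
  assumes "rec1 f" "rec1 g"
  shows "rec1 (\<lambda>x. f x + g x)" "rec1 (\<lambda>x. f x - g x)" "rec1 (\<lambda>x. f x * g x)"
    "rec1 (\<lambda>x. prod_encode (f x, g x))"
  using assms unfolding rec1_def
  by (auto intro: recursive_add recursive_diff recursive_mult recursive_prod_encode)

lemma rec1_decode:
  assumes "rec1 f"
  shows "rec1 (\<lambda>x. fst (prod_decode (f x)))" "rec1 (\<lambda>x. snd (prod_decode (f x)))"
  using assms unfolding rec1_def by (auto intro: recursive_fst_decode recursive_snd_decode)

text \<open>The parameter \<open>x\<close>, the counter \<open>n\<close> and the accumulator \<open>r\<close> of a recursion are packed into one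
  number, so that unary functions suffice from here on.\<close>

lemma rec1_rec:
  assumes a: "rec1 a" and h: "rec1 h" and m: "rec1 m"
  shows "rec1 (\<lambda>x. rec_nat (a x) (\<lambda>n r. h (prod_encode (x, prod_encode (n, r)))) (m x))"
proof -
  have "recursive 3 (\<lambda>xs. h (prod_encode (xs ! 2, prod_encode (xs ! 0, xs ! 1))))"
    using recursive_comp1[OF h[unfolded rec1_def], of 3
        "\<lambda>xs. prod_encode (xs ! 2, prod_encode (xs ! 0, xs ! 1))"]
    by (simp add: recursive_prod_encode recursive_proj0 recursive_proj1 recursive_proj2
        flip: One_nat_def)
  from recursive_rec2[OF a[unfolded rec1_def] this]
  have "recursive 2 (\<lambda>xs. rec_nat (a (xs ! 1))
      (\<lambda>n r. h (prod_encode (xs ! 1, prod_encode (n, r)))) (xs ! 0))"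
    by simp
  from recursive_comp2[OF this m[unfolded rec1_def] rec1_id[unfolded rec1_def]]
  show ?thesis unfolding rec1_def by simp
qed

lemma rec1_if:
  assumes "rec1 b" "rec1 f" "rec1 g"
  shows "rec1 (\<lambda>x. if b x = 0 then f x else g x)"
proof -
  have "rec1 (\<lambda>x. (1 - b x) * f x + (1 - (1 - b x)) * g x)"
    by (intro rec1_arith rec1_const assms)
  moreover have "(\<lambda>x. (1 - b x) * f x + (1 - (1 - b x)) * g x) = (\<lambda>x. if b x = 0 then f x else g x)"
    by auto
  ultimately show ?thesis by simp
qed

text \<open>Programs are written as functions between types with a fixed injective coding by numbers, and
  shown computable by closure rules that follow their syntax. The coding of lists is
  \<^const>\<open>list_encode\<close>, as in \<^const>\<open>word_code\<close>.\<close>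

class enc =
  fixes enc :: "'a \<Rightarrow> nat"
  assumes enc_inj: "enc x = enc y \<longleftrightarrow> x = y"

instantiation nat :: enc
begin
definition "enc (n::nat) = n"
instance by standard (simp add: enc_nat_def)
end

instantiation bool :: enc
begin
definition "enc (b::bool) = (of_bool b :: nat)"
instance by standard (simp add: enc_bool_def)
end

instantiation prod :: (enc, enc) enc
begin
definition "enc p = prod_encode (enc (fst p), enc (snd p))"
instance by standard (auto simp: enc_prod_def enc_inj)
end

instantiation list :: (enc) enc
begin
definition "enc xs = list_encode (map enc xs)"
instance
proof
  fix xs ys :: "'a list"
  have "inj (enc :: 'a \<Rightarrow> nat)" by (simp add: inj_def enc_inj)
  then show "enc xs = enc ys \<longleftrightarrow> xs = ys"
    by (auto simp: enc_list_def list_encode_eq inj_map_eq_map)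
qed
end

definition computable :: "('a::enc \<Rightarrow> 'b::enc) \<Rightarrow> bool" where
  "computable f \<longleftrightarrow> (\<exists>g. rec1 g \<and> (\<forall>x. g (enc x) = enc (f x)))"

lemma computableE:
  assumes "computable f"
  obtains g where "rec1 g" "\<And>x. g (enc x) = enc (f x)"
  using assms unfolding computable_def by auto

named_theorems computable_intros

lemma computable_id [computable_intros]: "computable (\<lambda>x. x)"
  unfolding computable_def using rec1_id by auto

lemma computable_const [computable_intros]: "computable (\<lambda>_. c)"
  unfolding computable_def using rec1_const[of "enc c"] by (intro exI[of _ "\<lambda>_. enc c"]) auto

lemma computable_comp:
  assumes "computable f" "computable g"
  shows "computable (\<lambda>x. f (g x))"
proof -
  obtain f' where "rec1 f'" "\<And>x. f' (enc x) = enc (f x)" using assms(1) by (rule computableE) (rule that)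
  moreover obtain g' where "rec1 g'" "\<And>x. g' (enc x) = enc (g x)"
    using assms(2) by (rule computableE) (rule that)
  ultimately show ?thesis
    unfolding computable_def by (intro exI[of _ "\<lambda>x. f' (g' x)"]) (auto intro: rec1_comp)
qed

lemma computable_binary:
  assumes "\<And>f g. rec1 f \<Longrightarrow> rec1 g \<Longrightarrow> rec1 (\<lambda>x. h (f x) (g x))"
    and "\<And>x y. h (enc x) (enc y) = enc (op x y)"
    and "computable f" "computable g"
  shows "computable (\<lambda>x. op (f x) (g x))"
proof -
  obtain f' where "rec1 f'" "\<And>x. f' (enc x) = enc (f x)" using assms(3) by (rule computableE) (rule that)
  moreover obtain g' where "rec1 g'" "\<And>x. g' (enc x) = enc (g x)"
    using assms(4) by (rule computableE) (rule that)
  ultimately show ?thesis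
    unfolding computable_def using assms(1,2) by (intro exI[of _ "\<lambda>x. h (f' x) (g' x)"]) auto
qed

lemma computable_Pair [computable_intros]:
  "computable f \<Longrightarrow> computable g \<Longrightarrow> computable (\<lambda>x. (f x, g x))"
  by (rule computable_binary[where h = "\<lambda>x y. prod_encode (x, y)" and op = Pair and f = f and g = g])
    (auto intro: rec1_arith simp: enc_prod_def)

lemma computable_fst [computable_intros]: "computable f \<Longrightarrow> computable (\<lambda>x. fst (f x))"
  by (rule computable_binary[where h = "\<lambda>x _. fst (prod_decode x)" and op = "\<lambda>x _. fst x" and f = f and g = f])
    (auto intro: rec1_decode simp: enc_prod_def)

lemma computable_snd [computable_intros]: "computable f \<Longrightarrow> computable (\<lambda>x. snd (f x))"
  by (rule computable_binary[where h = "\<lambda>x _. snd (prod_decode x)" and op = "\<lambda>x _. snd x" and f = f and g = f])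
    (auto intro: rec1_decode simp: enc_prod_def)

lemma computable_nat_arith [computable_intros]:
  fixes f g :: "'a::enc \<Rightarrow> nat"
  assumes "computable f" "computable g"
  shows "computable (\<lambda>x. f x + g x)" "computable (\<lambda>x. f x - g x)" "computable (\<lambda>x. f x * g x)"
    "computable (\<lambda>x. f x \<le> g x)"
proof -
  show "computable (\<lambda>x. f x + g x)" using assms
    by (rule computable_binary[where h = "(+)" and op = "(+)", rotated 2]) (auto intro: rec1_arith simp: enc_nat_def)
  show "computable (\<lambda>x. f x - g x)" using assms
    by (rule computable_binary[where h = "(-)" and op = "(-)", rotated 2]) (auto intro: rec1_arith simp: enc_nat_def)
  show "computable (\<lambda>x. f x * g x)" using assms
    by (rule computable_binary[where h = "(*)" and op = "(*)", rotated 2]) (auto intro: rec1_arith simp: enc_nat_def)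
  show "computable (\<lambda>x. f x \<le> g x)" using assms
    by (rule computable_binary[where h = "\<lambda>x y. 1 - (x - y)" and op = "(\<le>)", rotated 2])
      (auto intro!: rec1_arith rec1_const simp: enc_nat_def enc_bool_def of_bool_def)
qed

lemma computable_eq [computable_intros]:
  assumes "computable f" "computable g"
  shows "computable (\<lambda>x. f x = g x)"
proof (rule computable_binary[where h = "\<lambda>x y. 1 - ((x - y) + (y - x))" and op = "(=)", OF _ _ assms])
  show "1 - ((enc x - enc y) + (enc y - enc x)) = enc (x = y)" for x y :: 'b
    using enc_inj[of x y] by (auto simp: enc_bool_def of_bool_def)
qed (intro rec1_arith rec1_const)

lemma computable_if [computable_intros]:
  assumes "computable b" "computable f" "computable g"
  shows "computable (\<lambda>x. if b x then f x else g x)"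
proof -
  obtain b' where "rec1 b'" "\<And>x. b' (enc x) = enc (b x)" using assms(1) by (rule computableE) (rule that)
  moreover obtain f' where "rec1 f'" "\<And>x. f' (enc x) = enc (f x)"
    using assms(2) by (rule computableE) (rule that)
  moreover obtain g' where "rec1 g'" "\<And>x. g' (enc x) = enc (g x)"
    using assms(3) by (rule computableE) (rule that)
  ultimately show ?thesis
    unfolding computable_def
    by (intro exI[of _ "\<lambda>x. if b' x = 0 then g' x else f' x"]) (auto intro: rec1_if simp: enc_bool_def)
qed

lemma computable_not [computable_intros]:
  assumes "computable b" shows "computable (\<lambda>x. \<not> b x)"
proof -
  have "computable (\<lambda>x. if b x then False else True)" by (intro computable_intros assms)
  moreover have "(\<lambda>x. if b x then False else True) = (\<lambda>x. \<not> b x)" by auto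
  ultimately show ?thesis by simp
qed

lemma computable_conj [computable_intros]:
  assumes "computable b" "computable c" shows "computable (\<lambda>x. b x \<and> c x)"
proof -
  have "computable (\<lambda>x. if b x then c x else False)" by (intro computable_intros assms)
  moreover have "(\<lambda>x. if b x then c x else False) = (\<lambda>x. b x \<and> c x)" by auto
  ultimately show ?thesis by simp
qed

lemma computable_rec_nat [computable_intros]:
  fixes m :: "'a::enc \<Rightarrow> nat" and a :: "'a \<Rightarrow> 'b::enc"
  assumes "computable (\<lambda>p. h (fst p) (fst (snd p)) (snd (snd p)))" "computable a" "computable m"
  shows "computable (\<lambda>x. rec_nat (a x) (h x) (m x))"
proof -
  obtain h' where h: "rec1 h'" "\<And>p. h' (enc p) = enc (h (fst p) (fst (snd p)) (snd (snd p)))"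
    using assms(1) by (rule computableE) (rule that)
  obtain a' where a: "rec1 a'" "\<And>x. a' (enc x) = enc (a x)" using assms(2) by (rule computableE) (rule that)
  obtain m' where m: "rec1 m'" "\<And>x. m' (enc x) = enc (m x)" using assms(3) by (rule computableE) (rule that)
  have "rec_nat (enc (a x)) (\<lambda>n r. h' (prod_encode (enc x, prod_encode (n, r)))) n
      = enc (rec_nat (a x) (h x) n)" for x n
  proof (induction n)
    case (Suc n)
    then show ?case using h(2)[of "(x, (n, rec_nat (a x) (h x) n))"]
      by (simp add: enc_prod_def enc_nat_def)
  qed simp
  with rec1_rec[OF a(1) h(1) m(1)] show ?thesis
    unfolding computable_def
    by (intro exI[of _ "\<lambda>x. rec_nat (a' x) (\<lambda>n r. h' (prod_encode (x, prod_encode (n, r)))) (m' x)"])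
      (simp add: a m enc_nat_def)
qed

lemma computable_Cons [computable_intros]:
  "computable f \<Longrightarrow> computable g \<Longrightarrow> computable (\<lambda>x. f x # g x)"
  by (rule computable_binary[where h = "\<lambda>x y. Suc (prod_encode (x, y))" and op = "(#)" and f = f and g = g])
    (auto intro!: rec1_arith rec1_Suc simp: enc_list_def)

lemma computable_case_list [computable_intros]:
  assumes "computable l" "computable a"
    "computable (\<lambda>p. b (fst p) (fst (snd p)) (snd (snd p)))"
  shows "computable (\<lambda>x. case l x of [] \<Rightarrow> a x | y # ys \<Rightarrow> b x y ys)"
proof -
  obtain l' where l: "rec1 l'" "\<And>x. l' (enc x) = enc (l x)" using assms(1) by (rule computableE) (rule that)
  obtain a' where a: "rec1 a'" "\<And>x. a' (enc x) = enc (a x)" using assms(2) by (rule computableE) (rule that)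
  obtain b' where b: "rec1 b'" "\<And>p. b' (enc p) = enc (b (fst p) (fst (snd p)) (snd (snd p)))"
    using assms(3) by (rule computableE) (rule that)
  have "rec1 (\<lambda>x. if l' x = 0 then a' x else b' (prod_encode (x, l' x - 1)))"
    by (intro rec1_if l a rec1_comp[OF b(1)] rec1_arith rec1_id rec1_const)
  moreover have "b' (prod_encode (enc x, prod_encode (enc y, enc ys))) = enc (b x y ys)" for x y ys
    using b(2)[of "(x, y, ys)"] by (simp add: enc_prod_def)
  ultimately show ?thesis
    unfolding computable_def
    by (intro exI[of _ "\<lambda>x. if l' x = 0 then a' x else b' (prod_encode (x, l' x - 1))"])
      (auto simp: a l enc_list_def split: list.split)
qed

lemma length_le_list_encode: "length xs \<le> list_encode xs"
proof (induction xs)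
  case (Cons x xs)
  then show ?case using le_prod_encode_2[of "list_encode xs" x] by simp
qed simp

text \<open>A fold over a list is an iteration of the step that consumes its first entry; the code of the
  list bounds the number of steps.\<close>

lemma computable_foldl [computable_intros]:
  assumes f: "computable (\<lambda>p. f (fst p) (fst (snd p)) (snd (snd p)))"
    and s: "computable s" and l: "computable l"
  shows "computable (\<lambda>x. foldl (f x) (s x) (l x))"
proof -
  define step where "step x n st = (case fst st of [] \<Rightarrow> st | y # ys \<Rightarrow> (ys, f x (snd st) y))"
    for x and n :: nat and st
  have cf: "computable u \<Longrightarrow> computable v \<Longrightarrow> computable w \<Longrightarrow> computable (\<lambda>p. f (u p) (v p) (w p))"
    for u :: "'z::enc \<Rightarrow> 'a" and v w
    using computable_comp[OF f, of "\<lambda>p. (u p, v p, w p)"] by (simp add: computable_Pair)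
  have "computable (\<lambda>x. enc (l x))"
    using l unfolding computable_def by (simp add: enc_nat_def)
  then have "computable (\<lambda>x. snd (rec_nat (l x, s x) (step x) (enc (l x))))"
    unfolding step_def by (intro computable_intros cf s l)
  moreover have "snd (rec_nat (xs, t) (step x) n) = foldl (f x) t xs" if "length xs \<le> n" for x xs t n
  proof -
    have step_iter: "rec_nat st (step x) (Suc n) = rec_nat (step x n st) (step x) n" for n st
      by (induction n) (simp_all add: step_def)
    from that show ?thesis
    proof (induction n arbitrary: xs t)
      case (Suc n)
      have nil: "rec_nat ([], t) (step x) m = ([], t)" for m
        by (induction m) (simp_all add: step_def)
      show ?case
      proof (cases xs)
        case (Cons y ys)
        then have "step x n (xs, t) = (ys, f x t y)" by (simp add: step_def)
        with Suc.IH[of ys "f x t y"] Suc.prems Cons show ?thesis by (simp only: step_iter) simp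
      qed (simp only: nil, simp)
    qed simp
  qed
  ultimately show ?thesis
    using length_le_list_encode[of "map enc (l x)" for x] by (simp add: enc_list_def)
qed

lemma computable_rev [computable_intros]:
  assumes "computable l" shows "computable (\<lambda>x. rev (l x))"
proof -
  have "computable (\<lambda>x. foldl (\<lambda>s a. a # s) [] (l x))" by (intro computable_intros assms)
  moreover have "foldl (\<lambda>s a. a # s) t xs = rev xs @ t" for t xs :: "'b list"
    by (induction xs arbitrary: t) auto
  ultimately show ?thesis by simp
qed

lemma computable_foldr [computable_intros]:
  assumes f: "computable (\<lambda>p. f (fst p) (fst (snd p)) (snd (snd p)))"
    and s: "computable s" and l: "computable l"
  shows "computable (\<lambda>x. foldr (f x) (l x) (s x))"
proof -
  have "computable (\<lambda>p. f (fst p) (snd (snd p)) (fst (snd p)))"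
    using computable_comp[OF f, of "\<lambda>p. (fst p, snd (snd p), fst (snd p))"]
    by (simp add: computable_intros)
  then have "computable (\<lambda>x. foldl (\<lambda>s a. f x a s) (s x) (rev (l x)))"
    by (intro computable_intros s l) auto
  then show ?thesis by (simp add: foldr_conv_foldl)
qed

lemma computable_map [computable_intros]:
  assumes f: "computable (\<lambda>p. f (fst p) (snd p))" and l: "computable l"
  shows "computable (\<lambda>x. map (f x) (l x))"
proof -
  have "computable (\<lambda>p. f (fst p) (fst (snd p)))"
    using computable_comp[OF f, of "\<lambda>p. (fst p, fst (snd p))"] by (simp add: computable_intros)
  then have "computable (\<lambda>x. foldr (\<lambda>a r. f x a # r) (l x) [])"
    by (intro computable_intros l) auto
  moreover have "foldr (\<lambda>a r. f x a # r) xs [] = map (f x) xs" for x xs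
    by (induction xs) auto
  ultimately show ?thesis by simp
qed

lemma computable_append [computable_intros]:
  assumes "computable f" "computable g" shows "computable (\<lambda>x. f x @ g x)"
proof -
  have "computable (\<lambda>x. foldr (\<lambda>a r. a # r) (f x) (g x))" by (intro computable_intros assms)
  moreover have "foldr (\<lambda>a r. a # r) xs ys = xs @ ys" for xs ys :: "'b list" by (induction xs) auto
  ultimately show ?thesis by simp
qed

lemma computable_concat [computable_intros]:
  assumes "computable f" shows "computable (\<lambda>x. concat (f x))"
  unfolding concat_conv_foldr by (intro computable_intros assms)

lemma computable_length [computable_intros]:
  assumes "computable f" shows "computable (\<lambda>x. length (f x))"
proof -
  have "computable (\<lambda>x. foldr (\<lambda>_ n. n + 1) (f x) (0::nat))" by (intro computable_intros assms)
  moreover have "foldr (\<lambda>_ n. n + 1) xs 0 = length xs" for xs :: "'b list" by (induction xs) auto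
  ultimately show ?thesis by simp
qed

lemma computable_all_less [computable_intros]:
  fixes m :: "'a::enc \<Rightarrow> nat"
  assumes P: "computable (\<lambda>p. P (fst p) (snd p))" and m: "computable m"
  shows "computable (\<lambda>x. \<forall>i < m x. P x i)"
proof -
  have "computable (\<lambda>p. P (fst p) (fst (snd p)))"
    using computable_comp[OF P, of "\<lambda>p. (fst p, fst (snd p))"] by (simp add: computable_intros)
  then have "computable (\<lambda>x. rec_nat True (\<lambda>i r. r \<and> P x i) (m x))"
    by (intro computable_intros m) auto
  moreover have "rec_nat True (\<lambda>i r. r \<and> P x i) n \<longleftrightarrow> (\<forall>i < n. P x i)" for x n
    by (induction n) (auto simp: less_Suc_eq)
  ultimately show ?thesis by simp
qed

lemma computable_power2 [computable_intros]:
  assumes "computable m" shows "computable (\<lambda>x. 2 ^ m x :: nat)"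
proof -
  have "computable (\<lambda>x. rec_nat (1::nat) (\<lambda>_ r. 2 * r) (m x))" by (intro computable_intros assms)
  moreover have "rec_nat (1::nat) (\<lambda>_ r. 2 * r) n = 2 ^ n" for n by (induction n) auto
  ultimately show ?thesis by simp
qed

text \<open>Such a table lets an algorithm use data that merely exist, without being given by a formula.\<close>

lemma computable_finite_table:
  assumes "finite {x. f x \<noteq> c}"
  shows "computable f"
proof -
  have "computable f" if "finite S" "{x. f x \<noteq> c} \<subseteq> S" for f :: "'a \<Rightarrow> 'b" and S
    using that
  proof (induction S arbitrary: f rule: finite_induct)
    case empty
    then have "f = (\<lambda>_. c)" by auto
    then show ?case by (simp add: computable_const)
  next
    case (insert a S)
    then have "computable (f(a := c))" by (intro insert.IH) auto
    then have "computable (\<lambda>x. if x = a then f a else (f(a := c)) x)" by (intro computable_intros)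
    moreover have "(\<lambda>x. if x = a then f a else (f(a := c)) x) = f" by auto
    ultimately show ?case by simp
  qed
  from this[OF assms order_refl] show ?thesis .
qed

subsection \<open>Words as data\<close>

definition letter_code :: "nat \<times> bool \<Rightarrow> nat" where
  "letter_code l = 2 * fst l + of_bool (snd l)"

lemma word_code_enc: "word_code w = enc (map letter_code w)"
  by (simp add: word_code_def enc_list_def letter_code_def case_prod_unfold comp_def enc_nat_def)

lemma computable_letter_code [computable_intros]:
  assumes "computable f" shows "computable (\<lambda>x. letter_code (f x))"
proof -
  have "computable (\<lambda>x. 2 * fst (f x) + (if snd (f x) then 1 else 0))" by (intro computable_intros assms)
  then show ?thesis by (simp add: letter_code_def of_bool_def)
qed

lemma computable_word_decode:
  obtains conv :: "nat list \<Rightarrow> word" where "computable conv" "\<And>w. conv (map letter_code w) = w"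
proof
  define dec where "dec n = rec_nat (0::nat, False)
      (\<lambda>_ p. if snd p then (fst p + 1, False) else (fst p, True)) n" for n
  have dec: "dec n = (n div 2, odd n)" for n by (induction n) (auto simp: dec_def)
  show "computable (\<lambda>xs. map (\<lambda>n. dec n) xs)" unfolding dec_def by (intro computable_intros)
  show "map (\<lambda>n. dec n) (map letter_code w) = w" for w
    by (induction w) (auto simp: dec letter_code_def)
qed

lemma word_problem_solvableI:
  assumes "computable f" and "\<And>w. w \<in> words (length gs) \<Longrightarrow> f w = (word_val G gs w = \<one>\<^bsub>G\<^esub>)"
  shows "word_problem_solvable G gs"
proof -
  obtain conv :: "nat list \<Rightarrow> word" where conv: "computable conv" "\<And>w. conv (map letter_code w) = w"
    by (rule computable_word_decode) (rule that)
  from computable_comp[OF assms(1) conv(1)] obtain g where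
    g: "rec1 g" "\<And>x. g (enc x) = enc (f (conv x))" by (rule computableE) (rule that)
  show ?thesis unfolding word_problem_solvable_def
    using g assms(2)
    by (intro exI[of _ "\<lambda>xs. g (xs ! 0)"]) (auto simp: rec1_def word_code_enc enc_bool_def conv)
qed

text \<open>The first argument of the conjugacy test is constant; the second is the reduction, which acts on
  codes of words like a recursive function.\<close>

lemma word_problem_solvable_if_conjugacy:
  assumes "conjugacy_problem_solvable G gs" and "computable r" and x: "x \<in> words (length gs)"
    and r: "\<And>w. w \<in> words (length hs) \<Longrightarrow> r w \<in> words (length gs)"
    and iff: "\<And>w. w \<in> words (length hs) \<Longrightarrow> (word_val H hs w = \<one>\<^bsub>H\<^esub>) \<longleftrightarrow>
      (\<exists>g \<in> carrier G. word_val G gs (r w) = inv\<^bsub>G\<^esub> g \<otimes>\<^bsub>G\<^esub> word_val G gs x \<otimes>\<^bsub>G\<^esub> g)"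
  shows "word_problem_solvable H hs"
proof -
  obtain f where f: "recursive 2 f" "\<And>x y. x \<in> words (length gs) \<Longrightarrow> y \<in> words (length gs) \<Longrightarrow>
      f [word_code x, word_code y] = of_bool (\<exists>g \<in> carrier G.
        word_val G gs y = inv\<^bsub>G\<^esub> g \<otimes>\<^bsub>G\<^esub> word_val G gs x \<otimes>\<^bsub>G\<^esub> g)"
    using assms(1) unfolding conjugacy_problem_solvable_def by auto
  obtain conv :: "nat list \<Rightarrow> word" where conv: "computable conv" "\<And>w. conv (map letter_code w) = w"
    by (rule computable_word_decode) (rule that)
  have "computable (\<lambda>w. map letter_code (r (conv w)))"
    by (intro computable_intros computable_comp[OF assms(2) conv(1)])
  then obtain g where g: "rec1 g" "\<And>w. g (enc w) = enc (map letter_code (r (conv w)))"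
    by (rule computableE) (rule that)
  have "recursive 1 (\<lambda>xs. f [word_code x, g (xs ! 0)])"
    using recursive_comp2[OF f(1)] rec1_const[of "word_code x"] g(1) unfolding rec1_def by blast
  then show ?thesis unfolding word_problem_solvable_def
    using f(2)[OF x r] iff
    by (intro exI[of _ "\<lambda>xs. f [word_code x, g (xs ! 0)]"]) (auto simp: word_code_enc g(2) conv(2))
qed

section \<open>Words, presented groups and free reduction\<close>

abbreviation linv :: "nat \<times> bool \<Rightarrow> nat \<times> bool" where
  "linv l \<equiv> (fst l, \<not> snd l)"

lemma words_Nil [simp]: "[] \<in> words k"
  by (simp add: words_def)

lemma words_Cons [simp]: "l # w \<in> words k \<longleftrightarrow> fst l < k \<and> w \<in> words k"
  by (auto simp: words_def)

lemma words_append [simp]: "u @ v \<in> words k \<longleftrightarrow> u \<in> words k \<and> v \<in> words k"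
  by (auto simp: words_def)

lemma words_mono: "w \<in> words k \<Longrightarrow> k \<le> l \<Longrightarrow> w \<in> words l"
  by (auto simp: words_def)

lemma winv_Nil [simp]: "winv [] = []"
  by (simp add: winv_def)

lemma winv_Cons: "winv (l # w) = winv w @ [linv l]"
  by (simp add: winv_def case_prod_beta)

lemma winv_append [simp]: "winv (u @ v) = winv v @ winv u"
  by (simp add: winv_def)

lemma winv_words [simp]: "winv w \<in> words k \<longleftrightarrow> w \<in> words k"
  by (induction w) (auto simp: winv_Cons)

lemma winv_winv [simp]: "winv (winv w) = w"
  by (induction w) (auto simp: winv_Cons)

lemma gen_words [simp]: "gen i \<in> words k \<longleftrightarrow> i < k"
  by (simp add: gen_def)

subsection \<open>Values of words in a group\<close>

context group
begin

lemma word_val_closed [simp]: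
  assumes "set gs \<subseteq> carrier G" "w \<in> words (length gs)"
  shows "word_val G gs w \<in> carrier G"
  using assms(2) by (induction w) (use assms(1) nth_mem in \<open>auto simp: subset_iff\<close>)

lemma word_val_append:
  assumes "set gs \<subseteq> carrier G" "u \<in> words (length gs)" "v \<in> words (length gs)"
  shows "word_val G gs (u @ v) = word_val G gs u \<otimes> word_val G gs v"
  using assms(2)
proof (induction u)
  case (Cons l u)
  then have "gs ! fst l \<in> carrier G" using assms(1) nth_mem by auto
  with Cons assms show ?case by (simp add: m_assoc)
qed (use assms in simp)

lemma word_val_winv:
  assumes "set gs \<subseteq> carrier G" "w \<in> words (length gs)"
  shows "word_val G gs (winv w) = inv (word_val G gs w)"
  using assms(2)
proof (induction w)
  case (Cons l w)
  then have "gs ! fst l \<in> carrier G" using assms(1) nth_mem by auto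
  with Cons assms show ?case by (simp add: winv_Cons word_val_append inv_mult_group)
qed simp

lemma word_val_gen:
  assumes "set gs \<subseteq> carrier G" "i < length gs"
  shows "word_val G gs (gen i) = gs ! i"
proof -
  have "gs ! i \<in> carrier G" using assms nth_mem by blast
  then show ?thesis by (simp add: gen_def)
qed

end

lemma word_val_take:
  "w \<in> words (length gs) \<Longrightarrow> word_val G (gs @ hs) w = word_val G gs w"
  by (induction w) (auto simp: nth_append)

subsection \<open>The equivalence relation of a presentation\<close>

lemma pres_eq_words: "pres_eq k R u v \<Longrightarrow> u \<in> words k \<and> v \<in> words k"
  by (induction rule: pres_eq.induct) auto

lemma pres_eq_context:
  assumes "pres_eq k R w w'" "u \<in> words k" "v \<in> words k"
  shows "pres_eq k R (u @ w @ v) (u @ w' @ v)"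
  using assms
proof (induction rule: pres_eq.induct)
  case (cancel u' v' i e)
  then show ?case using pres_eq.cancel[of "u @ u'" k "v' @ v" i R e] by simp
next
  case (relator u' v' r)
  then show ?case using pres_eq.relator[of "u @ u'" k "v' @ v" r R] by simp
qed (auto intro: pres_eq.intros)

lemma pres_eq_append:
  assumes "pres_eq k R u u'" "pres_eq k R v v'"
  shows "pres_eq k R (u @ v) (u' @ v')"
  using pres_eq_context[OF assms(1), of "[]" v] pres_eq_context[OF assms(2), of u' "[]"]
    pres_eq_words[OF assms(1)] pres_eq_words[OF assms(2)] by (auto intro: pres_eq.trans)

lemma pres_eq_winv_right: "w \<in> words k \<Longrightarrow> pres_eq k R (w @ winv w) []"
proof (induction w)
  case (Cons l w)
  have "pres_eq k R ([l] @ (w @ winv w) @ [linv l]) ([l] @ [] @ [linv l])"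
    using Cons by (intro pres_eq_context) auto
  moreover have "pres_eq k R ([l] @ [] @ [linv l]) []"
    using pres_eq.cancel[of "[]" k "[]" "fst l" R "snd l"] Cons.prems by simp
  ultimately show ?case by (auto simp: winv_Cons intro: pres_eq.trans)
qed (auto intro: pres_eq.refl)

lemma pres_eq_winv_left: "w \<in> words k \<Longrightarrow> pres_eq k R (winv w @ w) []"
  using pres_eq_winv_right[of "winv w" k R] by simp

lemma pres_eq_invariant:
  assumes "pres_eq k R w w'"
    and "\<And>u v i e. u \<in> words k \<Longrightarrow> v \<in> words k \<Longrightarrow> i < k \<Longrightarrow> f (u @ [(i, e), (i, \<not> e)] @ v) = f (u @ v)"
    and "\<And>u v r. u \<in> words k \<Longrightarrow> v \<in> words k \<Longrightarrow> r \<in> R \<Longrightarrow> r \<in> words k \<Longrightarrow> f (u @ r @ v) = f (u @ v)"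
  shows "f w = f w'"
  using assms(1) by (induction rule: pres_eq.induct) (use assms(2,3) in auto)

lemma (in group) word_val_pres_eq:
  assumes gs: "set gs \<subseteq> carrier G" and R: "\<And>r. r \<in> R \<Longrightarrow> r \<in> words (length gs) \<Longrightarrow> word_val G gs r = \<one>"
    and "pres_eq (length gs) R w w'"
  shows "word_val G gs w = word_val G gs w'"
  using assms(3)
proof (rule pres_eq_invariant)
  fix u v i e assume *: "u \<in> words (length gs)" "v \<in> words (length gs)" "i < length gs"
  have "gs ! i \<in> carrier G" using gs * nth_mem by blast
  then have "word_val G gs [(i, e), (i, \<not> e)] = \<one>" by (cases e) auto
  moreover have "[(i, e), (i, \<not> e)] \<in> words (length gs)" using * by simp
  ultimately have "word_val G gs ([(i, e), (i, \<not> e)] @ v) = word_val G gs v"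
    using gs * by (simp only: word_val_append l_one word_val_closed)
  moreover have "[(i, e), (i, \<not> e)] @ v \<in> words (length gs)" using * by simp
  ultimately show "word_val G gs (u @ [(i, e), (i, \<not> e)] @ v) = word_val G gs (u @ v)"
    using gs * by (simp only: word_val_append)
next
  fix u v r assume *: "u \<in> words (length gs)" "v \<in> words (length gs)" "r \<in> R" "r \<in> words (length gs)"
  with gs R show "word_val G gs (u @ r @ v) = word_val G gs (u @ v)"
    by (simp add: word_val_append)
qed

lemma pres_class_eq_iff:
  assumes "u \<in> words k"
  shows "pres_class k R u = pres_class k R v \<longleftrightarrow> pres_eq k R u v"
proof
  assume "pres_class k R u = pres_class k R v"
  moreover have "u \<in> pres_class k R u" using assms by (auto simp: pres_class_def intro: pres_eq.refl)
  ultimately show "pres_eq k R u v" by (auto simp: pres_class_def intro: pres_eq.sym)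
next
  assume "pres_eq k R u v"
  then show "pres_class k R u = pres_class k R v"
    by (auto simp: pres_class_def intro: pres_eq.sym pres_eq.trans)
qed

text \<open>The union in the definition of the product runs over representatives that all give the same
  class.\<close>

lemma presented_group_mult:
  assumes "u \<in> words k" "v \<in> words k"
  shows "pres_class k R u \<otimes>\<^bsub>presented_group k R\<^esub> pres_class k R v = pres_class k R (u @ v)"
proof -
  have eq: "pres_class k R (x @ y) = pres_class k R (u @ v)"
    if "x \<in> pres_class k R u" "y \<in> pres_class k R v" for x y
  proof -
    from that have "pres_eq k R (u @ v) (x @ y)" by (auto simp: pres_class_def intro: pres_eq_append)
    with assms show ?thesis by (metis pres_class_eq_iff words_append)
  qed
  have "u \<in> pres_class k R u" "v \<in> pres_class k R v"
    using assms by (auto simp: pres_class_def intro: pres_eq.refl)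
  then have "pres_class k R u \<noteq> {}" "pres_class k R v \<noteq> {}" by blast+
  then show ?thesis by (simp add: presented_group_def eq cong: SUP_cong)
qed

lemma group_presented_group: "group (presented_group k R)"
proof (rule groupI)
  show "\<one>\<^bsub>presented_group k R\<^esub> \<in> carrier (presented_group k R)"
    by (auto simp: presented_group_def)
  fix x assume "x \<in> carrier (presented_group k R)"
  then obtain u where u: "u \<in> words k" "x = pres_class k R u" by (auto simp: presented_group_def)
  have one: "\<one>\<^bsub>presented_group k R\<^esub> = pres_class k R []" by (simp add: presented_group_def)
  show "\<one>\<^bsub>presented_group k R\<^esub> \<otimes>\<^bsub>presented_group k R\<^esub> x = x"
    using u by (simp add: one presented_group_mult)
  have "pres_class k R (winv u) \<otimes>\<^bsub>presented_group k R\<^esub> x = \<one>\<^bsub>presented_group k R\<^esub>"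
    using u by (simp add: one presented_group_mult pres_class_eq_iff pres_eq_winv_left)
  moreover have "pres_class k R (winv u) \<in> carrier (presented_group k R)"
    using u by (simp add: presented_group_def)
  ultimately show "\<exists>y\<in>carrier (presented_group k R). y \<otimes>\<^bsub>presented_group k R\<^esub> x = \<one>\<^bsub>presented_group k R\<^esub>"
    by blast
  fix y assume "y \<in> carrier (presented_group k R)"
  then obtain v where v: "v \<in> words k" "y = pres_class k R v" by (auto simp: presented_group_def)
  have "pres_class k R (u @ v) \<in> carrier (presented_group k R)"
    using u v by (simp add: presented_group_def)
  then show "x \<otimes>\<^bsub>presented_group k R\<^esub> y \<in> carrier (presented_group k R)"
    using u v by (simp add: presented_group_mult)
  fix z assume "z \<in> carrier (presented_group k R)"
  then obtain w where "w \<in> words k" "z = pres_class k R w" by (auto simp: presented_group_def)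
  then show "x \<otimes>\<^bsub>presented_group k R\<^esub> y \<otimes>\<^bsub>presented_group k R\<^esub> z
      = x \<otimes>\<^bsub>presented_group k R\<^esub> (y \<otimes>\<^bsub>presented_group k R\<^esub> z)"
    using u v by (simp add: presented_group_mult)
qed

lemma length_pres_gens [simp]: "length (pres_gens k R) = k"
  by (simp add: pres_gens_def)

lemma pres_gens_closed: "set (pres_gens k R) \<subseteq> carrier (presented_group k R)"
  by (auto simp: pres_gens_def presented_group_def)

lemma word_val_presented_group:
  assumes "w \<in> words k"
  shows "word_val (presented_group k R) (pres_gens k R) w = pres_class k R w"
  using assms
proof (induction w)
  case Nil
  then show ?case by (simp add: presented_group_def)
next
  case (Cons l w)
  interpret group "presented_group k R" by (rule group_presented_group)
  obtain i e where l: "l = (i, e)" by fastforce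
  have "pres_class k R [(i, True)] \<in> carrier (presented_group k R)"
    "pres_class k R [(i, False)] \<in> carrier (presented_group k R)"
    using Cons.prems l by (auto simp: presented_group_def)
  moreover have "pres_class k R [(i, False)] \<otimes>\<^bsub>presented_group k R\<^esub> pres_class k R [(i, True)]
      = \<one>\<^bsub>presented_group k R\<^esub>"
    using Cons.prems l pres_eq.cancel[of "[]" k "[]" i R False]
    by (simp add: presented_group_mult pres_class_eq_iff) (simp add: presented_group_def pres_class_eq_iff)
  ultimately have "inv\<^bsub>presented_group k R\<^esub> (pres_class k R [(i, True)]) = pres_class k R [(i, False)]"
    using inv_equality by blast
  with Cons l show ?case
    by (auto simp: pres_gens_def gen_def presented_group_mult)
qed

lemma presented_group_carrier:
  "carrier (presented_group k R) = pres_class k R ` words k"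
  by (simp add: presented_group_def)

lemma word_val_presented_group_eq_iff:
  assumes "u \<in> words k" "v \<in> words k"
  shows "word_val (presented_group k R) (pres_gens k R) u = word_val (presented_group k R) (pres_gens k R) v
    \<longleftrightarrow> pres_eq k R u v"
  using assms by (simp add: word_val_presented_group pres_class_eq_iff)

lemma word_val_presented_group_one_iff:
  assumes "u \<in> words k"
  shows "word_val (presented_group k R) (pres_gens k R) u = \<one>\<^bsub>presented_group k R\<^esub> \<longleftrightarrow> pres_eq k R u []"
  using word_val_presented_group_eq_iff[OF assms, of "[]" R] by simp

subsection \<open>Free reduction\<close>

text \<open>Reducing from the right by this operation, each letter cancels at most once, and the result does
  not depend on cancellations in the original word (\<open>fred_cancel\<close>).\<close>

definition push :: "nat \<times> bool \<Rightarrow> word \<Rightarrow> word" where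
  "push l w = (case w of [] \<Rightarrow> [l] | l' # w' \<Rightarrow> if l' = linv l then w' else l # w)"

definition fred :: "word \<Rightarrow> word" where
  "fred w = foldr push w []"

lemma reduced_Nil [simp]: "reduced []"
  by (simp add: reduced_def)

lemma reduced_Cons: "reduced (l # w) \<longleftrightarrow> reduced w \<and> (w = [] \<or> hd w \<noteq> linv l)"
proof
  assume *: "reduced (l # w)"
  have "reduced w"
    unfolding reduced_def
  proof (intro notI)
    assume "\<exists>u i e v. w = u @ [(i, e), (i, \<not> e)] @ v"
    then obtain u i e v where "l # w = (l # u) @ [(i, e), (i, \<not> e)] @ v" by auto
    with * show False unfolding reduced_def by blast
  qed
  moreover have "hd w \<noteq> linv l" if "w \<noteq> []"
  proof
    assume "hd w = linv l"
    with that have "l # w = [] @ [(fst l, snd l), (fst l, \<not> snd l)] @ tl w"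
      by (cases w) auto
    with * show False unfolding reduced_def by blast
  qed
  ultimately show "reduced w \<and> (w = [] \<or> hd w \<noteq> linv l)" by blast
next
  assume *: "reduced w \<and> (w = [] \<or> hd w \<noteq> linv l)"
  show "reduced (l # w)"
    unfolding reduced_def
  proof (intro notI)
    assume "\<exists>u i e v. l # w = u @ [(i, e), (i, \<not> e)] @ v"
    then obtain u i e v where eq: "l # w = u @ [(i, e), (i, \<not> e)] @ v" by blast
    show False
    proof (cases u)
      case Nil
      with eq * show False by auto
    next
      case (Cons x u')
      with eq have "w = u' @ [(i, e), (i, \<not> e)] @ v" by simp
      with * show False unfolding reduced_def by blast
    qed
  qed
qed

lemma reduced_push: "reduced w \<Longrightarrow> reduced (push l w)"
  by (cases w) (auto simp: push_def reduced_Cons)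

lemma reduced_fred: "reduced (fred w)"
  unfolding fred_def by (induction w) (auto intro: reduced_push)

lemma push_push: "reduced w \<Longrightarrow> push l (push (linv l) w) = w"
  by (cases w; cases "tl w") (auto simp: push_def reduced_Cons prod_eq_iff)

lemma fred_cancel: "fred (u @ [(i, e), (i, \<not> e)] @ v) = fred (u @ v)"
  using push_push[OF reduced_fred[of v], of "(i, e)"] by (simp add: fred_def)

lemma push_words: "fst l < k \<Longrightarrow> w \<in> words k \<Longrightarrow> push l w \<in> words k"
  by (cases w) (auto simp: push_def)

lemma pres_eq_push:
  assumes "fst l < k" "w \<in> words k"
  shows "pres_eq k R (l # w) (push l w)"
proof (cases "w \<noteq> [] \<and> hd w = linv l")
  case True
  then obtain w' where "w = linv l # w'" by (metis list.collapse)
  with assms show ?thesis using pres_eq.cancel[of "[]" k w' "fst l" R "snd l"] by (simp add: push_def)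
next
  case False
  then have "push l w = l # w" by (cases w) (auto simp: push_def)
  with assms show ?thesis by (simp add: pres_eq.refl)
qed

lemma fred_words_pres_eq:
  assumes "w \<in> words k" shows "fred w \<in> words k \<and> pres_eq k R w (fred w)"
  using assms
proof (induction w)
  case (Cons l w)
  then have "pres_eq k R (l # w) (l # fred w)" using pres_eq_context[of k R w "fred w" "[l]" "[]"] by simp
  with Cons show ?case unfolding fred_def
    by (auto intro: pres_eq_push push_words pres_eq.trans)
qed (auto simp: fred_def intro: pres_eq.refl)

lemma fred_words: "w \<in> words k \<Longrightarrow> fred w \<in> words k"
  using fred_words_pres_eq by blast

lemma pres_eq_fred: "w \<in> words k \<Longrightarrow> pres_eq k R w (fred w)"
  using fred_words_pres_eq by blast

lemma (in group) word_val_fred: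
  assumes "set gs \<subseteq> carrier G" "w \<in> words (length gs)"
  shows "word_val G gs (fred w) = word_val G gs w"
  using word_val_pres_eq[OF assms(1) _ pres_eq_fred[OF assms(2), of "{}"]] by simp

lemma computable_push [computable_intros]:
  assumes "computable l" "computable w"
  shows "computable (\<lambda>x. push (l x) (w x))"
  unfolding push_def by (intro computable_intros computable_comp[OF assms(1)] computable_comp[OF assms(2)] assms)

section \<open>The groups \<open>PL\<^sub>2\<close>, \<open>F\<close> and \<open>T\<close>\<close>

abbreviation finv :: "('a \<Rightarrow> 'b) \<Rightarrow> 'b \<Rightarrow> 'a" where
  "finv \<equiv> inv_into UNIV"

lemma dyadicI: "x * 2 ^ n \<in> \<int> \<Longrightarrow> x \<in> dyadic"
  by (auto simp: dyadic_def field_simps elim!: Ints_cases)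

lemma dyadicE:
  assumes "x \<in> dyadic"
  obtains n where "\<And>m. n \<le> m \<Longrightarrow> x * 2 ^ m \<in> \<int>"
proof -
  obtain k n where x: "x = of_int k / 2 ^ n" using assms by (auto simp: dyadic_def)
  have "x * 2 ^ m \<in> \<int>" if "n \<le> m" for m
  proof -
    have "x * 2 ^ m = of_int k * 2 ^ (m - n)"
      using that by (simp add: x power_diff)
    then show ?thesis by simp
  qed
  then show ?thesis by (rule that)
qed

lemma dyadic_add: assumes "x \<in> dyadic" "y \<in> dyadic" shows "x + y \<in> dyadic"
proof -
  obtain n where n: "\<And>m. n \<le> m \<Longrightarrow> x * 2 ^ m \<in> \<int>" using assms(1) by (rule dyadicE) (rule that)
  obtain n' where "\<And>m. n' \<le> m \<Longrightarrow> y * 2 ^ m \<in> \<int>" using assms(2) by (rule dyadicE) (rule that)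
  with n have "x * 2 ^ max n n' + y * 2 ^ max n n' \<in> \<int>" by (intro Ints_add) auto
  then show ?thesis by (intro dyadicI[of _ "max n n'"]) (simp add: distrib_right)
qed

lemma dyadic_mult: assumes "x \<in> dyadic" "y \<in> dyadic" shows "x * y \<in> dyadic"
proof -
  obtain n where n: "\<And>m. n \<le> m \<Longrightarrow> x * 2 ^ m \<in> \<int>" using assms(1) by (rule dyadicE) (rule that)
  obtain n' where "\<And>m. n' \<le> m \<Longrightarrow> y * 2 ^ m \<in> \<int>" using assms(2) by (rule dyadicE) (rule that)
  with n have "(x * 2 ^ n) * (y * 2 ^ n') \<in> \<int>" using Ints_mult by blast
  then show ?thesis by (intro dyadicI[of _ "n + n'"]) (simp add: power_add mult_ac)
qed

lemma dyadic_of_int [simp]: "of_int k \<in> dyadic"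
  by (rule dyadicI[of _ 0]) simp

lemma dyadic_numeral [simp]: "0 \<in> dyadic" "1 \<in> dyadic" "numeral k \<in> dyadic"
  using dyadic_of_int[of 0] dyadic_of_int[of 1] dyadic_of_int[of "numeral k"] by simp_all

lemma dyadic_div_power [simp]: "of_int k / 2 ^ n \<in> dyadic"
  by (auto simp: dyadic_def)

lemma dyadic_powi [simp]: "2 powi k \<in> dyadic"
  by (rule dyadicI[of _ "nat (- k)"]) (auto simp: power_int_def field_simps)

lemma dyadic_minus: "x \<in> dyadic \<Longrightarrow> - x \<in> dyadic"
  using dyadic_mult[OF dyadic_of_int[of "-1"], of x] by simp

lemma dyadic_diff: "x \<in> dyadic \<Longrightarrow> y \<in> dyadic \<Longrightarrow> x - y \<in> dyadic"
  using dyadic_add[OF _ dyadic_minus, of x y] by simp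

subsection \<open>The group \<open>PL\<^sub>2\<close>\<close>

text \<open>Membership in \<^const>\<open>PL2\<close> is tested with any locally finite set of dyadic exceptional points
  instead of the exact set of breakpoints, since a composition may be smooth where its factors are
  not.\<close>

definition dyadic_affine_at :: "(real \<Rightarrow> real) \<Rightarrow> real \<Rightarrow> bool" where
  "dyadic_affine_at f x \<longleftrightarrow> (\<exists>s b. (\<exists>k::int. s = 2 powi k \<or> s = - (2 powi k)) \<and>
     (\<forall>\<^sub>F y in nhds x. f y = s * y + b))"

lemma dyadic_affine_atE:
  assumes "dyadic_affine_at f x"
  obtains s b and k :: int where "\<forall>\<^sub>F y in nhds x. f y = s * y + b" "s = 2 powi k \<or> s = - (2 powi k)"
  using assms unfolding dyadic_affine_at_def by blast

lemma affine_has_derivative: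
  fixes f :: "real \<Rightarrow> real"
  assumes "\<forall>\<^sub>F y in nhds x. f y = s * y + b"
  shows "(f has_real_derivative s) (at x)"
proof -
  have "((\<lambda>y. s * y + b) has_real_derivative s) (at x)"
    by (auto intro!: derivative_eq_intros)
  then show ?thesis
    using DERIV_cong_ev[of x x f "\<lambda>y. s * y + b" s s] assms by simp
qed

lemma dyadic_affine_at_PL2: "f \<in> PL2 \<Longrightarrow> x \<notin> breakpoints f \<Longrightarrow> dyadic_affine_at f x"
proof -
  assume f: "f \<in> PL2" and x: "x \<notin> breakpoints f"
  obtain a b where ab: "\<forall>\<^sub>F y in nhds x. f y = a * y + b" using x by (auto simp: breakpoints_def)
  obtain k :: int where "(f has_real_derivative 2 powi k) (at x) \<or> (f has_real_derivative - (2 powi k)) (at x)"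
    using f x unfolding PL2_def by blast
  with affine_has_derivative[OF ab] have "a = 2 powi k \<or> a = - (2 powi k)"
    using DERIV_unique by blast
  with ab show ?thesis unfolding dyadic_affine_at_def by blast
qed

text \<open>At an exceptional point that is not a breakpoint the map is affine nearby, and its slope is that
  at the neighbouring points, which are not exceptional.\<close>

lemma PL2I:
  assumes homeo: "homeomorphism UNIV UNIV f g" and dyadic: "f ` dyadic = dyadic"
    and S: "S \<subseteq> dyadic" "\<And>a b. finite (S \<inter> {a..b})" and aff: "\<And>x. x \<notin> S \<Longrightarrow> dyadic_affine_at f x"
  shows "f \<in> PL2" "breakpoints f \<subseteq> S"
proof -
  show bp: "breakpoints f \<subseteq> S"
    using aff by (auto simp: breakpoints_def dyadic_affine_at_def)
  have "\<exists>k::int. (f has_real_derivative 2 powi k) (at x) \<or> (f has_real_derivative - (2 powi k)) (at x)"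
    if x: "x \<notin> breakpoints f" for x
  proof -
    obtain a b where ab: "\<forall>\<^sub>F y in nhds x. f y = a * y + b" using x by (auto simp: breakpoints_def)
    then obtain e where e: "e > 0" "\<And>y. dist y x < e \<Longrightarrow> f y = a * y + b"
      unfolding eventually_nhds_metric by blast
    \<comment> \<open>Some point close to \<open>x\<close> is not exceptional, and there the slope is known.\<close>
    have "infinite {x<..<x + e}" using e by simp
    moreover have "finite (S \<inter> {x<..<x + e})"
      by (rule finite_subset[OF _ S(2)[of x "x + e"]]) auto
    ultimately have "\<not> {x<..<x + e} \<subseteq> S" by (metis inf.absorb_iff2)
    then obtain z where z: "z \<in> {x<..<x + e}" "z \<notin> S" by blast
    obtain s b' k where sb: "\<forall>\<^sub>F y in nhds z. f y = s * y + b'" "s = 2 powi k \<or> s = - (2 powi k)"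
      by (rule dyadic_affine_atE[OF aff[OF z(2)]]) (rule that)
    have "\<forall>\<^sub>F y in nhds z. y \<in> {x<..<x + e}" using z(1) by (intro eventually_nhds_in_open) auto
    then have "\<forall>\<^sub>F y in nhds z. f y = a * y + b"
      by eventually_elim (rule e(2), simp add: dist_real_def)
    then have "a = s"
      using affine_has_derivative[OF sb(1)] affine_has_derivative DERIV_unique by blast
    with affine_has_derivative[OF ab] sb(2) show ?thesis by blast
  qed
  with bp S dyadic homeo show "f \<in> PL2"
    unfolding PL2_def by (auto intro: finite_subset[OF Int_mono[OF bp order_refl]])
qed

lemma PL2_homeomorphism:
  assumes "f \<in> PL2" shows "bij f" "continuous_on UNIV f" "continuous_on UNIV (finv f)"
    "homeomorphism UNIV UNIV f (finv f)"
proof -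
  obtain g where g: "homeomorphism UNIV UNIV f g" using assms by (auto simp: PL2_def)
  then have fg: "f (g x) = x" "g (f x) = x" for x by (auto simp: homeomorphism_def)
  then show "bij f" by (metis bijI')
  have "finv f = g" using fg by (intro Hilbert_Choice.inv_equality) auto
  with g show "continuous_on UNIV f" "continuous_on UNIV (finv f)" "homeomorphism UNIV UNIV f (finv f)"
    by (auto simp: homeomorphism_def)
qed

lemma PL2_inv: assumes "f \<in> PL2" shows "f (finv f x) = x" "finv f (f x) = x"
  using PL2_homeomorphism[OF assms] by (auto simp: bij_def surj_f_inv_f)

lemma PL2_dyadic_iff: assumes "f \<in> PL2" shows "f x \<in> dyadic \<longleftrightarrow> x \<in> dyadic"
proof -
  have "f ` dyadic = dyadic" "inj f" using assms PL2_homeomorphism[OF assms] by (auto simp: PL2_def bij_def)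
  then show ?thesis by (metis inj_image_mem_iff)
qed

lemma continuous_on_UNIV_filterlim:
  fixes f :: "real \<Rightarrow> real"
  assumes "continuous_on UNIV f"
  shows "filterlim f (nhds (f x)) (nhds x)"
  using assms tendsto_at_iff_tendsto_nhds[of f x]
  by (simp add: continuous_on_eq_continuous_at isCont_def)

lemma PL2_comp:
  assumes f: "f \<in> PL2" and g: "g \<in> PL2"
  shows "f \<circ> g \<in> PL2" "breakpoints (f \<circ> g) \<subseteq> breakpoints g \<union> g -` breakpoints f"
proof -
  let ?S = "breakpoints g \<union> g -` breakpoints f"
  have homeo: "homeomorphism UNIV UNIV (f \<circ> g) (finv g \<circ> finv f)"
    using PL2_homeomorphism(4)[OF f] PL2_homeomorphism(4)[OF g] by (rule homeomorphism_compose[rotated])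
  have dy: "(f \<circ> g) ` dyadic = dyadic"
  proof -
    have "f ` dyadic = dyadic" "g ` dyadic = dyadic" using f g by (auto simp: PL2_def)
    then show ?thesis by (metis image_comp)
  qed
  have "breakpoints g \<subseteq> dyadic" "breakpoints f \<subseteq> dyadic" using f g by (auto simp: PL2_def)
  then have S: "?S \<subseteq> dyadic" using PL2_dyadic_iff[OF g] by blast
  have fin: "finite (?S \<inter> {a..b})" for a b
  proof -
    have "compact (g ` {a..b})"
      using PL2_homeomorphism(2)[OF g] by (intro compact_continuous_image) (auto intro: continuous_on_subset)
    then obtain B where B: "\<And>y. y \<in> g ` {a..b} \<Longrightarrow> \<bar>y\<bar> \<le> B"
      using compact_imp_bounded bounded_real by metis
    have "finite (breakpoints f \<inter> {- B..B})" using f by (simp add: PL2_def)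
    then have "finite (g -` (breakpoints f \<inter> {- B..B}))"
      using PL2_homeomorphism(1)[OF g] by (intro finite_vimageI) (auto simp: bij_def)
    then have "finite (g -` breakpoints f \<inter> {a..b})"
      by (rule finite_subset[rotated]) (use B in \<open>auto simp: abs_le_iff\<close>, smt (verit) B atLeastAtMost_iff imageI)
    moreover have "finite (breakpoints g \<inter> {a..b})" using g by (simp add: PL2_def)
    ultimately show ?thesis by (simp add: Int_Un_distrib2)
  qed
  have aff: "dyadic_affine_at (f \<circ> g) x" if nb: "x \<notin> ?S" for x
  proof -
    obtain s b k where sb: "\<forall>\<^sub>F y in nhds x. g y = s * y + b" "s = 2 powi k \<or> s = - (2 powi k)"
      using nb by (auto intro: dyadic_affine_atE[OF dyadic_affine_at_PL2[OF g, of x]])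
    obtain s' b' k' where sb': "\<forall>\<^sub>F y in nhds (g x). f y = s' * y + b'" "s' = 2 powi k' \<or> s' = - (2 powi k')"
      using nb by (auto intro: dyadic_affine_atE[OF dyadic_affine_at_PL2[OF f, of "g x"]])
    have "filterlim g (nhds (g x)) (nhds x)"
      using PL2_homeomorphism(2)[OF g] by (rule continuous_on_UNIV_filterlim)
    then have "\<forall>\<^sub>F y in nhds x. f (g y) = s' * g y + b'"
      using sb'(1) by (rule eventually_compose_filterlim[rotated])
    with sb(1) have "\<forall>\<^sub>F y in nhds x. (f \<circ> g) y = (s' * s) * y + (s' * b + b')"
      by eventually_elim (simp add: algebra_simps)
    moreover have "s' * s = 2 powi (k' + k) \<or> s' * s = - (2 powi (k' + k))"
      using sb(2) sb'(2) by (auto simp: power_int_add)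
    ultimately show ?thesis unfolding dyadic_affine_at_def by blast
  qed
  show "f \<circ> g \<in> PL2" "breakpoints (f \<circ> g) \<subseteq> ?S"
    using PL2I[OF homeo dy S fin aff] by blast+
qed

lemma PL2_inverse:
  assumes f: "f \<in> PL2"
  shows "finv f \<in> PL2" "breakpoints (finv f) \<subseteq> f ` breakpoints f"
proof -
  let ?S = "f ` breakpoints f"
  have homeo: "homeomorphism UNIV UNIV (finv f) f"
    using PL2_homeomorphism(4)[OF f] homeomorphism_sym by blast
  have fd: "f ` dyadic = dyadic" using f by (simp add: PL2_def)
  then have "finv f ` dyadic = finv f ` f ` dyadic" by simp
  then have dy: "finv f ` dyadic = dyadic" by (simp add: image_image PL2_inv[OF f])
  have S: "?S \<subseteq> dyadic" using f fd by (auto simp: PL2_def)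
  have fin: "finite (?S \<inter> {a..b})" for a b
  proof -
    have "compact (finv f ` {a..b})"
      using PL2_homeomorphism(3)[OF f] by (intro compact_continuous_image) (auto intro: continuous_on_subset)
    then obtain B where B: "\<And>y. y \<in> finv f ` {a..b} \<Longrightarrow> \<bar>y\<bar> \<le> B"
      using compact_imp_bounded bounded_real by metis
    have "?S \<inter> {a..b} \<subseteq> f ` (breakpoints f \<inter> {- B..B})"
    proof
      fix y assume y: "y \<in> ?S \<inter> {a..b}"
      then obtain x where x: "x \<in> breakpoints f" "y = f x" by blast
      with y f have "x \<in> finv f ` {a..b}" by (auto simp: PL2_inv[OF f] intro: image_eqI[of _ _ "f x"])
      then have "\<bar>x\<bar> \<le> B" by (rule B)
      then have "x \<in> breakpoints f \<inter> {- B..B}" using x by auto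
      with x(2) show "y \<in> f ` (breakpoints f \<inter> {- B..B})" by blast
    qed
    moreover have "finite (breakpoints f \<inter> {- B..B})" using f by (simp add: PL2_def)
    ultimately show ?thesis using finite_subset by blast
  qed
  have aff: "dyadic_affine_at (finv f) y" if "y \<notin> ?S" for y
  proof -
    have "f (finv f y) = y" by (rule PL2_inv[OF f])
    then have "finv f y \<notin> breakpoints f" using that by (metis imageI)
    then obtain s b k where sb: "\<forall>\<^sub>F x in nhds (finv f y). f x = s * x + b" "s = 2 powi k \<or> s = - (2 powi k)"
      by (auto intro: dyadic_affine_atE[OF dyadic_affine_at_PL2[OF f, of "finv f y"]])
    then have "s \<noteq> 0" by auto
    have "filterlim (finv f) (nhds (finv f y)) (nhds y)"
      using PL2_homeomorphism(3)[OF f] by (rule continuous_on_UNIV_filterlim)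
    then have "\<forall>\<^sub>F z in nhds y. f (finv f z) = s * finv f z + b"
      using sb(1) by (rule eventually_compose_filterlim[rotated])
    then have "\<forall>\<^sub>F z in nhds y. finv f z = (1 / s) * z + (- b / s)"
      by eventually_elim (use \<open>s \<noteq> 0\<close> in \<open>simp add: PL2_inv[OF f] field_simps\<close>)
    moreover have "1 / s = 2 powi (- k) \<or> 1 / s = - (2 powi (- k))"
      using sb(2) by (auto simp: power_int_minus field_simps)
    ultimately show ?thesis unfolding dyadic_affine_at_def by blast
  qed
  show "finv f \<in> PL2" "breakpoints (finv f) \<subseteq> ?S"
    using PL2I[OF homeo dy S fin aff] by blast+
qed

lemma PL2_id: "id \<in> PL2"
proof (rule PL2I(1)[of id id "{}"])
  fix x :: real
  have "\<forall>\<^sub>F y in nhds x. id y = 1 * y + 0" by simp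
  moreover have "(1::real) = 2 powi 0 \<or> (1::real) = - (2 powi 0)" by simp
  ultimately show "dyadic_affine_at id x" unfolding dyadic_affine_at_def by blast
qed (auto simp: homeomorphism_def)

lemma PL2_group_simps [simp]:
  "carrier PL2_group = PL2" "f \<otimes>\<^bsub>PL2_group\<^esub> g = f \<circ> g" "\<one>\<^bsub>PL2_group\<^esub> = id"
  by (simp_all add: PL2_group_def)

lemma group_PL2: "group PL2_group"
proof (rule groupI)
  fix f assume "f \<in> carrier PL2_group"
  then have "finv f \<in> PL2" "finv f \<circ> f = id" by (auto simp: PL2_inverse PL2_inv fun_eq_iff)
  then show "\<exists>y\<in>carrier PL2_group. y \<otimes>\<^bsub>PL2_group\<^esub> f = \<one>\<^bsub>PL2_group\<^esub>" by auto
qed (auto simp: PL2_comp PL2_id)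

interpretation PL2: group PL2_group
  by (rule group_PL2)

lemma inv_PL2 [simp]: "f \<in> PL2 \<Longrightarrow> inv\<^bsub>PL2_group\<^esub> f = finv f"
  by (rule PL2.inv_equality) (auto simp: PL2_inverse PL2_inv fun_eq_iff)

lemma strict_mono_inverse:
  fixes f g :: "real \<Rightarrow> real"
  assumes "strict_mono f" "\<And>x. f (g x) = x"
  shows "strict_mono g"
proof (rule strict_monoI)
  fix x y :: real assume "x < y"
  then have "f (g x) < f (g y)" by (simp add: assms(2))
  then show "g x < g y" using strict_mono_less[OF assms(1)] by blast
qed

text \<open>A practical criterion: \<open>f\<close> is increasing, invertible, and affine with dyadic data on the cells
  of a dyadic mesh.\<close>

lemma PL2_mesh:
  assumes mono: "strict_mono f" and fg: "\<And>x. f (g x) = x" "\<And>x. g (f x) = x"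
    and cells: "\<And>k::int. \<exists>s::int. f (of_int k / 2 ^ N) \<in> dyadic \<and>
      (\<forall>x. of_int k / 2 ^ N \<le> x \<and> x \<le> (of_int k + 1) / 2 ^ N \<longrightarrow>
        f x = f (of_int k / 2 ^ N) + 2 powi s * (x - of_int k / 2 ^ N))"
  shows "f \<in> PL2"
proof -
  define cell where "cell x = \<lfloor>x * 2 ^ N\<rfloor>" for x :: real
  have cell: "of_int (cell x) / 2 ^ N \<le> x" "x < (of_int (cell x) + 1) / 2 ^ N" for x
    by (auto simp: cell_def field_simps) linarith
  have monog: "strict_mono g"
    by (rule strict_mono_inverse[OF mono fg(1)])
  have surj: "surj f" "surj g" using fg by (metis surjI)+
  have "continuous_on UNIV f" "continuous_on UNIV g"
    using surj strict_mono_leD[OF mono] strict_mono_leD[OF monog] by (auto intro!: continuous_onI_mono)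
  with surj fg have homeo: "homeomorphism UNIV UNIV f g" by (auto simp: homeomorphism_def)
  have fd: "f x \<in> dyadic \<longleftrightarrow> x \<in> dyadic" for x
  proof -
    obtain s where s: "f (of_int (cell x) / 2 ^ N) \<in> dyadic"
      "f x = f (of_int (cell x) / 2 ^ N) + 2 powi s * (x - of_int (cell x) / 2 ^ N)"
      using cells[of "cell x"] cell[of x] by (metis less_imp_le)
    then have "x = of_int (cell x) / 2 ^ N + 2 powi (- s) * (f x - f (of_int (cell x) / 2 ^ N))"
      by (simp add: power_int_minus flip: mult.assoc)
    with s show ?thesis
      by (metis dyadic_add dyadic_diff dyadic_mult dyadic_powi dyadic_div_power)
  qed
  have dy: "f ` dyadic = dyadic"
  proof
    show "f ` dyadic \<subseteq> dyadic" by (auto simp: fd)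
    show "dyadic \<subseteq> f ` dyadic"
    proof
      fix y :: real assume "y \<in> dyadic"
      then have "g y \<in> dyadic" using fd[of "g y"] by (simp add: fg)
      then show "y \<in> f ` dyadic" by (rule image_eqI[rotated]) (simp add: fg)
    qed
  qed
  define S :: "real set" where "S = (\<lambda>k. of_int k / 2 ^ N) ` UNIV"
  have S: "S \<subseteq> dyadic" by (auto simp: S_def)
  have fin: "finite (S \<inter> {a..b})" for a b
  proof (rule finite_subset)
    show "S \<inter> {a..b} \<subseteq> (\<lambda>k. of_int k / 2 ^ N) ` {\<lfloor>a * 2 ^ N\<rfloor>..\<lceil>b * 2 ^ N\<rceil>}"
      by (auto simp: S_def field_simps floor_le_iff le_ceiling_iff intro!: imageI)
  qed simp
  have aff: "dyadic_affine_at f x" if "x \<notin> S" for x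
  proof -
    have "x \<noteq> of_int (cell x) / 2 ^ N" using that by (auto simp: S_def)
    with cell[of x] have "x \<in> {of_int (cell x) / 2 ^ N <..< (of_int (cell x) + 1) / 2 ^ N}" by auto
    then have ev: "\<forall>\<^sub>F y in nhds x. y \<in> {of_int (cell x) / 2 ^ N <..< (of_int (cell x) + 1) / 2 ^ N}"
      by (intro eventually_nhds_in_open) auto
    obtain s :: int where s: "\<And>y. of_int (cell x) / 2 ^ N \<le> y \<Longrightarrow> y \<le> (of_int (cell x) + 1) / 2 ^ N \<Longrightarrow>
        f y = f (of_int (cell x) / 2 ^ N) + 2 powi s * (y - of_int (cell x) / 2 ^ N)"
      using cells[of "cell x"] by blast
    from ev have "\<forall>\<^sub>F y in nhds x. f y = 2 powi s * y +
        (f (of_int (cell x) / 2 ^ N) - 2 powi s * (of_int (cell x) / 2 ^ N))"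
      by eventually_elim (use s in \<open>simp add: algebra_simps\<close>)
    then show ?thesis unfolding dyadic_affine_at_def by blast
  qed
  show ?thesis by (rule PL2I(1)[OF homeo dy S fin aff])
qed

subsection \<open>Thompson's group \<open>F\<close>\<close>

lemma strict_mono_inv_PL2: "f \<in> PL2 \<Longrightarrow> strict_mono f \<Longrightarrow> strict_mono (finv f)"
  by (rule strict_mono_inverse[of f]) (simp_all add: PL2_inv)

lemma thompson_F_comp:
  assumes f: "f \<in> thompson_F" and g: "g \<in> thompson_F" shows "f \<circ> g \<in> thompson_F"
proof -
  have PL: "f \<in> PL2" "g \<in> PL2" "strict_mono f" "strict_mono g"
    "finite (breakpoints f)" "finite (breakpoints g)" using f g by (auto simp: thompson_F_def)
  have fin: "finite (breakpoints (f \<circ> g))"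
    using PL PL2_homeomorphism(1)[of g] PL2_comp(2)[of f g]
    by (auto intro!: finite_subset[OF PL2_comp(2)] finite_vimageI simp: bij_def)
  obtain M N k l where 1: "\<forall>x>M. f x = x + of_int k" "\<forall>x<N. f x = x + of_int l"
    using f unfolding thompson_F_def by blast
  obtain M' N' k' l' where 2: "\<forall>x>M'. g x = x + of_int k'" "\<forall>x<N'. g x = x + of_int l'"
    using g unfolding thompson_F_def by blast
  have "(f \<circ> g) x = x + of_int (k + k')" if "x > max M' (M - of_int k')" for x
    using that 1 2 by simp
  moreover have "(f \<circ> g) x = x + of_int (l + l')" if "x < min N' (N - of_int l')" for x
    using that 1 2 by simp
  ultimately have "\<exists>M N (k::int) (l::int). (\<forall>x>M. (f \<circ> g) x = x + of_int k) \<and> (\<forall>x<N. (f \<circ> g) x = x + of_int l)"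
    by blast
  with PL fin show ?thesis unfolding thompson_F_def by (auto simp: PL2_comp strict_mono_o)
qed

lemma thompson_F_inv:
  assumes f: "f \<in> thompson_F" shows "finv f \<in> thompson_F"
proof -
  have PL: "f \<in> PL2" "strict_mono f" "finite (breakpoints f)" using f by (auto simp: thompson_F_def)
  have fin: "finite (breakpoints (finv f))"
    using PL PL2_inverse(2)[of f] finite_subset by blast
  obtain M N k l where 1: "\<forall>x>M. f x = x + of_int k" "\<forall>x<N. f x = x + of_int l"
    using f unfolding thompson_F_def by blast
  have "finv f x = x + of_int (- k)" if "x > M + of_int k" for x
  proof -
    have "f (x - of_int k) = x" using 1(1) that by simp
    then show ?thesis using PL2_inv(2)[OF PL(1), of "x - of_int k"] by simp
  qed
  moreover have "finv f x = x + of_int (- l)" if "x < N + of_int l" for x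
  proof -
    have "f (x - of_int l) = x" using 1(2) that by simp
    then show ?thesis using PL2_inv(2)[OF PL(1), of "x - of_int l"] by simp
  qed
  ultimately have "\<exists>M N (k::int) (l::int). (\<forall>x>M. finv f x = x + of_int k) \<and> (\<forall>x<N. finv f x = x + of_int l)"
    by blast
  with PL fin show ?thesis unfolding thompson_F_def by (auto simp: PL2_inverse strict_mono_inv_PL2)
qed

lemma thompson_F_id: "id \<in> thompson_F"
proof -
  have "\<forall>\<^sub>F y in nhds x. id y = 1 * y + 0" for x :: real by simp
  then have "breakpoints id = {}" unfolding breakpoints_def by blast
  moreover have "\<exists>M N (k::int) (l::int). (\<forall>x>M. id x = x + of_int k) \<and> (\<forall>x<N. id x = x + (of_int l :: real))"
    by (intro exI[of _ 0]) auto
  ultimately show ?thesis unfolding thompson_F_def by (auto simp: PL2_id strict_mono_def)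
qed

lemma thompson_F_PL2: "f \<in> thompson_F \<Longrightarrow> f \<in> PL2"
  by (simp add: thompson_F_def)

lemma subgroup_F: "subgroup thompson_F PL2_group"
  by (rule PL2.subgroupI) (auto simp: thompson_F_PL2 thompson_F_comp thompson_F_inv intro: thompson_F_id)

lemma group_F: "group F_group"
  unfolding F_group_def by (rule subgroup.subgroup_is_group[OF subgroup_F group_PL2])

lemma alpha_F: "alpha \<in> thompson_F"
proof -
  have mono: "strict_mono alpha" by (auto simp: strict_mono_def alpha_def)
  have "alpha \<in> PL2"
  proof (rule PL2_mesh[where N = 0 and g = "\<lambda>x. x + 1"])
    show "\<exists>s::int. alpha (of_int k / 2 ^ 0) \<in> dyadic \<and>
      (\<forall>x. of_int k / 2 ^ 0 \<le> x \<and> x \<le> (of_int k + 1) / 2 ^ 0 \<longrightarrow>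
        alpha x = alpha (of_int k / 2 ^ 0) + 2 powi s * (x - of_int k / 2 ^ 0))" for k :: int
      by (rule exI[of _ 0]) (simp add: alpha_def dyadic_diff)
  qed (use mono in \<open>auto simp: alpha_def\<close>)
  moreover have "\<forall>\<^sub>F y in nhds x. alpha y = 1 * y + (-1)" for x :: real by (simp add: alpha_def)
  then have "breakpoints alpha = {}" unfolding breakpoints_def by blast
  moreover have "\<exists>M N (k::int) (l::int). (\<forall>x>M. alpha x = x + of_int k) \<and> (\<forall>x<N. alpha x = x + of_int l)"
    by (rule exI[of _ 0], rule exI[of _ 0], rule exI[of _ "-1"], rule exI[of _ "-1"]) (simp add: alpha_def)
  ultimately show ?thesis using mono unfolding thompson_F_def by simp
qed

lemma beta_F: "beta \<in> thompson_F"
proof -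
  have mono: "strict_mono beta" by (auto simp: strict_mono_def beta_def)
  have PL: "beta \<in> PL2"
  proof (rule PL2_mesh[where N = 0 and g = "\<lambda>x. if x \<le> 0 then x else if x \<le> 1 then 2 * x else x + 1"])
    fix k :: int
    have dy: "beta (of_int k) \<in> dyadic"
      using dyadic_div_power[of k 1] dyadic_of_int[of "k - 1"] by (auto simp: beta_def)
    consider "k + 1 \<le> 0" | "k = 0" | "k = 1" | "2 \<le> k" by linarith
    then have "\<exists>s::int. \<forall>x. of_int k \<le> x \<and> x \<le> of_int k + 1 \<longrightarrow>
        beta x = beta (of_int k) + 2 powi s * (x - of_int k)"
    proof cases
      case 1
      then have "real_of_int k + 1 \<le> 0" by linarith
      then show ?thesis by (intro exI[of _ 0]) (auto simp: beta_def)
    next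
      case 4
      then have "real_of_int k \<ge> 2" by linarith
      then show ?thesis by (intro exI[of _ 0]) (auto simp: beta_def)
    qed (rule exI[of _ "-1"], auto simp: beta_def power_int_minus field_simps)+
    with dy show "\<exists>s::int. beta (of_int k / 2 ^ 0) \<in> dyadic \<and>
      (\<forall>x. of_int k / 2 ^ 0 \<le> x \<and> x \<le> (of_int k + 1) / 2 ^ 0 \<longrightarrow>
        beta x = beta (of_int k / 2 ^ 0) + 2 powi s * (x - of_int k / 2 ^ 0))"
      by simp
  qed (use mono in \<open>auto simp: beta_def\<close>)
  have "x \<notin> breakpoints beta" if "x \<notin> {0..2}" for x
  proof -
    from that consider "x < 0" | "x > 2" by fastforce
    then show ?thesis
    proof cases
      case 1
      then have "\<forall>\<^sub>F y in nhds x. y \<in> {..<0}" by (intro eventually_nhds_in_open) auto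
      then have "\<forall>\<^sub>F y in nhds x. beta y = 1 * y + 0" by eventually_elim (auto simp: beta_def)
      then show ?thesis unfolding breakpoints_def by blast
    next
      case 2
      then have "\<forall>\<^sub>F y in nhds x. y \<in> {2<..}" by (intro eventually_nhds_in_open) auto
      then have "\<forall>\<^sub>F y in nhds x. beta y = 1 * y + (-1)" by eventually_elim (auto simp: beta_def)
      then show ?thesis unfolding breakpoints_def by blast
    qed
  qed
  then have "breakpoints beta = breakpoints beta \<inter> {0..2}" by blast
  then have "finite (breakpoints beta)" using PL unfolding PL2_def by (metis (no_types, lifting) mem_Collect_eq)
  moreover have "\<exists>M N (k::int) (l::int). (\<forall>x>M. beta x = x + of_int k) \<and> (\<forall>x<N. beta x = x + of_int l)"
    by (rule exI[of _ 2], rule exI[of _ 0], rule exI[of _ "-1"], rule exI[of _ 0]) (simp add: beta_def)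
  ultimately show ?thesis using mono PL unfolding thompson_F_def by simp
qed

subsection \<open>Thompson's group \<open>T\<close>\<close>

lemma to_circle_eq_iff: "to_circle x = to_circle y \<longleftrightarrow> x - y \<in> \<int>"
  by (rule circle.abs_eq_iff)

lemma to_circle_rep [simp]: "to_circle (rep_circle z) = z"
  by (rule Quotient_abs_rep[OF Quotient_circle])

lemma commute_int_shift:
  fixes f :: "real \<Rightarrow> real"
  assumes "\<And>x. f (x + 1) = f x + 1"
  shows "f (x + of_int n) = f x + of_int n"
proof (induction n arbitrary: x rule: int_induct[of _ 0])
  case (step1 i)
  then show ?case using assms[of "x + of_int i"] by (simp add: add.assoc)
next
  case (step2 i)
  then show ?case using assms[of "x + of_int i - 1"] by (simp add: algebra_simps)
qed simp

lemma to_circle_cong: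
  fixes f :: "real \<Rightarrow> real"
  assumes "\<And>x. f (x + 1) = f x + 1" "to_circle x = to_circle y"
  shows "to_circle (f x) = to_circle (f y)"
proof -
  obtain n where "x = y + of_int n" using assms(2) by (auto simp: to_circle_eq_iff elim!: Ints_cases) (metis add.commute diff_add_cancel)
  then show ?thesis using commute_int_shift[of f y n] assms(1) by (simp add: to_circle_eq_iff)
qed

lemma thompson_TE:
  assumes "g \<in> thompson_T"
  obtains f where "f \<in> PL2" "strict_mono f" "\<And>x. f (x + 1) = f x + 1" "\<And>x. g (to_circle x) = to_circle (f x)"
  using assms unfolding thompson_T_def by blast

lemma T_group_simps [simp]:
  "carrier T_group = thompson_T" "f \<otimes>\<^bsub>T_group\<^esub> g = f \<circ> g" "\<one>\<^bsub>T_group\<^esub> = id"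
  by (simp_all add: T_group_def)

lemma thompson_T_comp:
  assumes "g \<in> thompson_T" "h \<in> thompson_T" shows "g \<circ> h \<in> thompson_T"
proof -
  obtain f where f: "f \<in> PL2" "strict_mono f" "\<And>x. f (x + 1) = f x + 1" "\<And>x. g (to_circle x) = to_circle (f x)"
    using assms(1) by (rule thompson_TE) (rule that)
  obtain f' where f': "f' \<in> PL2" "strict_mono f'" "\<And>x. f' (x + 1) = f' x + 1" "\<And>x. h (to_circle x) = to_circle (f' x)"
    using assms(2) by (rule thompson_TE) (rule that)
  show ?thesis unfolding thompson_T_def
    using f f' by (intro CollectI bexI[of _ "f \<circ> f'"]) (auto simp: PL2_comp strict_mono_o)
qed

lemma thompson_T_left_inverse:
  assumes "g \<in> thompson_T" shows "\<exists>h \<in> thompson_T. h \<circ> g = id"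
proof -
  obtain f where f: "f \<in> PL2" "strict_mono f" "\<And>x. f (x + 1) = f x + 1" "\<And>x. g (to_circle x) = to_circle (f x)"
    using assms(1) by (rule thompson_TE) (rule that)
  have shift: "finv f (x + 1) = finv f x + 1" for x
    using f(3)[of "finv f x"] PL2_inv[OF f(1)] by metis
  define h where "h z = to_circle (finv f (rep_circle z))" for z
  have h: "h (to_circle x) = to_circle (finv f x)" for x
    unfolding h_def by (rule to_circle_cong) (simp_all add: shift)
  then have "h \<in> thompson_T" unfolding thompson_T_def
    using f shift by (intro CollectI bexI[of _ "finv f"]) (auto simp: PL2_inverse strict_mono_inv_PL2)
  moreover have "h \<circ> g = id"
  proof
    fix z
    have "h (g (to_circle (rep_circle z))) = to_circle (rep_circle z)"
      by (simp add: f(4) h PL2_inv[OF f(1)] del: to_circle_rep)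
    then show "(h \<circ> g) z = id z" by simp
  qed
  ultimately show ?thesis by blast
qed

lemma id_T: "id \<in> thompson_T"
  unfolding thompson_T_def by (intro CollectI bexI[of _ id]) (auto simp: PL2_id strict_mono_def)

lemma group_T: "group T_group"
  by (rule groupI) (auto simp: thompson_T_comp thompson_T_left_inverse id_T)

text \<open>An increasing bijection from \<open>[0, 1)\<close> to \<open>[c, c + 1)\<close>, affine on the quarters of the interval,
  extends periodically to the line.\<close>

lemma periodic_extension_T:
  fixes a b :: "real \<Rightarrow> real"
  assumes range: "\<And>t. 0 \<le> t \<Longrightarrow> t < 1 \<Longrightarrow> c \<le> a t \<and> a t < c + 1 \<and> b (a t - c) = t"
    and inverse: "\<And>t. 0 \<le> t \<Longrightarrow> t < 1 \<Longrightarrow> 0 \<le> b t \<and> b t < 1 \<and> a (b t) = c + t"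
    and mono: "\<And>s t. 0 \<le> s \<Longrightarrow> s < t \<Longrightarrow> t < 1 \<Longrightarrow> a s < a t" and one: "a 1 = a 0 + 1"
    and cells: "\<And>r. r \<in> {0, 1/4, 1/2, 3/4} \<Longrightarrow> \<exists>s::int. a r \<in> dyadic \<and>
      (\<forall>t. r \<le> t \<and> t \<le> r + 1/4 \<longrightarrow> a t = a r + 2 powi s * (t - r))"
    and g: "\<And>x. g (to_circle x) = to_circle (a (frac x))"
  shows "g \<in> thompson_T"
proof -
  define f where "f x = of_int \<lfloor>x\<rfloor> + a (frac x)" for x
  define f' where "f' y = of_int \<lfloor>y - c\<rfloor> + b (frac (y - c))" for y
  have frac: "0 \<le> frac x" "frac x < 1" "x = of_int \<lfloor>x\<rfloor> + frac x" for x :: real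
    using frac_ge_0[of x] frac_lt_1[of x] by (auto simp: frac_def)
  have split: "\<lfloor>of_int n + t\<rfloor> = n \<and> frac (of_int n + t) = t" if "0 \<le> t" "t < 1" for n and t :: real
  proof -
    have "\<lfloor>of_int n + t\<rfloor> = n" using that by (intro floor_unique) auto
    then show ?thesis by (simp add: frac_def)
  qed
  have f_cell: "f (of_int n + t) = of_int n + a t" if "0 \<le> t" "t \<le> 1" for n t
  proof (cases "t < 1")
    case True
    then show ?thesis using split[of t n] that by (simp add: f_def)
  next
    case False
    then have "t = 1" using that by simp
    then show ?thesis using split[of 0 "n + 1"] one by (simp add: f_def)
  qed
  have f'f: "f' (f x) = x" for x
  proof -
    have e: "f x - c = of_int \<lfloor>x\<rfloor> + (a (frac x) - c)" by (simp add: f_def)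
    have r: "c \<le> a (frac x)" "a (frac x) < c + 1" "b (a (frac x) - c) = frac x"
      using range[of "frac x"] frac(1,2)[of x] by auto
    have s: "\<lfloor>f x - c\<rfloor> = \<lfloor>x\<rfloor>" "frac (f x - c) = a (frac x) - c"
      unfolding e using split[of "a (frac x) - c" "\<lfloor>x\<rfloor>"] r by auto
    show ?thesis unfolding f'_def s r(3) by (simp add: frac_def)
  qed
  have ff': "f (f' y) = y" for y
    using f_cell[of "b (frac (y - c))" "\<lfloor>y - c\<rfloor>"] inverse[of "frac (y - c)"] frac[of "y - c"]
    unfolding f'_def by simp
  have smono: "strict_mono f"
  proof (rule strict_monoI)
    fix x y :: real assume "x < y"
    then consider "\<lfloor>x\<rfloor> = \<lfloor>y\<rfloor>" "frac x < frac y" | "\<lfloor>x\<rfloor> + 1 \<le> \<lfloor>y\<rfloor>"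
      using frac(3)[of x] frac(3)[of y] floor_mono[of x y] by (metis add_less_cancel_left less_imp_le order_le_less zless_imp_add1_zle)
    then show "f x < f y"
    proof cases
      case 1
      then show ?thesis using mono[of "frac x" "frac y"] frac by (simp add: f_def)
    next
      case 2
      then have "real_of_int \<lfloor>x\<rfloor> + 1 \<le> real_of_int \<lfloor>y\<rfloor>" by linarith
      then show ?thesis using range[of "frac x"] range[of "frac y"] frac[of x] frac[of y] by (simp add: f_def)
    qed
  qed
  have "f \<in> PL2"
  proof (rule PL2_mesh[where N = 2, OF smono ff' f'f])
    fix k :: int
    define r :: real where "r = of_int (k mod 4) / 4"
    define n where "n = k div 4"
    have k: "of_int k / 2\<^sup>2 = of_int n + r"
    proof -
      have "k = 4 * n + k mod 4" by (simp add: n_def)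
      then have "real_of_int k = real_of_int (4 * n + k mod 4)" by simp
      then show ?thesis by (simp add: r_def)
    qed
    have "k mod 4 \<in> {0, 1, 2, 3}" by auto
    then have r: "r \<in> {0, 1/4, 1/2, 3/4}" by (auto simp: r_def)
    then obtain s :: int where s: "a r \<in> dyadic" "\<And>t. r \<le> t \<Longrightarrow> t \<le> r + 1/4 \<Longrightarrow> a t = a r + 2 powi s * (t - r)"
      using cells by blast
    have r01: "0 \<le> r" "r + 1/4 \<le> 1" using r by auto
    have "f x = f (of_int k / 2\<^sup>2) + 2 powi s * (x - of_int k / 2\<^sup>2)"
      if "of_int k / 2\<^sup>2 \<le> x" "x \<le> (of_int k + 1) / 2\<^sup>2" for x
    proof -
      define t where "t = x - of_int n"
      have "x \<le> of_int n + r + 1/4" using that k by (simp add: add_divide_distrib)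
      then have t: "r \<le> t" "t \<le> r + 1/4" using that k by (auto simp: t_def)
      have "f x = of_int n + a t" using f_cell[of t n] t r01 by (simp add: t_def)
      moreover have "f (of_int n + r) = of_int n + a r" using f_cell[of r n] r01 by simp
      ultimately show ?thesis using s(2)[OF t] unfolding k by (simp add: t_def algebra_simps)
    qed
    moreover have "f (of_int k / 2\<^sup>2) \<in> dyadic"
      using f_cell[of r n] r01 s(1) unfolding k by (simp add: dyadic_add)
    ultimately show "\<exists>s::int. f (of_int k / 2\<^sup>2) \<in> dyadic \<and>
      (\<forall>x. of_int k / 2\<^sup>2 \<le> x \<and> x \<le> (of_int k + 1) / 2\<^sup>2 \<longrightarrow>
        f x = f (of_int k / 2\<^sup>2) + 2 powi s * (x - of_int k / 2\<^sup>2))"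
      by blast
  qed
  moreover have "f (x + 1) = f x + 1" for x by (simp add: f_def frac_def)
  moreover have "g (to_circle x) = to_circle (f x)" for x
    unfolding g by (simp add: to_circle_eq_iff f_def)
  ultimately show ?thesis using smono unfolding thompson_T_def by blast
qed

lemma T_A_mem: "T_A \<in> thompson_T"
proof (rule periodic_extension_T[where c = 0
      and a = "\<lambda>t. if t \<le> 1/2 then t / 2 else if t \<le> 3/4 then t - 1/4 else 2 * t - 1"
      and b = "\<lambda>t. if t \<le> 1/4 then 2 * t else if t \<le> 1/2 then t + 1/4 else (t + 1) / 2"])
  fix r :: real assume "r \<in> {0, 1/4, 1/2, 3/4}"
  then consider "r = 0" | "r = 1/4" | "r = 1/2" | "r = 3/4" by blast
  then show "\<exists>s::int. (if r \<le> 1/2 then r / 2 else if r \<le> 3/4 then r - 1/4 else 2 * r - 1) \<in> dyadic \<and>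
    (\<forall>t. r \<le> t \<and> t \<le> r + 1/4 \<longrightarrow> (if t \<le> 1/2 then t / 2 else if t \<le> 3/4 then t - 1/4 else 2 * t - 1) =
      (if r \<le> 1/2 then r / 2 else if r \<le> 3/4 then r - 1/4 else 2 * r - 1) + 2 powi s * (t - r))"
  proof cases
    case 1
    show ?thesis unfolding 1 by (intro exI[of _ "-1"]) (auto simp: power_int_minus field_simps)
  next
    case 2
    show ?thesis unfolding 2 using dyadic_div_power[of 1 3] by (intro exI[of _ "-1"]) (auto simp: power_int_minus field_simps)
  next
    case 3
    show ?thesis unfolding 3 using dyadic_div_power[of 1 2] by (intro exI[of _ 0]) auto
  next
    case 4
    show ?thesis unfolding 4 using dyadic_div_power[of 1 1] by (intro exI[of _ 1]) (auto simp: algebra_simps)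
  qed
qed (auto simp: T_A.abs_eq Let_def add_divide_distrib diff_divide_distrib split: if_splits)

lemma T_C_mem: "T_C \<in> thompson_T"
proof (rule periodic_extension_T[where c = "3/4"
      and a = "\<lambda>t. if t \<le> 1/2 then t / 2 + 3/4 else if t \<le> 3/4 then 2 * t else t + 3/4"
      and b = "\<lambda>t. if t \<le> 1/4 then 2 * t else if t \<le> 3/4 then t / 2 + 3/8 else t"])
  fix r :: real assume "r \<in> {0, 1/4, 1/2, 3/4}"
  then consider "r = 0" | "r = 1/4" | "r = 1/2" | "r = 3/4" by blast
  then show "\<exists>s::int. (if r \<le> 1/2 then r / 2 + 3/4 else if r \<le> 3/4 then 2 * r else r + 3/4) \<in> dyadic \<and>
    (\<forall>t. r \<le> t \<and> t \<le> r + 1/4 \<longrightarrow> (if t \<le> 1/2 then t / 2 + 3/4 else if t \<le> 3/4 then 2 * t else t + 3/4) =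
      (if r \<le> 1/2 then r / 2 + 3/4 else if r \<le> 3/4 then 2 * r else r + 3/4) + 2 powi s * (t - r))"
  proof cases
    case 1
    show ?thesis unfolding 1 using dyadic_div_power[of 3 2] by (intro exI[of _ "-1"]) (auto simp: power_int_minus field_simps)
  next
    case 2
    show ?thesis unfolding 2 using dyadic_div_power[of 7 3] by (intro exI[of _ "-1"]) (auto simp: power_int_minus field_simps)
  next
    case 3
    show ?thesis unfolding 3 by (intro exI[of _ 1]) (auto simp: algebra_simps)
  next
    case 4
    show ?thesis unfolding 4 using dyadic_div_power[of 3 1] by (intro exI[of _ 0]) auto
  qed
next
  fix x
  have *: "t - 1 / 4 - (t + 3 / 4) = -1" for t :: real by simp
  show "T_C (to_circle x) = to_circle (if frac x \<le> 1/2 then frac x / 2 + 3/4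
      else if frac x \<le> 3/4 then 2 * frac x else frac x + 3/4)"
    by (auto simp: T_C.abs_eq Let_def to_circle_eq_iff *)
qed (auto simp: Let_def add_divide_distrib diff_divide_distrib split: if_splits)

section \<open>Generators of \<open>F\<close>\<close>

abbreviation FV :: "word \<Rightarrow> real \<Rightarrow> real" where
  "FV \<equiv> word_val PL2_group [alpha, beta]"

lemma alpha_beta_PL2: "alpha \<in> PL2" "beta \<in> PL2"
  using alpha_F beta_F by (auto simp: thompson_F_PL2)

lemma FV_F: "w \<in> words 2 \<Longrightarrow> FV w \<in> thompson_F"
proof (induction w)
  case Nil
  then show ?case using thompson_F_id by (simp add: id_def)
next
  case (Cons l w)
  then have l: "fst l = 0 \<or> fst l = 1" and w: "FV w \<in> thompson_F" by auto
  define g where "g = (if snd l then [alpha, beta] ! fst l else finv ([alpha, beta] ! fst l))"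
  have "FV (l # w) = g \<circ> FV w" 
    using l by (elim disjE; cases "snd l") (simp_all add: alpha_beta_PL2 g_def)
  moreover have "g \<in> thompson_F"
    using l alpha_F beta_F thompson_F_inv[OF alpha_F] thompson_F_inv[OF beta_F] by (auto simp: g_def)
  ultimately show ?case using w by (simp only: thompson_F_comp)
qed

lemma FV_append: "u \<in> words 2 \<Longrightarrow> v \<in> words 2 \<Longrightarrow> FV (u @ v) = FV u \<circ> FV v"
  using PL2.word_val_append[of "[alpha, beta]" u v] by (simp add: alpha_beta_PL2 numeral_2_eq_2)

lemma FV_winv: "w \<in> words 2 \<Longrightarrow> FV (winv w) = finv (FV w)"
  using PL2.word_val_winv[of "[alpha, beta]" w] thompson_F_PL2[OF FV_F[of w]]
  by (simp add: alpha_beta_PL2 numeral_2_eq_2)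

text \<open>The standard infinite generating set \<open>x\<^sub>0, x\<^sub>1, \<dots>\<close>: the homeomorphism \<open>x\<^sub>n\<^sub>+\<^sub>1\<close> is \<open>\<beta>\<close> moved by
  \<open>n\<close>.\<close>

primrec xgen :: "nat \<Rightarrow> real \<Rightarrow> real" where
  "xgen 0 = alpha"
| "xgen (Suc n) = (\<lambda>t. beta (t - real n) + real n)"

primrec xword :: "nat \<Rightarrow> word" where
  "xword 0 = gen 0"
| "xword (Suc n) = winv (replicate n (0, True)) @ gen 1 @ replicate n (0, True)"

lemma words_replicate [simp]: "fst l < k \<Longrightarrow> replicate n l \<in> words k"
  by (induction n) auto

lemma xword_words [simp]: "xword n \<in> words 2"
  by (cases n) auto

lemma FV_alpha_power: "FV (replicate n (0, True)) = (\<lambda>t. t - real n)"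
  by (induction n) (auto simp: fun_eq_iff alpha_def)

lemma FV_alpha_inverse_power: "FV (winv (replicate n (0, True))) = (\<lambda>t. t + real n)"
proof -
  have "finv (\<lambda>t. t - real n) = (\<lambda>t. t + real n)" by (rule Hilbert_Choice.inv_equality) auto
  then show ?thesis by (simp add: FV_winv FV_alpha_power)
qed

lemma FV_xword: "FV (xword n) = xgen n"
proof (cases n)
  case (Suc m)
  have "FV (gen 1) = beta" by (simp add: gen_def)
  then show ?thesis using Suc by (simp add: FV_append FV_alpha_power FV_alpha_inverse_power comp_def)
qed (simp add: gen_def)

lemma FV_translation: "\<exists>w \<in> words 2. FV w = (\<lambda>t. t + real_of_int k)"
proof (cases "0 \<le> k")
  case True
  then show ?thesis
    using FV_alpha_inverse_power[of "nat k"] by (intro bexI[of _ "winv (replicate (nat k) (0, True))"]) auto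
next
  case False
  then show ?thesis
    using FV_alpha_power[of "nat (- k)"] by (intro bexI[of _ "replicate (nat (- k)) (0, True)"]) auto
qed

subsection \<open>Maps with dyadic cells are positive words\<close>

text \<open>These maps are the products of the generators \<open>x\<^sub>n\<close> with \<open>n > 0\<close>. Each unit cell is carried onto a
  standard dyadic interval; the total length \<open>m\<close> that is lost is the number of factors.\<close>

definition cell_map :: "(real \<Rightarrow> real) \<Rightarrow> nat \<Rightarrow> bool" where
  "cell_map g m \<longleftrightarrow> (\<forall>x\<le>0. g x = x) \<and> (\<exists>M::nat. \<forall>x\<ge>real M. g x = x - real m) \<and>
     (\<forall>i::nat. \<exists>s::nat. g (real i) * 2 ^ s \<in> \<int> \<and>
       (\<forall>x. real i \<le> x \<and> x \<le> real i + 1 \<longrightarrow> g x = g (real i) + (x - real i) / 2 ^ s))"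

lemma even_if_coarser:
  assumes "x * 2 ^ r \<in> \<int>" "r < S" "x * 2 ^ S = real_of_int j"
  shows "even j"
proof -
  obtain z where z: "x * 2 ^ r = real_of_int z" using assms(1) by (auto elim: Ints_cases)
  have "real_of_int j = x * 2 ^ r * 2 ^ (S - r)"
    using assms(2,3) by (simp add: mult.assoc flip: power_add)
  then have "real_of_int j = real_of_int (z * 2 ^ (S - r))" by (simp add: z)
  then have "j = z * 2 ^ (S - r)" by linarith
  then show ?thesis using assms(2) by simp
qed

text \<open>The key to the induction: two cells of the smallest image size that are mapped onto the two
  halves of a standard dyadic interval. Factoring out the generator that compresses these two cells
  to one merges them.\<close>

lemma cell_map_sibling:
  assumes "cell_map g m" "\<exists>x. g x \<noteq> x"
  obtains i S where "m > 0" "g (real i) * 2 ^ S \<in> \<int>"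
    "\<And>x. real i \<le> x \<Longrightarrow> x \<le> real i + 2 \<Longrightarrow> g x = g (real i) + (x - real i) / 2 ^ Suc S"
proof -
  obtain s where s: "\<And>i. g (real i) * 2 ^ s i \<in> \<int>"
    "\<And>i x. real i \<le> x \<Longrightarrow> x \<le> real i + 1 \<Longrightarrow> g x = g (real i) + (x - real i) / 2 ^ s i"
    using assms(1) unfolding cell_map_def by metis
  obtain M where M: "\<And>x. x \<ge> real M \<Longrightarrow> g x = x - real m"
    using assms(1) unfolding cell_map_def by blast
  have le0: "g x = x" if "x \<le> 0" for x using assms(1) that unfolding cell_map_def by blast
  have step: "g (real (Suc i)) = g (real i) + 1 / 2 ^ s i" for i
    using s(2)[of i "real i + 1"] by (simp add: add.commute)
  have pow: "1 / 2 ^ k \<le> (1::real)" "k > 0 \<Longrightarrow> 1 / 2 ^ k < (1::real)" for k :: nat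
    by (auto simp: divide_simps)
  have ex: "\<exists>i. s i > 0"
  proof (rule ccontr)
    assume "\<not> (\<exists>i. s i > 0)"
    then have s0: "s i = 0" for i by simp
    have gi: "g (real i) = real i" for i
    proof (induction i)
      case (Suc i)
      then show ?case using step[of i] s0 by simp
    qed (use le0 in simp)
    have "g x = x" for x
    proof (cases "x \<le> 0")
      case False
      then have "real (nat \<lfloor>x\<rfloor>) \<le> x" "x \<le> real (nat \<lfloor>x\<rfloor>) + 1" by linarith+
      then obtain n where "real n \<le> x" "x \<le> real n + 1" by blast
      then show ?thesis using s(2)[of n x] s0[of n] gi[of n] by simp
    qed (rule le0)
    with assms(2) show False by blast
  qed
  then obtain i0 where i0: "s i0 > 0" by blast
  have small: "1 / 2 ^ Suc (s i0) + 1 / 2 ^ s i0 \<le> (1::real)"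
  proof -
    obtain k where "s i0 = Suc k" using i0 by (metis gr0_implies_Suc)
    then have "1 / 2 ^ Suc (s i0) + 1 / 2 ^ s i0 = (3/4) * (1 / 2 ^ k :: real)" by simp
    also have "\<dots> \<le> (3/4) * 1" by (intro mult_left_mono pow) auto
    finally show ?thesis by linarith
  qed
  define E where "E i = (if i0 < i then 1 / 2 ^ Suc (s i0) else (0::real))" for i
  have deficit: "g (real i) + E i \<le> real i" for i
  proof (induction i)
    case 0
    then show ?case using le0 by (simp add: E_def)
  next
    case (Suc i)
    have "E (Suc i) + 1 / 2 ^ s i \<le> E i + 1"
    proof (cases "i = i0")
      case True
      then show ?thesis using small by (simp add: E_def)
    next
      case False
      then have "E (Suc i) = E i" by (auto simp: E_def)
      then show ?thesis using pow(1)[of "s i"] by simp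
    qed
    moreover have "real (Suc i) = real i + 1" by simp
    ultimately show ?case using Suc step[of i] by linarith
  qed
  have "real m > 0"
  proof -
    define i where "i = max M (Suc i0)"
    have "E i = 1 / 2 ^ Suc (s i0)" by (simp add: i_def E_def less_max_iff_disj)
    then have "g (real i) + 1 / 2 ^ Suc (s i0) \<le> real i" using deficit[of i] by simp
    moreover have "g (real i) = real i - real m" by (rule M) (simp add: i_def)
    moreover have "1 / 2 ^ Suc (s i0) > (0::real)" by simp
    ultimately show ?thesis by linarith
  qed
  then have m: "m > 0" by simp
  have s_far: "s i = 0" if "i \<ge> M" for i
  proof (rule ccontr)
    assume "s i \<noteq> 0"
    then have "1 / 2 ^ s i < (1::real)" by (intro pow) simp
    moreover have "g (real (Suc i)) = g (real i) + 1" using M[of "real i"] M[of "real (Suc i)"] that by simp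
    ultimately show False using step[of i] by simp
  qed
  have "s j < Suc (\<Sum>i\<le>M. s i)" for j
  proof (cases "j \<le> M")
    case True
    then show ?thesis using member_le_sum[of j "{..M}" s] by simp
  next
    case False
    then show ?thesis using s_far[of j] by simp
  qed
  then obtain i where i: "\<And>j. s j \<le> s i"
    using ex_has_greatest_nat[of "\<lambda>_. True" 0 s "Suc (\<Sum>i\<le>M. s i)"] by blast
  then have "s i > 0" using i0 by (metis not_gr_zero le_zero_eq)
  then obtain S where S: "s i = Suc S" by (metis gr0_implies_Suc)
  have "\<exists>p. s p = Suc S \<and> s (Suc p) = Suc S \<and> g (real p) * 2 ^ S \<in> \<int>"
  proof -
    obtain j where j: "g (real i) * 2 ^ Suc S = real_of_int j"
      using s(1)[of i] S by (auto elim: Ints_cases)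
    show ?thesis
    proof (cases "even j")
      case True
      then obtain k where k: "j = 2 * k" by blast
      have "g (real (Suc i)) * 2 ^ Suc S = real_of_int (j + 1)"
        using step[of i] S j by (simp add: distrib_right)
      then have "\<not> s (Suc i) < Suc S" using even_if_coarser[OF s(1)[of "Suc i"]] True by fastforce
      then have "s (Suc i) = Suc S" using i[of "Suc i"] S by simp
      moreover have "g (real i) * 2 ^ S = real_of_int k" using j k by simp
      ultimately show ?thesis using S by (metis Ints_of_int)
    next
      case False
      then have "i \<noteq> 0" using j le0[of 0] by (intro notI) simp
      then obtain p where p: "i = Suc p" by (metis not0_implies_Suc)
      have "g (real i) * 2 ^ s p = g (real p) * 2 ^ s p + 1" using step[of p] p by (simp add: distrib_right)
      then have "g (real i) * 2 ^ s p \<in> \<int>" using s(1)[of p] by simp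
      then have "\<not> s p < Suc S" using even_if_coarser j False by blast
      then have sp: "s p = Suc S" using i[of p] S by simp
      have "odd j" by (rule False)
      then obtain k where k: "j = 2 * k + 1" by (metis oddE)
      have "g (real p) * 2 ^ Suc S = real_of_int (j - 1)"
        using step[of p] sp j p by (simp add: distrib_right)
      then have "g (real p) * 2 ^ S = real_of_int k" using k by simp
      then show ?thesis using sp S p by (metis Ints_of_int)
    qed
  qed
  then obtain p where p: "s p = Suc S" "s (Suc p) = Suc S" "g (real p) * 2 ^ S \<in> \<int>" by blast
  have "g x = g (real p) + (x - real p) / 2 ^ Suc S" if "real p \<le> x" "x \<le> real p + 2" for x
  proof (cases "x \<le> real p + 1")
    case True
    then show ?thesis using s(2)[of p x] p that by simp
  next
    case False
    then have "g x = g (real (Suc p)) + (x - real (Suc p)) / 2 ^ Suc S"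
      using s(2)[of "Suc p" x] p that by simp
    then show ?thesis using step[of p] p by (simp add: diff_divide_distrib add_divide_distrib)
  qed
  with m p(3) show ?thesis by (rule that)
qed

text \<open>By \<open>cell_map_sibling\<close>, \<open>g = g' \<circ> x\<^sub>i\<^sub>+\<^sub>1\<close> where \<open>g'\<close> loses one unit of length less.\<close>

lemma FV_cell_map: "cell_map g m \<Longrightarrow> \<exists>w \<in> words 2. FV w = g"
proof (induction m arbitrary: g)
  case 0
  have "\<not> (\<exists>x. g x \<noteq> x)" using cell_map_sibling[OF 0] by blast
  then have "g = id" by (simp add: fun_eq_iff)
  then show ?case by (intro bexI[of _ "[]"]) auto
next
  case (Suc m)
  show ?case
  proof (cases "\<exists>x. g x \<noteq> x")
    case False
    then have "g = id" by (simp add: fun_eq_iff)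
    then show ?thesis by (intro bexI[of _ "[]"]) auto
  next
    case True
    obtain i S where i: "g (real i) * 2 ^ S \<in> \<int>"
      "\<And>x. real i \<le> x \<Longrightarrow> x \<le> real i + 2 \<Longrightarrow> g x = g (real i) + (x - real i) / 2 ^ Suc S"
      by (rule cell_map_sibling[OF Suc.prems True]) blast
    define g' where "g' y = g (if y \<le> real i then y else if y \<le> real i + 1 then 2 * y - real i else y + 1)" for y
    have "cell_map g' m"
      unfolding cell_map_def
    proof (intro conjI allI impI)
      note cell = Suc.prems[unfolded cell_map_def, THEN conjunct2, THEN conjunct2, THEN spec]
      show "g' x = x" if "x \<le> 0" for x
        using Suc.prems that by (simp add: g'_def cell_map_def)
      obtain M :: nat where M: "\<And>x. x \<ge> real M \<Longrightarrow> g x = x - real (Suc m)"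
        using Suc.prems unfolding cell_map_def by blast
      have "g' x = x - real m" if "x \<ge> real (M + i + 2)" for x
        using M[of "x + 1"] that by (simp add: g'_def)
      then show "\<exists>M::nat. \<forall>x\<ge>real M. g' x = x - real m" by blast
      fix j :: nat
      consider "j < i" | "j = i" | "j > i" by linarith
      then show "\<exists>s::nat. g' (real j) * 2 ^ s \<in> \<int> \<and>
        (\<forall>x. real j \<le> x \<and> x \<le> real j + 1 \<longrightarrow> g' x = g' (real j) + (x - real j) / 2 ^ s)"
      proof cases
        case 1
        then have ji: "real j + 1 \<le> real i" by linarith
        obtain s where s: "g (real j) * 2 ^ s \<in> \<int>"
          "\<And>x. real j \<le> x \<Longrightarrow> x \<le> real j + 1 \<Longrightarrow> g x = g (real j) + (x - real j) / 2 ^ s"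
          using cell[of j] by blast
        have e: "g' x = g x" if "x \<le> real j + 1" for x using that ji by (simp add: g'_def)
        have "g' x = g' (real j) + (x - real j) / 2 ^ s" if "real j \<le> x" "x \<le> real j + 1" for x
          using s(2)[OF that] e[OF that(2)] e[of "real j"] by simp
        moreover have "g' (real j) * 2 ^ s \<in> \<int>" using s(1) e[of "real j"] by simp
        ultimately show ?thesis by blast
      next
        case 2
        have "g' x = g' (real i) + (x - real i) / 2 ^ S" if "real i \<le> x" "x \<le> real i + 1" for x
        proof (cases "x = real i")
          case False
          then have "g' x = g (2 * x - real i)" using that by (simp add: g'_def)
          also have "\<dots> = g (real i) + (2 * x - real i - real i) / 2 ^ Suc S" using that by (intro i(2)) auto
          finally show ?thesis by (simp add: g'_def diff_divide_distrib)
        qed simp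
        moreover have "g' (real i) * 2 ^ S \<in> \<int>" using i(1) by (simp add: g'_def)
        ultimately show ?thesis using 2 by blast
      next
        case 3
        then have ji: "real i + 1 \<le> real j" by linarith
        have shift: "g' x = g (x + 1)" if "real i + 1 \<le> x" for x
          using that by (auto simp: g'_def add.commute)
        obtain s where s: "g (real (Suc j)) * 2 ^ s \<in> \<int>"
          "\<And>x. real (Suc j) \<le> x \<Longrightarrow> x \<le> real (Suc j) + 1 \<Longrightarrow> g x = g (real (Suc j)) + (x - real (Suc j)) / 2 ^ s"
          using cell[of "Suc j"] by blast
        have e: "g (real j + 1) = g (real (Suc j))" by (simp add: add.commute)
        have "g' x = g' (real j) + (x - real j) / 2 ^ s" if "real j \<le> x" "x \<le> real j + 1" for x
          using s(2)[of "x + 1"] that shift[of x] shift[of "real j"] ji e by simp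
        moreover have "g' (real j) * 2 ^ s \<in> \<int>" using s(1) shift[of "real j"] ji e by simp
        ultimately show ?thesis by blast
      qed
    qed
    then obtain w where w: "w \<in> words 2" "FV w = g'" using Suc.IH by blast
    have "g' (xgen (Suc i) t) = g t" for t
    proof -
      consider "t \<le> real i" | "real i < t" "t \<le> real i + 2" | "real i + 2 < t" by linarith
      then show ?thesis by cases (auto simp: g'_def beta_def diff_divide_distrib)
    qed
    then have "FV (w @ xword (Suc i)) = g" using w FV_xword[of "Suc i"]
      by (simp add: FV_append fun_eq_iff del: xword.simps)
    with w(1) show ?thesis by (intro bexI[of _ "w @ xword (Suc i)"]) (auto simp del: xword.simps)
  qed
qed

subsection \<open>Every element of \<open>F\<close> is a word\<close>

lemma F_affine_between_breakpoints:
  assumes f: "f \<in> thompson_F" and yz: "y < z" and nb: "\<And>x. y < x \<Longrightarrow> x < z \<Longrightarrow> x \<notin> breakpoints f"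
  obtains k :: int where "\<And>x. y \<le> x \<Longrightarrow> x \<le> z \<Longrightarrow> f x = f y + 2 powi k * (x - y)"
proof -
  have PL: "f \<in> PL2" "strict_mono f" using f by (auto simp: thompson_F_def)
  have loc: "\<exists>k::int. \<forall>\<^sub>F w in nhds x. (f has_real_derivative 2 powi k) (at w)" if x: "y < x" "x < z" for x
  proof -
    obtain s b k where sb: "\<forall>\<^sub>F w in nhds x. f w = s * w + b" and k: "s = 2 powi k \<or> s = - (2 powi k)"
      by (rule dyadic_affine_atE[OF dyadic_affine_at_PL2[OF PL(1) nb[OF x]]])
    have "\<forall>\<^sub>F w in nhds x. \<forall>\<^sub>F v in nhds w. f v = s * v + b" using sb by (simp add: eventually_eventually)
    then have D: "\<forall>\<^sub>F w in nhds x. (f has_real_derivative s) (at w)"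
      by eventually_elim (rule affine_has_derivative)
    obtain e where e: "e > 0" "\<And>w. dist w x < e \<Longrightarrow> f w = s * w + b"
      using sb unfolding eventually_nhds_metric by blast
    have "f (x + e/2) > f x" using PL(2) e(1) by (simp add: strict_mono_less)
    then have "s * e > 0" using e(1) e(2)[of "x + e/2"] e(2)[of x] by (simp add: dist_real_def distrib_left)
    then have "s > 0" using e(1) by (simp add: zero_less_mult_iff)
    moreover have "2 powi k > (0::real)" by simp
    ultimately have "s = 2 powi k" using k by linarith
    with D show ?thesis by blast
  qed
  have DD: "(deriv f has_real_derivative 0) (at x)" if x: "y < x" "x < z" for x
  proof -
    obtain k :: int where "\<forall>\<^sub>F w in nhds x. (f has_real_derivative 2 powi k) (at w)"
      using loc[OF x] by blast
    then have "\<forall>\<^sub>F w in nhds x. deriv f w = 0 * w + 2 powi k" by eventually_elim (simp add: DERIV_imp_deriv)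
    then show ?thesis by (rule affine_has_derivative)
  qed
  define x0 where "x0 = (y + z) / 2"
  have x0: "y < x0" "x0 < z" using yz by (auto simp: x0_def)
  obtain k :: int where "\<forall>\<^sub>F w in nhds x0. (f has_real_derivative 2 powi k) (at w)" using loc x0 by blast
  then have k: "deriv f x0 = 2 powi k" by (auto dest!: eventually_nhds_x_imp_x DERIV_imp_deriv)
  have D: "(f has_real_derivative 2 powi k) (at x)" if x: "y < x" "x < z" for x
  proof -
    have "deriv f x = deriv f x0"
      by (rule DERIV_isconst3[OF yz]) (use x x0 DD in auto)
    moreover obtain j :: int where "\<forall>\<^sub>F w in nhds x. (f has_real_derivative 2 powi j) (at w)" using loc[OF x] by blast
    then have "(f has_real_derivative 2 powi j) (at x)" by (rule eventually_nhds_x_imp_x)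
    ultimately show ?thesis using k DERIV_imp_deriv by metis
  qed
  have "f x = f y + 2 powi k * (x - y)" if x: "y \<le> x" "x \<le> z" for x
  proof -
    define h where "h w = f w - 2 powi k * w" for w
    have "continuous_on {y..z} h"
      unfolding h_def by (intro continuous_intros continuous_on_subset[OF PL2_homeomorphism(2)[OF PL(1)]]) auto
    moreover have "(h has_real_derivative 0) (at w)" if "y < w" "w < z" for w
      unfolding h_def by (rule derivative_eq_intros D[OF that] refl | simp)+
    ultimately have "h x = h y" using DERIV_isconst2[OF yz, of h x] x by blast
    then show ?thesis by (simp add: h_def algebra_simps)
  qed
  then show ?thesis by (rule that)
qed

text \<open>On a linear piece of \<open>f\<close> all sufficiently fine cells are mapped onto standard dyadic
  intervals of length at most 1.\<close>

lemma affine_fine_cells: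
  assumes aff: "\<And>x. y \<le> x \<Longrightarrow> x \<le> z \<Longrightarrow> f x = f y + 2 powi k * (x - y)"
    and dy: "y \<in> dyadic" "f y \<in> dyadic"
  obtains N0 where "\<And>N c. N0 \<le> N \<Longrightarrow> y \<le> real c / 2 ^ N \<Longrightarrow> (real c + 1) / 2 ^ N \<le> z \<Longrightarrow>
    \<exists>s::nat. f (real c / 2 ^ N) * 2 ^ s \<in> \<int> \<and>
      (\<forall>x. real c \<le> x \<and> x \<le> real c + 1 \<longrightarrow> f (x / 2 ^ N) = f (real c / 2 ^ N) + (x - real c) / 2 ^ s)"
proof -
  obtain n where n: "\<And>m. n \<le> m \<Longrightarrow> f y * 2 ^ m \<in> \<int>" using dy(2) by (rule dyadicE) (rule that)
  obtain n' where n': "\<And>m. n' \<le> m \<Longrightarrow> y * 2 ^ m \<in> \<int>" using dy(1) by (rule dyadicE) (rule that)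
  define N0 where "N0 = n + n' + nat \<bar>k\<bar>"
  have "\<exists>s::nat. f (real c / 2 ^ N) * 2 ^ s \<in> \<int> \<and>
      (\<forall>x. real c \<le> x \<and> x \<le> real c + 1 \<longrightarrow> f (x / 2 ^ N) = f (real c / 2 ^ N) + (x - real c) / 2 ^ s)"
    if N: "N0 \<le> N" "y \<le> real c / 2 ^ N" "(real c + 1) / 2 ^ N \<le> z" for N c
  proof -
    define s where "s = nat (int N - k)"
    have sN: "int s = int N - k" "n \<le> s" "n' \<le> N" using N(1) by (auto simp: s_def N0_def)
    have slope: "2 powi k = (2 ^ N / 2 ^ s :: real)"
    proof -
      have "(2::real) powi k = 2 powi (int N - int s)" using sN by simp
      then show ?thesis by (simp add: power_int_diff)
    qed
    have f: "f (x / 2 ^ N) = f y + (x - y * 2 ^ N) / 2 ^ s" if "real c \<le> x" "x \<le> real c + 1" for x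
    proof -
      have "y \<le> x / 2 ^ N" using N(2) that by (meson divide_right_mono order_trans zero_le_numeral zero_le_power)
      moreover have "x / 2 ^ N \<le> z" using N(3) that by (meson divide_right_mono order_trans zero_le_numeral zero_le_power)
      ultimately have "f (x / 2 ^ N) = f y + 2 powi k * (x / 2 ^ N - y)" by (rule aff)
      moreover have "2 ^ N / 2 ^ s * (x / 2 ^ N - y) = (x - y * 2 ^ N) / 2 ^ s"
      proof -
        have "2 ^ N * (x / 2 ^ N - y) = x - y * 2 ^ N" by (simp add: right_diff_distrib)
        then show ?thesis by (metis times_divide_eq_left)
      qed
      ultimately show ?thesis unfolding slope by simp
    qed
    have "f (real c / 2 ^ N) * 2 ^ s = f y * 2 ^ s + (real c - y * 2 ^ N)"
      using f[of "real c"] by (simp add: distrib_right)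
    also have "\<dots> \<in> \<int>" using n[OF sN(2)] n'[OF sN(3)] by (intro Ints_add Ints_diff) auto
    finally have "f (real c / 2 ^ N) * 2 ^ s \<in> \<int>" .
    moreover have "f (x / 2 ^ N) = f (real c / 2 ^ N) + (x - real c) / 2 ^ s"
      if "real c \<le> x \<and> x \<le> real c + 1" for x
      using f[of x] f[of "real c"] that by (simp add: diff_divide_distrib)
    ultimately show ?thesis by blast
  qed
  then show ?thesis by (rule that)
qed

text \<open>Composition with this map turns the cells of the mesh of size \<open>2\<^sup>-\<^sup>N\<close> into unit cells. Thus a map
  \<open>f\<close> becomes a cell map if it is linear on the small cells and carries them onto standard dyadic
  intervals.\<close>

definition compress :: "nat \<Rightarrow> nat \<Rightarrow> real \<Rightarrow> real" where
  "compress N M x = (if x \<le> 0 then x else if x \<le> 2 ^ N * real M then x / 2 ^ N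
     else x - (2 ^ N * real M - real M))"

lemma cell_map_comp_compress:
  assumes le0: "\<And>x. x \<le> 0 \<Longrightarrow> f x = x" and far: "\<And>x. real M \<le> x \<Longrightarrow> f x = x + real_of_int k"
    and N: "k \<le> int N" and M: "1 \<le> M"
    and cells: "\<And>c. (real c + 1) / 2 ^ N \<le> real M \<Longrightarrow> \<exists>s::nat. f (real c / 2 ^ N) * 2 ^ s \<in> \<int> \<and>
      (\<forall>x. real c \<le> x \<and> x \<le> real c + 1 \<longrightarrow> f (x / 2 ^ N) = f (real c / 2 ^ N) + (x - real c) / 2 ^ s)"
  shows "cell_map (f \<circ> compress N M) (nat (2 ^ N * int M - int M - k))"
proof -
  have "int N + 1 \<le> 2 ^ N" by (induction N) auto
  then have "(int N + 1) * 1 - 1 \<le> 2 ^ N * int M - int M"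
  proof -
    assume "int N + 1 \<le> 2 ^ N"
    then have "int N * 1 \<le> (2 ^ N - 1) * int M" using M by (intro mult_mono) auto
    then show ?thesis by (simp add: left_diff_distrib)
  qed
  then have nn: "0 \<le> 2 ^ N * int M - int M - k" using N by simp
  define d where "d = real (nat (2 ^ N * int M - int M - k))"
  have d: "d = 2 ^ N * real M - real M - real_of_int k"
  proof -
    have "d = real_of_int (2 ^ N * int M - int M - k)" using nn unfolding d_def by (simp only: of_nat_nat)
    then show ?thesis by simp
  qed
  have far': "f (compress N M x) = x - d" if "2 ^ N * real M \<le> x" for x
  proof -
    have "0 < 2 ^ N * real M" using M by simp
    then have "0 < x" using that by linarith
    then have "compress N M x = x - (2 ^ N * real M - real M)"
      using that by (auto simp: compress_def)
    then show ?thesis using far[of "x - (2 ^ N * real M - real M)"] that by (simp add: d)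
  qed
  have near: "compress N M x = x / 2 ^ N" if "0 \<le> x" "x \<le> 2 ^ N * real M" for x
    using that by (auto simp: compress_def)
  show ?thesis
    unfolding cell_map_def
  proof (intro conjI allI impI)
    show "(f \<circ> compress N M) x = x" if "x \<le> 0" for x using that le0 by (simp add: compress_def)
    have "(f \<circ> compress N M) x = x - real (nat (2 ^ N * int M - int M - k))" if "real (2 ^ N * M) \<le> x" for x
      using far'[of x] that by (simp add: d_def)
    then show "\<exists>M'::nat. \<forall>x\<ge>real M'. (f \<circ> compress N M) x = x - real (nat (2 ^ N * int M - int M - k))"
      by blast
    fix c :: nat
    show "\<exists>s::nat. (f \<circ> compress N M) (real c) * 2 ^ s \<in> \<int> \<and>
      (\<forall>x. real c \<le> x \<and> x \<le> real c + 1 \<longrightarrow>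
        (f \<circ> compress N M) x = (f \<circ> compress N M) (real c) + (x - real c) / 2 ^ s)"
    proof (cases "c < 2 ^ N * M")
      case True
      then have "real (Suc c) \<le> real (2 ^ N * M)" by linarith
      then have c: "real c + 1 \<le> 2 ^ N * real M" by (simp add: add.commute)
      then have "(real c + 1) / 2 ^ N \<le> real M" by (simp add: field_simps)
      then obtain s :: nat where s: "f (real c / 2 ^ N) * 2 ^ s \<in> \<int>"
        "\<And>x. real c \<le> x \<Longrightarrow> x \<le> real c + 1 \<Longrightarrow> f (x / 2 ^ N) = f (real c / 2 ^ N) + (x - real c) / 2 ^ s"
        using cells by blast
      have e: "(f \<circ> compress N M) x = f (x / 2 ^ N)" if "real c \<le> x" "x \<le> real c + 1" for x
        using near[of x] that c by simp
      have "(f \<circ> compress N M) x = (f \<circ> compress N M) (real c) + (x - real c) / 2 ^ s"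
        if "real c \<le> x" "x \<le> real c + 1" for x
        using s(2)[OF that] unfolding e[OF that] e[OF order_refl le_add_same_cancel1[THEN iffD2, OF zero_le_one]] .
      moreover have "(f \<circ> compress N M) (real c) * 2 ^ s \<in> \<int>" using s(1) e[of "real c"] by simp
      ultimately show ?thesis by blast
    next
      case False
      then have "real (2 ^ N * M) \<le> real c" by (intro of_nat_mono) simp
      then have c: "2 ^ N * real M \<le> real c" by simp
      have "real c - d \<in> \<int>" by (simp add: d_def)
      with c far' show ?thesis by (intro exI[of _ 0]) simp
    qed
  qed
qed

lemma finite_dyadic_common_denominator:
  "finite S \<Longrightarrow> S \<subseteq> dyadic \<Longrightarrow> \<exists>N. \<forall>x\<in>S. x * 2 ^ N \<in> \<int>"
proof (induction S rule: finite_induct)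
  case (insert x S)
  then obtain N where N: "\<And>y. y \<in> S \<Longrightarrow> y * 2 ^ N \<in> \<int>" by auto
  have "x \<in> dyadic" using insert.prems by simp
  then obtain n where n: "\<And>m. n \<le> m \<Longrightarrow> x * 2 ^ m \<in> \<int>" by (rule dyadicE) (rule that)
  have "y * 2 ^ (N + n) \<in> \<int>" if "y \<in> S" for y
    using Ints_mult[OF N[OF that], of "2 ^ n"] by (simp add: power_add mult.assoc)
  with n[of "N + n"] show ?case by auto
qed auto

text \<open>For a fine enough mesh both \<open>f \<circ> compress N M\<close> and \<open>compress N M\<close> are cell maps, hence words, and
  \<open>f\<close> is their quotient.\<close>

lemma F_generated_half_line:
  assumes f: "f \<in> thompson_F" and le0: "\<And>x. x \<le> 0 \<Longrightarrow> f x = x"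
  shows "\<exists>w \<in> words 2. FV w = f"
proof -
  have PL: "f \<in> PL2" "finite (breakpoints f)" "breakpoints f \<subseteq> dyadic"
    using f by (auto simp: thompson_F_def PL2_def)
  obtain K k where K: "\<And>x. x > K \<Longrightarrow> f x = x + real_of_int k" using f unfolding thompson_F_def by blast
  define M where "M = nat \<lceil>\<bar>K\<bar>\<rceil> + 1"
  have far: "f x = x + real_of_int k" if "real M \<le> x" for x
    using that by (intro K) (simp add: M_def, linarith)
  have M: "1 \<le> M" by (simp add: M_def)
  obtain B where B: "\<And>x. x \<in> breakpoints f \<Longrightarrow> x * 2 ^ B \<in> \<int>"
    using finite_dyadic_common_denominator[OF PL(2,3)] by blast
  \<comment> \<open>Every cell inside one of the base intervals of length \<open>2\<^sup>-\<^sup>B\<close> becomes good for large \<open>N\<close>, with a bound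
    that depends on the base interval; finitely many of these matter.\<close>
  define good where "good N c \<longleftrightarrow> (\<exists>s::nat. f (real c / 2 ^ N) * 2 ^ s \<in> \<int> \<and>
      (\<forall>x. real c \<le> x \<and> x \<le> real c + 1 \<longrightarrow> f (x / 2 ^ N) = f (real c / 2 ^ N) + (x - real c) / 2 ^ s))" for N c
  have "\<exists>N0. \<forall>N c. N0 \<le> N \<longrightarrow> real i / 2 ^ B \<le> real c / 2 ^ N \<longrightarrow> (real c + 1) / 2 ^ N \<le> (real i + 1) / 2 ^ B
      \<longrightarrow> good N c" for i
  proof -
    have nb: "x \<notin> breakpoints f" if "real i / 2 ^ B < x" "x < (real i + 1) / 2 ^ B" for x
    proof
      assume "x \<in> breakpoints f"
      then obtain j where j: "x * 2 ^ B = real_of_int j" using B by (auto elim: Ints_cases)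
      have "real i < x * 2 ^ B" "x * 2 ^ B < real i + 1" using that by (auto simp: field_simps)
      then have "real_of_int (int i) < real_of_int j" "real_of_int j < real_of_int (int i + 1)"
        unfolding j by simp_all
      then show False by (simp only: of_int_less_iff)
    qed
    have lt: "real i / 2 ^ B < (real i + 1) / 2 ^ B" by (simp add: divide_strict_right_mono)
    obtain k :: int where k: "\<And>x. real i / 2 ^ B \<le> x \<Longrightarrow> x \<le> (real i + 1) / 2 ^ B \<Longrightarrow>
        f x = f (real i / 2 ^ B) + 2 powi k * (x - real i / 2 ^ B)"
      by (rule F_affine_between_breakpoints[OF f lt nb], assumption, assumption) (rule that)
    have dy: "real i / 2 ^ B \<in> dyadic" using dyadic_div_power[of "int i" B] by simp
    then have dyf: "f (real i / 2 ^ B) \<in> dyadic" using PL2_dyadic_iff[OF PL(1)] by blast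
    obtain N0 where "\<And>N c. N0 \<le> N \<Longrightarrow> real i / 2 ^ B \<le> real c / 2 ^ N \<Longrightarrow> (real c + 1) / 2 ^ N \<le> (real i + 1) / 2 ^ B \<Longrightarrow>
        \<exists>s::nat. f (real c / 2 ^ N) * 2 ^ s \<in> \<int> \<and>
        (\<forall>x. real c \<le> x \<and> x \<le> real c + 1 \<longrightarrow> f (x / 2 ^ N) = f (real c / 2 ^ N) + (x - real c) / 2 ^ s)"
      by (rule affine_fine_cells[OF k dy dyf], assumption, assumption) (rule that)
    then show ?thesis unfolding good_def by blast
  qed
  then have "\<forall>i. \<exists>N0. \<forall>N c. N0 \<le> N \<longrightarrow> real i / 2 ^ B \<le> real c / 2 ^ N \<longrightarrow>
      (real c + 1) / 2 ^ N \<le> (real i + 1) / 2 ^ B \<longrightarrow> good N c"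
    by (rule allI)
  from choice[OF this] obtain n where n: "\<And>i N c. n i \<le> N \<Longrightarrow> real i / 2 ^ B \<le> real c / 2 ^ N \<Longrightarrow>
      (real c + 1) / 2 ^ N \<le> (real i + 1) / 2 ^ B \<Longrightarrow> good N c"
    by blast
  define N where "N = (\<Sum>i<2 ^ B * M. n i) + B + nat \<bar>k\<bar>"
  have N: "n i \<le> N" if "i < 2 ^ B * M" for i
    using member_le_sum[of i "{..<2 ^ B * M}" n] that by (simp add: N_def)
  have good: "good N c" if c: "(real c + 1) / 2 ^ N \<le> real M" for c
  proof -
    define q where "q = (2::nat) ^ (N - B)"
    have q: "(2::real) ^ N = 2 ^ B * real q" "q > 0" by (auto simp: q_def N_def simp flip: power_add)
    define i where "i = c div q"
    have "i * q \<le> c" "c < (i + 1) * q"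
      using dividend_less_div_times[OF q(2), of c]
      by (simp_all add: i_def div_times_less_eq_dividend add.commute)
    then have "real (i * q) \<le> real c" "real (Suc c) \<le> real ((i + 1) * q)" by linarith+
    then have b: "real i * real q \<le> real c" "real c + 1 \<le> (real i + 1) * real q" by (auto simp: algebra_simps)
    have pos: "(0::real) < 2 ^ B * real q" using q by simp
    have 1: "real i / 2 ^ B \<le> real c / 2 ^ N"
      using b(1) q pos by (simp add: field_simps)
    have 2: "(real c + 1) / 2 ^ N \<le> (real i + 1) / 2 ^ B"
    proof -
      have "(real c + 1) / real q \<le> real i + 1" using b(2) q(2) by (simp add: pos_divide_le_eq)
      then have "(real c + 1) / real q / 2 ^ B \<le> (real i + 1) / 2 ^ B" by (rule divide_right_mono) simp
      then show ?thesis by (simp add: q(1) mult.commute)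
    qed
    have "real i / 2 ^ B < (real c + 1) / 2 ^ N"
      using 1 by (rule order.strict_trans1) (simp add: divide_strict_right_mono)
    then have "real i / 2 ^ B < real M" using c by linarith
    then have "real i < real (2 ^ B * M)" by (simp add: field_simps)
    then have "i < 2 ^ B * M" by linarith
    from n[OF N[OF this] 1 2] show ?thesis .
  qed
  have "nat \<bar>k\<bar> \<le> N" by (simp add: N_def)
  then have kN: "k \<le> int N" by linarith
  obtain w where w: "w \<in> words 2" "FV w = f \<circ> compress N M"
    using FV_cell_map[OF cell_map_comp_compress[OF le0 far kN M good[unfolded good_def]]] by blast
  have "cell_map (id \<circ> compress N M) (nat (2 ^ N * int M - int M - 0))"
  proof (rule cell_map_comp_compress)
    fix c :: nat
    show "\<exists>s::nat. id (real c / 2 ^ N) * 2 ^ s \<in> \<int> \<and>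
      (\<forall>x. real c \<le> x \<and> x \<le> real c + 1 \<longrightarrow> id (x / 2 ^ N) = id (real c / 2 ^ N) + (x - real c) / 2 ^ s)"
      by (intro exI[of _ N]) (auto simp: field_simps)
  qed (use M in auto)
  from FV_cell_map[OF this] obtain w' where w': "w' \<in> words 2" "FV w' = compress N M" by auto
  have "compress N M \<in> PL2" using thompson_F_PL2[OF FV_F[OF w'(1)]] w'(2) by simp
  moreover have "FV (w @ winv w') = (f \<circ> compress N M) \<circ> finv (compress N M)"
    using w w' by (simp only: FV_append FV_winv winv_words)
  ultimately have "FV (w @ winv w') = f" by (simp add: fun_eq_iff PL2_inv)
  with w w' show ?thesis by (intro bexI[of _ "w @ winv w'"]) auto
qed

text \<open>Translations before and after make \<open>f\<close> the identity on the negative half line.\<close>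

theorem F_generated: "f \<in> thompson_F \<Longrightarrow> \<exists>w \<in> words 2. FV w = f"
proof -
  assume f: "f \<in> thompson_F"
  obtain N l where N: "\<And>x. x < N \<Longrightarrow> f x = x + real_of_int l" using f unfolding thompson_F_def by blast
  define n where "n = \<lfloor>N\<rfloor> - 1"
  have n: "real_of_int n < N" unfolding n_def by linarith
  obtain u where u: "u \<in> words 2" "FV u = (\<lambda>t. t + real_of_int n)"
    using FV_translation[of n] by auto
  obtain v where v: "v \<in> words 2" "FV v = (\<lambda>t. t + real_of_int (n + l))"
    using FV_translation[of "n + l"] by auto
  define h where "h = FV (winv v) \<circ> f \<circ> FV u"
  have hF: "h \<in> thompson_F" unfolding h_def using u v f by (intro thompson_F_comp FV_F) auto
  have "finv (\<lambda>t. t + real_of_int (n + l)) = (\<lambda>t. t - real_of_int (n + l))"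
    by (rule Hilbert_Choice.inv_equality) auto
  then have h: "h x = f (x + n) - real_of_int (n + l)" for x
    using u v by (simp add: h_def FV_winv)
  have "h x = x" if "x \<le> 0" for x using N[of "x + n"] that n by (simp add: h)
  from F_generated_half_line[OF hF this] obtain w where w: "w \<in> words 2" "FV w = h" by auto
  have "finv (\<lambda>t. t + real_of_int n) = (\<lambda>t. t - real_of_int n)"
    by (rule Hilbert_Choice.inv_equality) auto
  moreover have "FV (v @ w @ winv u) = (\<lambda>t. t + real_of_int (n + l)) \<circ> (h \<circ> finv (\<lambda>t. t + real_of_int n))"
    using u v w by (simp only: FV_append FV_winv winv_words words_append)
  ultimately have "FV (v @ w @ winv u) = f" by (simp add: fun_eq_iff h)
  with u v w show ?thesis by (intro bexI[of _ "v @ w @ winv u"]) auto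
qed

section \<open>The presentation of \<open>F\<close>\<close>

context group
begin

lemma inv_mult_cancel:
  assumes "x \<in> carrier G" "y \<in> carrier G"
  shows "inv x \<otimes> (x \<otimes> y) = y" "x \<otimes> (inv x \<otimes> y) = y"
  using assms by (simp_all flip: m_assoc)

definition conj_by :: "'a \<Rightarrow> 'a \<Rightarrow> 'a" where
  "conj_by g y = inv g \<otimes> y \<otimes> g"

lemma conj_by_closed [simp]: "g \<in> carrier G \<Longrightarrow> y \<in> carrier G \<Longrightarrow> conj_by g y \<in> carrier G"
  by (simp add: conj_by_def)

lemma conj_by_conj_by:
  "g \<in> carrier G \<Longrightarrow> h \<in> carrier G \<Longrightarrow> y \<in> carrier G \<Longrightarrow>
    conj_by g (conj_by h y) = conj_by (conj_by g h) (conj_by g y)"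
  by (simp add: conj_by_def m_assoc inv_mult_group inv_mult_cancel)

lemma conj_by_eq_iff:
  assumes "g \<in> carrier G" "y \<in> carrier G" "z \<in> carrier G"
  shows "conj_by g y = z \<longleftrightarrow> y \<otimes> g = g \<otimes> z"
proof
  assume "conj_by g y = z"
  then show "y \<otimes> g = g \<otimes> z" using assms by (auto simp: conj_by_def m_assoc inv_mult_cancel)
next
  assume "y \<otimes> g = g \<otimes> z"
  then show "conj_by g y = z" using assms by (simp add: conj_by_def m_assoc inv_mult_cancel)
qed

end

declare xword.simps [simp del]

lemma F_relators_xword:
  "F_relators = {wcomm (gen 0 @ winv (gen 1)) (xword 2), wcomm (gen 0 @ winv (gen 1)) (xword 3)}"
  by (simp add: F_relators_def Let_def gen_def winv_def xword.simps numeral_2_eq_2 numeral_3_eq_3)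

text \<open>The relations are studied in an arbitrary group, because they will be applied to a direct product
  whose second factor consists of homeomorphisms.\<close>

locale F_relations = group G for G (structure) +
  fixes a b :: 'a
  assumes ab: "a \<in> carrier G" "b \<in> carrier G"
    and relators: "\<And>r. r \<in> F_relators \<Longrightarrow> word_val G [a, b] r = \<one>"
begin

definition x :: "nat \<Rightarrow> 'a" where
  "x n = word_val G [a, b] (xword n)"

lemma val_append: "u \<in> words 2 \<Longrightarrow> v \<in> words 2 \<Longrightarrow>
    word_val G [a, b] (u @ v) = word_val G [a, b] u \<otimes> word_val G [a, b] v"
  using word_val_append[of "[a, b]" u v] ab by (simp add: numeral_2_eq_2)

lemma val_winv: "w \<in> words 2 \<Longrightarrow> word_val G [a, b] (winv w) = inv (word_val G [a, b] w)"
  using word_val_winv[of "[a, b]" w] ab by (simp add: numeral_2_eq_2)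

lemma val_closed [simp]: "w \<in> words 2 \<Longrightarrow> word_val G [a, b] w \<in> carrier G"
  using word_val_closed[of "[a, b]" w] ab by (simp add: numeral_2_eq_2)

lemma x_closed [simp]: "x n \<in> carrier G"
  by (simp add: x_def)

lemma val_gen: "word_val G [a, b] (gen 0) = a" "word_val G [a, b] (gen 1) = b"
    "word_val G [a, b] (gen (Suc 0)) = b"
  using ab by (simp_all add: gen_def)

lemma x_0: "x 0 = a" and x_1: "x (Suc 0) = b"
  using val_gen by (simp_all add: x_def xword.simps gen_def)

lemma conj_a_x: "conj_by a (x (Suc n)) = x (Suc (Suc n))"
proof -
  let ?p = "word_val G [a, b] (replicate n (0, True))"
  have p: "?p \<in> carrier G" by simp
  have "replicate (Suc n) (0, True) = gen 0 @ replicate n (0::nat, True)" by (simp add: gen_def)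
  then have "word_val G [a, b] (replicate (Suc n) (0, True)) = a \<otimes> ?p"
    by (simp only: val_append gen_words words_replicate fst_conv val_gen zero_less_numeral)
  moreover have "a \<otimes> ?p = ?p \<otimes> a"
  proof (induction n)
    case (Suc n)
    let ?q = "word_val G [a, b] (replicate n (0, True))"
    have "a \<otimes> (a \<otimes> ?q) = a \<otimes> (?q \<otimes> a)" using Suc by simp
    also have "\<dots> = (a \<otimes> ?q) \<otimes> a" using ab by (simp add: m_assoc)
    finally show ?case by simp
  qed (use ab in simp)
  moreover have "x (Suc m) = inv (word_val G [a, b] (replicate m (0, True))) \<otimes> b \<otimes> word_val G [a, b] (replicate m (0, True))" for m
    using val_gen by (simp add: x_def xword.simps val_append val_winv m_assoc ab)
  ultimately show ?thesis using p ab
    by (simp only: conj_by_def) (simp add: inv_mult_group m_assoc)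
qed

text \<open>The relator says that conjugation by \<open>x\<^sub>1\<close> agrees with conjugation by \<open>x\<^sub>0\<close> on \<open>y\<close>.\<close>

lemma conj_b_of_relator:
  assumes "w \<in> words 2" "wcomm (gen 0 @ winv (gen 1)) w \<in> F_relators"
  shows "conj_by b (word_val G [a, b] w) = conj_by a (word_val G [a, b] w)"
proof -
  let ?y = "word_val G [a, b] w"
  have y: "?y \<in> carrier G" using assms(1) by simp
  have "inv (a \<otimes> inv b) \<otimes> (inv ?y \<otimes> ((a \<otimes> inv b) \<otimes> ?y)) = \<one>"
    using relators[OF assms(2)] assms(1)
    by (simp add: wcomm_def val_append val_winv val_gen ab m_assoc del: winv_append)
  then have "(?y \<otimes> (a \<otimes> inv b)) \<otimes> (inv (a \<otimes> inv b) \<otimes> (inv ?y \<otimes> ((a \<otimes> inv b) \<otimes> ?y))) = ?y \<otimes> (a \<otimes> inv b)"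
    using y ab by simp
  then have "(a \<otimes> inv b) \<otimes> ?y = ?y \<otimes> (a \<otimes> inv b)"
    using y ab by (simp add: m_assoc inv_mult_cancel inv_mult_group)
  then have "inv a \<otimes> ((a \<otimes> inv b) \<otimes> ?y) \<otimes> b = inv a \<otimes> (?y \<otimes> (a \<otimes> inv b)) \<otimes> b" by simp
  then show ?thesis using y ab by (simp add: conj_by_def m_assoc inv_mult_cancel)
qed

text \<open>The two relators give the cases \<open>n = 0\<close> and \<open>n = 1\<close>. The induction step expresses \<open>x\<^sub>n\<^sub>+\<^sub>2\<close> as the
  conjugate of \<open>x\<^sub>n\<^sub>+\<^sub>1\<close> by \<open>x\<^sub>2\<close> and conjugates this by \<open>x\<^sub>1\<close> and by \<open>x\<^sub>0\<close>, with the same result.\<close>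

lemma conj_b_x: "conj_by b (x (Suc (Suc n))) = x (Suc (Suc (Suc n)))"
proof (induction n rule: less_induct)
  case (less n)
  have c2: "conj_by b (x 2) = x 3"
    using conj_b_of_relator[OF xword_words[of 2]] conj_a_x[of 1]
    by (simp add: F_relators_xword numeral_2_eq_2 numeral_3_eq_3 flip: x_def)
  have c3: "conj_by b (x 3) = x 4"
    using conj_b_of_relator[OF xword_words[of 3]] conj_a_x[of 2]
    by (simp add: F_relators_xword eval_nat_numeral flip: x_def)
  consider "n = 0" | "n = 1" | m where "n = Suc (Suc m)" by (cases n; cases "n - 1") auto
  then show ?case
  proof cases
    case (3 m)
    define y where "y = x (Suc (Suc (Suc m)))"
    define z where "z = x (Suc (Suc (Suc (Suc m))))"
    have closed: "y \<in> carrier G" "z \<in> carrier G" by (simp_all add: y_def z_def)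
    have P: "conj_by b (x (Suc (Suc m))) = y" "conj_by b y = z"
      using less[of m] less[of "Suc m"] 3 by (simp_all add: y_def z_def)
    have a2: "conj_by a b = x 2" "conj_by a (x 2) = x 3"
      using conj_a_x[of 0] conj_a_x[of 1] by (simp_all add: x_1 numeral_2_eq_2 numeral_3_eq_3)
    have ay: "conj_by a (x (Suc (Suc m))) = y" "conj_by a y = z" "conj_by a z = x (Suc (Suc (Suc (Suc (Suc m)))))"
      by (simp_all add: y_def z_def conj_a_x)
    have "z = conj_by a (conj_by b (x (Suc (Suc m))))" by (simp add: P(1) ay(2))
    also have "\<dots> = conj_by (x 2) y" using ab by (simp add: conj_by_conj_by[of a b] a2 ay)
    finally have z: "z = conj_by (x 2) y" .
    have "conj_by b z = conj_by b (conj_by (x 2) y)" using z by simp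
    also have "\<dots> = conj_by (x 3) z" using ab closed by (simp add: conj_by_conj_by[of b "x 2"] c2 P(2))
    also have "\<dots> = conj_by a (conj_by (x 2) y)" using ab closed by (simp add: conj_by_conj_by[of a "x 2"] a2 ay)
    also have "\<dots> = conj_by a z" using z by simp
    finally show ?thesis using 3 ay(3) by (simp add: z_def)
  qed (use c2 c3 in \<open>simp_all add: eval_nat_numeral\<close>)
qed

lemma conj_x_x: "k < n \<Longrightarrow> conj_by (x k) (x n) = x (Suc n)"
proof (induction k arbitrary: n)
  case 0
  then obtain m where "n = Suc m" by (metis less_nat_zero_code not0_implies_Suc)
  then show ?case using conj_a_x[of m] by (simp add: x_0)
next
  case (Suc k)
  then obtain m where n: "n = Suc m" "k < m" by (metis Suc_lessE)
  then obtain m' where m': "m = Suc m'" by (metis less_nat_zero_code not0_implies_Suc)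
  show ?case
  proof (cases k)
    case 0
    then show ?thesis using conj_b_x[of m'] n m' by (simp add: x_1)
  next
    case (Suc k')
    have "conj_by (x (Suc k)) (x n) = conj_by (conj_by a (x k)) (conj_by a (x m))"
      using Suc n m' conj_a_x by simp
    also have "\<dots> = conj_by a (conj_by (x k) (x m))"
      using ab by (intro conj_by_conj_by[symmetric]) auto
    also have "\<dots> = x (Suc n)" using Suc.IH[OF n(2)] n m' conj_a_x by simp
    finally show ?thesis .
  qed
qed

lemma x_commute:
  assumes "k < n" shows "x n \<otimes> x k = x k \<otimes> x (Suc n)"
  using conj_x_x[OF assms] conj_by_eq_iff by simp

subsection \<open>Fractions of positive words\<close>

definition pos :: "nat list \<Rightarrow> 'a" where
  "pos ns = foldr (\<lambda>n y. x n \<otimes> y) ns \<one>"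

lemma pos_simps [simp]: "pos [] = \<one>" "pos (n # ns) = x n \<otimes> pos ns"
  by (simp_all add: pos_def)

lemma pos_closed [simp]: "pos ns \<in> carrier G"
  by (induction ns) auto

lemma pos_append: "pos (ms @ ns) = pos ms \<otimes> pos ns"
  by (induction ms) (auto simp: m_assoc)

text \<open>Moving \<open>x\<^sub>n\<close> to the right past a generator with smaller index increases \<open>n\<close>, so it reaches its
  place.\<close>

lemma pos_insert:
  "sorted ms \<Longrightarrow> \<exists>ms'. sorted ms' \<and> x n \<otimes> pos ms = pos ms' \<and>
    (\<forall>j. j \<le> n \<longrightarrow> (\<forall>i \<in> set ms. j \<le> i) \<longrightarrow> (\<forall>i \<in> set ms'. j \<le> i))"
proof (induction ms arbitrary: n)
  case Nil
  then show ?case by (intro exI[of _ "[n]"]) auto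
next
  case (Cons k ms)
  show ?case
  proof (cases "n \<le> k")
    case True
    then show ?thesis using Cons.prems by (intro exI[of _ "n # k # ms"]) auto
  next
    case False
    obtain ms' where ms': "sorted ms'" "x (Suc n) \<otimes> pos ms = pos ms'"
      "\<And>j. j \<le> Suc n \<Longrightarrow> \<forall>i \<in> set ms. j \<le> i \<Longrightarrow> \<forall>i \<in> set ms'. j \<le> i"
      using Cons.IH[of "Suc n"] Cons.prems by auto
    have "x n \<otimes> pos (k # ms) = x k \<otimes> (x (Suc n) \<otimes> pos ms)"
      using x_commute[of k n] False by (simp flip: m_assoc)
    then have "x n \<otimes> pos (k # ms) = pos (k # ms')" using ms'(2) by simp
    moreover have "sorted (k # ms')" using ms'(1) ms'(3)[of k] Cons.prems False by auto
    moreover have "\<forall>i \<in> set (k # ms'). j \<le> i" if "j \<le> n" "\<forall>i \<in> set (k # ms). j \<le> i" for j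
      using ms'(3)[of j] that by auto
    ultimately show ?thesis by blast
  qed
qed

lemma pos_sorted: "\<exists>ms. sorted ms \<and> pos ns = pos ms"
proof (induction ns)
  case Nil
  then show ?case by (intro exI[of _ "[]"]) auto
next
  case (Cons n ns)
  then obtain ms where "sorted ms" "pos ns = pos ms" by blast
  with pos_insert[of ms n] show ?case by auto
qed

text \<open>An inverse generator moves to the right past a positive word, changing indices only, until it is
  cancelled or reaches the end.\<close>

lemma inv_x_pos: "\<exists>p q. inv (x i) \<otimes> pos ns = pos p \<otimes> inv (pos q)"
proof (induction ns arbitrary: i)
  case Nil
  then show ?case by (intro exI[of _ "[]"] exI[of _ "[i]"]) simp
next
  case (Cons k ns)
  consider "k = i" | "k < i" | "i < k" by linarith
  then show ?case
  proof cases
    case 1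
    then show ?thesis by (intro exI[of _ ns] exI[of _ "[]"]) (simp add: inv_mult_cancel)
  next
    case 2
    have "inv (x i) \<otimes> x k = x k \<otimes> inv (x (Suc i))"
    proof -
      have "inv (x i) \<otimes> (x i \<otimes> x k) \<otimes> inv (x (Suc i)) = inv (x i) \<otimes> (x k \<otimes> x (Suc i)) \<otimes> inv (x (Suc i))"
        using x_commute[OF 2] by simp
      then show ?thesis by (simp add: m_assoc inv_mult_cancel)
    qed
    then have eq: "inv (x i) \<otimes> pos (k # ns) = x k \<otimes> (inv (x (Suc i)) \<otimes> pos ns)" by (simp flip: m_assoc)
    obtain p q where "inv (x (Suc i)) \<otimes> pos ns = pos p \<otimes> inv (pos q)" using Cons.IH by blast
    then have "inv (x i) \<otimes> pos (k # ns) = pos (k # p) \<otimes> inv (pos q)" by (simp only: eq) (simp add: m_assoc)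
    then show ?thesis by blast
  next
    case 3
    have "inv (x i) \<otimes> x k = x (Suc k) \<otimes> inv (x i)"
    proof -
      have "inv (x i) \<otimes> (x k \<otimes> x i) \<otimes> inv (x i) = inv (x i) \<otimes> (x i \<otimes> x (Suc k)) \<otimes> inv (x i)"
        using x_commute[OF 3] by simp
      then show ?thesis by (simp add: m_assoc inv_mult_cancel)
    qed
    then have eq: "inv (x i) \<otimes> pos (k # ns) = x (Suc k) \<otimes> (inv (x i) \<otimes> pos ns)" by (simp flip: m_assoc)
    obtain p q where "inv (x i) \<otimes> pos ns = pos p \<otimes> inv (pos q)" using Cons.IH by blast
    then have "inv (x i) \<otimes> pos (k # ns) = pos (Suc k # p) \<otimes> inv (pos q)" by (simp only: eq) (simp add: m_assoc)
    then show ?thesis by blast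
  qed
qed

lemma val_fraction:
  "w \<in> words 2 \<Longrightarrow> \<exists>p q. word_val G [a, b] w = pos p \<otimes> inv (pos q)"
proof (induction w)
  case Nil
  then show ?case by (intro exI[of _ "[]"]) simp
next
  case (Cons l w)
  then obtain p q where pq: "word_val G [a, b] w = pos p \<otimes> inv (pos q)" by auto
  have "fst l = 0 \<or> fst l = 1" using Cons.prems by auto
  then have l: "[a, b] ! fst l = x (fst l)" by (auto simp: x_0 x_1)
  show ?case
  proof (cases "snd l")
    case True
    then have "word_val G [a, b] (l # w) = pos (fst l # p) \<otimes> inv (pos q)"
      using l by (simp add: pq m_assoc)
    then show ?thesis by blast
  next
    case False
    obtain p' q' where "inv (x (fst l)) \<otimes> pos p = pos p' \<otimes> inv (pos q')" using inv_x_pos by blast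
    moreover have "word_val G [a, b] (l # w) = inv (x (fst l)) \<otimes> pos p \<otimes> inv (pos q)"
      using False l by (simp add: pq m_assoc)
    ultimately have "word_val G [a, b] (l # w) = pos p' \<otimes> inv (pos (q @ q'))"
      by (simp add: m_assoc pos_append inv_mult_group)
    then show ?thesis by blast
  qed
qed

lemma val_sorted_fraction:
  assumes "w \<in> words 2"
  obtains p q where "sorted p" "sorted q" "word_val G [a, b] w = pos p \<otimes> inv (pos q)"
  using val_fraction[OF assms] pos_sorted by metis

end

subsection \<open>Sorted positive words are determined by their maps\<close>

definition posmap :: "nat list \<Rightarrow> real \<Rightarrow> real" where
  "posmap ns = foldr (\<lambda>n f. xgen n \<circ> f) ns id"

lemma posmap_simps [simp]: "posmap [] = id" "posmap (n # ns) = xgen n \<circ> posmap ns"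
  by (simp_all add: posmap_def)

lemma xgen_PL2: "xgen n \<in> PL2"
  using thompson_F_PL2[OF FV_F[OF xword_words[of n]]] by (simp only: FV_xword)

lemma xgen_le: "xgen n t \<le> t"
  by (cases n) (auto simp: alpha_def beta_def field_simps)

lemma xgen_fixes: "h < n \<Longrightarrow> xgen n (real h) = real h"
  by (cases n) (auto simp: beta_def)

lemma xgen_less: "t \<le> real h \<Longrightarrow> xgen h t < real h"
  by (cases h) (auto simp: alpha_def beta_def)

lemma posmap_le: "posmap ns t \<le> t"
proof (induction ns)
  case (Cons n ns)
  then show ?case using xgen_le[of n "posmap ns t"] by simp
qed simp

lemma posmap_fixes: "\<forall>n \<in> set ns. h < n \<Longrightarrow> posmap ns (real h) = real h"
  by (induction ns) (auto simp: xgen_fixes)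

lemma posmap_moves: "posmap (h # ns) (real h) < real h"
  using xgen_less[OF posmap_le] by simp

text \<open>For a sorted word that begins with \<open>h\<close>, the number \<open>h\<close> is the least natural number moved by the map.
  So the first letters of both words agree and can be cancelled.\<close>

lemma posmap_inject: "sorted p \<Longrightarrow> sorted q \<Longrightarrow> posmap p = posmap q \<Longrightarrow> p = q"
proof (induction p arbitrary: q)
  case Nil
  show ?case
  proof (cases q)
    case (Cons h q')
    then show ?thesis using posmap_moves[of h q'] Nil.prems(3) by (metis id_apply less_irrefl posmap_simps(1))
  qed simp
next
  case (Cons h p)
  show ?case
  proof (cases q)
    case Nil
    then show ?thesis using posmap_moves[of h p] Cons.prems(3) by (metis id_apply less_irrefl posmap_simps(1))
  next
    case q: (Cons k q')
    have "\<not> h < k"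
    proof
      assume "h < k"
      then have "\<forall>n \<in> set q. h < n" using Cons.prems(2) q by auto
      then have "posmap q (real h) = real h" by (rule posmap_fixes)
      then show False using posmap_moves[of h p] unfolding Cons.prems(3) by simp
    qed
    moreover have "\<not> k < h"
    proof
      assume "k < h"
      then have "\<forall>n \<in> set (h # p). k < n" using Cons.prems(1) by auto
      then have "posmap (h # p) (real k) = real k" by (rule posmap_fixes)
      then show False using posmap_moves[of k q'] unfolding Cons.prems(3) q by simp
    qed
    ultimately have hk: "h = k" by simp
    have "posmap p t = posmap q' t" for t
    proof -
      have "inj (xgen h)" using PL2_homeomorphism(1)[OF xgen_PL2] by (rule bij_is_inj)
      moreover have "xgen h (posmap p t) = xgen h (posmap q' t)"
        using fun_cong[OF Cons.prems(3), of t] q hk by simp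
      ultimately show ?thesis by (rule injD)
    qed
    then have "posmap p = posmap q'" by (auto simp: fun_eq_iff)
    moreover have "sorted p" "sorted q'" using Cons.prems(1,2) q by auto
    ultimately have "p = q'" using Cons.IH[of q'] by blast
    then show ?thesis using q hk by simp
  qed
qed

subsection \<open>Completeness of the presentation\<close>

lemma finv_beta: "finv beta = (\<lambda>t. if t \<le> 0 then t else if t \<le> 1 then 2 * t else t + 1)"
  by (rule Hilbert_Choice.inv_equality) (auto simp: beta_def)

text \<open>The commutators vanish because \<open>\<alpha>\<beta>\<^sup>-\<^sup>1\<close> is supported on the numbers below 1 and \<open>x\<^sub>2, x\<^sub>3\<close> on
  those above 1.\<close>

lemma FV_relators:
  assumes "r \<in> F_relators" shows "FV r = id"
proof -
  have gens: "FV (gen 0) = alpha" "FV (gen 1) = beta" "FV (gen (Suc 0)) = beta"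
    by (simp_all add: gen_def)
  let ?g = "gen 0 @ winv (gen 1)"
  have g: "FV ?g = (\<lambda>t. if t \<le> 0 then t - 1 else if t \<le> 1 then 2 * t - 1 else t)"
    by (simp add: FV_append FV_winv gens finv_beta fun_eq_iff alpha_def)
  have "FV (wcomm ?g (xword n)) = id" if "n = 2 \<or> n = 3" for n
  proof -
    have low: "xgen n t = t" if "t \<le> 1" for t
      using \<open>n = 2 \<or> n = 3\<close> that by (auto simp: eval_nat_numeral beta_def)
    have high: "1 < xgen n t" if "1 < t" for t
      using \<open>n = 2 \<or> n = 3\<close> that by (auto simp: eval_nat_numeral beta_def field_simps)
    have comm: "FV ?g \<circ> xgen n = xgen n \<circ> FV ?g"
    proof
      fix t
      show "(FV ?g \<circ> xgen n) t = (xgen n \<circ> FV ?g) t"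
      proof (cases "t \<le> 1")
        case True
        then have "FV ?g t \<le> 1" unfolding g by simp
        then show ?thesis using True by (simp add: low)
      next
        case False
        then have "FV ?g t = t" "FV ?g (xgen n t) = xgen n t" using high[of t] unfolding g by simp_all
        then show ?thesis by simp
      qed
    qed
    have PL: "FV ?g \<in> PL2" "xgen n \<in> PL2" using FV_F[of ?g] xgen_PL2 by (auto intro: thompson_F_PL2)
    have "FV (wcomm ?g (xword n)) = finv (FV ?g) \<circ> (finv (xgen n) \<circ> (FV ?g \<circ> xgen n))"
      unfolding wcomm_def by (simp only: FV_append FV_winv FV_xword words_append winv_words xword_words gen_words
          comp_assoc zero_less_numeral one_less_numeral_iff semiring_norm)
    also have "\<dots> = id" unfolding comm using PL2_inv[OF PL(1)] PL2_inv[OF PL(2)] by (simp add: fun_eq_iff)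
    finally show ?thesis .
  qed
  from this[of 2] this[of 3] show ?thesis using assms by (auto simp: F_relators_xword)
qed

lemma word_val_DirProd:
  assumes "group G" "group H" "set gs \<subseteq> carrier G" "set hs \<subseteq> carrier H"
    "w \<in> words (length gs)" "length hs = length gs"
  shows "word_val (G \<times>\<times> H) (zip gs hs) w = (word_val G gs w, word_val H hs w)"
  using assms(5)
proof (induction w)
  case (Cons l w)
  then have "gs ! fst l \<in> carrier G" "hs ! fst l \<in> carrier H" using assms nth_mem by auto
  with Cons assms show ?case by (simp add: inv_DirProd)
qed simp

text \<open>Rewriting a word as a fraction of sorted positive words uses the relations only, so it can be
  done simultaneously in \<open>G\<close> and in the group of homeomorphisms, where the numerator and the
  denominator must be the same word.\<close>

lemma F_relations_complete:
  assumes "group G" and ab: "a \<in> carrier G" "b \<in> carrier G"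
    and rel: "\<And>r. r \<in> F_relators \<Longrightarrow> word_val G [a, b] r = \<one>\<^bsub>G\<^esub>"
    and w: "w \<in> words 2" "FV w = id"
  shows "word_val G [a, b] w = \<one>\<^bsub>G\<^esub>"
proof -
  interpret G: group G by fact
  interpret P: group "G \<times>\<times> PL2_group" by (rule DirProd_group[OF assms(1) group_PL2])
  have val: "word_val (G \<times>\<times> PL2_group) [(a, alpha), (b, beta)] v = (word_val G [a, b] v, FV v)"
    if "v \<in> words 2" for v
    using word_val_DirProd[of G PL2_group "[a, b]" "[alpha, beta]" v] that ab alpha_beta_PL2 group_PL2 assms(1)
    by (simp add: numeral_2_eq_2)
  have words: "r \<in> words 2" if "r \<in> F_relators" for r
    using that by (auto simp: F_relators_def Let_def wcomm_def)
  interpret R: F_relations "G \<times>\<times> PL2_group" "(a, alpha)" "(b, beta)"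
    by unfold_locales (use ab alpha_beta_PL2 val words rel FV_relators in auto)
  have R_x: "R.x n = (word_val G [a, b] (xword n), xgen n)" for n
    unfolding R.x_def by (simp only: val xword_words FV_xword)
  have snd_pos: "snd (R.pos ns) = posmap ns" for ns
    by (induction ns) (simp_all add: R_x mult_DirProd')
  obtain p q where pq: "sorted p" "sorted q" "(word_val G [a, b] w, FV w) = R.pos p \<otimes>\<^bsub>G \<times>\<times> PL2_group\<^esub> inv\<^bsub>G \<times>\<times> PL2_group\<^esub> R.pos q"
    using R.val_sorted_fraction[OF w(1)] val[OF w(1)] by metis
  have "(word_val G [a, b] w, FV w) \<otimes>\<^bsub>G \<times>\<times> PL2_group\<^esub> R.pos q = R.pos p"
    unfolding pq(3) by (simp only: P.m_assoc P.l_inv P.r_one P.inv_closed R.pos_closed)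
  then have "snd ((word_val G [a, b] w, FV w) \<otimes>\<^bsub>G \<times>\<times> PL2_group\<^esub> R.pos q) = snd (R.pos p)" by simp
  then have "posmap p = posmap q" by (simp add: snd_pos mult_DirProd' w(2))
  from posmap_inject[OF pq(1,2) this] have "p = q" .
  then have "(word_val G [a, b] w, FV w) = \<one>\<^bsub>G \<times>\<times> PL2_group\<^esub>"
    unfolding pq(3) by (simp only: P.r_inv R.pos_closed)
  then show ?thesis by simp
qed

section \<open>Extensions of \<open>F\<close> by free groups\<close>

text \<open>The elements of the normalizer of \<open>F\<close>, described by conjugation of maps.\<close>

definition normF :: "(real \<Rightarrow> real) \<Rightarrow> bool" where
  "normF e \<longleftrightarrow> e \<in> PL2 \<and> (\<forall>f \<in> thompson_F. e \<circ> f \<circ> finv e \<in> thompson_F \<and> finv e \<circ> f \<circ> e \<in> thompson_F)"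

lemma normF_PL2: "normF e \<Longrightarrow> e \<in> PL2"
  by (simp add: normF_def)

lemma finv_finv: "e \<in> PL2 \<Longrightarrow> finv (finv e) = e"
  using PL2_homeomorphism(1) by (simp add: inv_inv_eq)

lemma finv_comp: "e \<in> PL2 \<Longrightarrow> e' \<in> PL2 \<Longrightarrow> finv (e \<circ> e') = finv e' \<circ> finv e"
  using PL2_homeomorphism(1) by (intro o_inv_distrib) auto

lemma normF_inv: "normF e \<Longrightarrow> normF (finv e)"
  by (auto simp: normF_def PL2_inverse finv_finv simp del: o_apply)

lemma normF_comp:
  assumes "normF e" "normF e'" shows "normF (e \<circ> e')"
proof -
  have PL: "e \<in> PL2" "e' \<in> PL2" using assms by (auto simp: normF_def)
  have "(e \<circ> e') \<circ> f \<circ> finv (e \<circ> e') \<in> thompson_F \<and> finv (e \<circ> e') \<circ> f \<circ> (e \<circ> e') \<in> thompson_F"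
    if f: "f \<in> thompson_F" for f
  proof -
    have "e \<circ> (e' \<circ> f \<circ> finv e') \<circ> finv e \<in> thompson_F" "finv e' \<circ> (finv e \<circ> f \<circ> e) \<circ> e' \<in> thompson_F"
      using assms f unfolding normF_def by blast+
    then show ?thesis by (simp only: finv_comp[OF PL] comp_assoc)
  qed
  then show ?thesis unfolding normF_def using PL PL2_comp(1) by blast
qed

lemma normF_F: "f \<in> thompson_F \<Longrightarrow> normF f"
  unfolding normF_def by (auto intro!: thompson_F_comp thompson_F_inv thompson_F_PL2)

lemma normF_normalizer:
  assumes "e \<in> normalizer PL2_group thompson_F" shows "normF e"
proof -
  have sub: "thompson_F \<subseteq> PL2" using thompson_F_PL2 by blast
  have e: "e \<in> PL2" and eq: "e <#\<^bsub>PL2_group\<^esub> thompson_F #>\<^bsub>PL2_group\<^esub> (inv\<^bsub>PL2_group\<^esub> e) = thompson_F"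
    using assms sub by (auto simp: normalizer_def stabilizer_def)
  have set: "(\<lambda>f. e \<circ> f \<circ> finv e) ` thompson_F = thompson_F"
  proof -
    have "e <#\<^bsub>PL2_group\<^esub> thompson_F #>\<^bsub>PL2_group\<^esub> finv e = (\<lambda>f. e \<circ> f \<circ> finv e) ` thompson_F"
      unfolding l_coset_def r_coset_def PL2_group_simps by blast
    with eq[unfolded inv_PL2[OF e]] show ?thesis by (simp only:)
  qed
  have "finv e \<circ> f \<circ> e \<in> thompson_F" if "f \<in> thompson_F" for f
  proof -
    from that have "f \<in> (\<lambda>f. e \<circ> f \<circ> finv e) ` thompson_F" by (simp only: set)
    then obtain f' where f': "f' \<in> thompson_F" "f = e \<circ> f' \<circ> finv e" by (auto simp del: o_apply)
    have "finv e \<circ> f \<circ> e = f'" unfolding f'(2) by (simp add: fun_eq_iff PL2_inv[OF e])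
    with f'(1) show ?thesis by simp
  qed
  moreover have "e \<circ> f \<circ> finv e \<in> thompson_F" if "f \<in> thompson_F" for f
    using imageI[OF that, of "\<lambda>f. e \<circ> f \<circ> finv e"] by (simp only: set)
  ultimately show ?thesis unfolding normF_def using e by simp
qed

abbreviation PV :: "(real \<Rightarrow> real) list \<Rightarrow> word \<Rightarrow> real \<Rightarrow> real" where
  "PV \<equiv> word_val PL2_group"

lemma PV_normF:
  assumes "\<And>e. e \<in> set es \<Longrightarrow> normF e" "w \<in> words (length es)"
  shows "normF (PV es w)"
  using assms(2)
proof (induction w)
  case Nil
  show ?case using normF_F[OF thompson_F_id] by (simp only: word_val.simps PL2_group_simps)
next
  case (Cons l w)
  have e: "normF (es ! fst l)" using assms(1) Cons.prems nth_mem by auto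
  define g where "g = (if snd l then es ! fst l else finv (es ! fst l))"
  have "PV es (l # w) = g \<circ> PV es w" using normF_PL2[OF e] by (simp only: g_def word_val.simps inv_PL2 PL2_group_simps)
  moreover have "normF g" using e normF_inv[OF e] by (simp add: g_def)
  moreover have "normF (PV es w)" using Cons by simp
  ultimately show ?case by (simp only: normF_comp)
qed

lemma PV_append:
  assumes "\<And>e. e \<in> set es \<Longrightarrow> normF e" "u \<in> words (length es)" "v \<in> words (length es)"
  shows "PV es (u @ v) = PV es u \<circ> PV es v"
  using PL2.word_val_append[of es u v] assms normF_PL2 by (simp add: subset_iff)

lemma PV_winv:
  assumes "\<And>e. e \<in> set es \<Longrightarrow> normF e" "w \<in> words (length es)"
  shows "PV es (winv w) = finv (PV es w)"
  using PL2.word_val_winv[of es w] assms normF_PL2[OF PV_normF[OF assms]] normF_PL2 by (simp add: subset_iff)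

text \<open>Conjugation of a word in \<open>\<alpha>, \<beta>\<close> by a normalizing element is a substitution of
  words for letters, taken from the table \<open>S\<close>.\<close>

definition subst_word :: "(nat \<times> bool \<Rightarrow> nat \<times> bool \<Rightarrow> word) \<Rightarrow> nat \<times> bool \<Rightarrow> word \<Rightarrow> word" where
  "subst_word S l f = concat (map (S l) f)"

text \<open>The default value \<open>[]\<close> keeps the support finite, which makes the table computable.\<close>

definition conj_table :: "(real \<Rightarrow> real) list \<Rightarrow> (nat \<times> bool \<Rightarrow> nat \<times> bool \<Rightarrow> word) \<Rightarrow> bool" where
  "conj_table es S \<longleftrightarrow> (\<forall>l x. \<not> (fst l < length es \<and> fst x < 2) \<longrightarrow> S l x = []) \<and>
     (\<forall>l x. fst l < length es \<longrightarrow> fst x < 2 \<longrightarrow> S l x \<in> words 2 \<and>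
        FV (S l x) = PV es [l] \<circ> FV [x] \<circ> finv (PV es [l]))"

lemma conj_table_exists:
  assumes "\<And>e. e \<in> set es \<Longrightarrow> normF e"
  shows "\<exists>S. conj_table es S"
proof -
  define D where "D l x = (SOME w. w \<in> words 2 \<and> FV w = PV es [l] \<circ> FV [x] \<circ> finv (PV es [l]))" for l x
  have "D l x \<in> words 2 \<and> FV (D l x) = PV es [l] \<circ> FV [x] \<circ> finv (PV es [l])"
    if "fst l < length es" "fst x < 2" for l x
  proof -
    have "normF (PV es [l])" using that by (intro PV_normF assms) auto
    moreover have "FV [x] \<in> thompson_F" using that by (intro FV_F) auto
    ultimately have "PV es [l] \<circ> FV [x] \<circ> finv (PV es [l]) \<in> thompson_F" unfolding normF_def by blast
    from F_generated[OF this, unfolded Bex_def] show ?thesis unfolding D_def by (rule someI_ex)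
  qed
  then have "conj_table es (\<lambda>l x. if fst l < length es \<and> fst x < 2 then D l x else [])"
    unfolding conj_table_def by (auto simp del: word_val.simps)
  then show ?thesis by blast
qed

lemma conj_tableD:
  assumes "conj_table es S" "fst l < length es" "fst x < 2"
  shows "S l x \<in> words 2" "FV (S l x) = PV es [l] \<circ> FV [x] \<circ> finv (PV es [l])"
  using assms unfolding conj_table_def by blast+

lemma computable_subst_word:
  assumes "conj_table es S" "computable l" "computable f"
  shows "computable (\<lambda>x. subst_word S (l x) (f x))"
proof -
  have "fst l < length es \<and> fst x < 2" if "S l x \<noteq> []" for l x
    using assms(1) that unfolding conj_table_def by blast
  then have "{p. S (fst p) (snd p) \<noteq> []} \<subseteq> ({..<length es} \<times> UNIV) \<times> ({..<2} \<times> UNIV)"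
    by (auto simp: mem_Times_iff)
  then have "finite {p. S (fst p) (snd p) \<noteq> []}" by (rule finite_subset) (intro finite_cartesian_product; simp)
  then have S: "computable (\<lambda>p. S (fst p) (snd p))" by (rule computable_finite_table)
  have "computable (\<lambda>p. (l (fst p), snd p))"
    by (intro computable_Pair computable_snd computable_id computable_comp[OF assms(2) computable_fst])
  from computable_comp[OF S this] have "computable (\<lambda>p. S (l (fst p)) (snd p))" by simp
  then show ?thesis unfolding subst_word_def by (intro computable_intros assms)
qed

lemma subst_word:
  assumes S: "conj_table es S" and es: "\<And>e. e \<in> set es \<Longrightarrow> normF e" and l: "fst l < length es"
    and f: "f \<in> words 2"
  shows "subst_word S l f \<in> words 2 \<and> FV (subst_word S l f) = PV es [l] \<circ> FV f \<circ> finv (PV es [l])"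
  using f
proof (induction f)
  case Nil
  have "PV es [l] \<in> PL2" using l by (intro normF_PL2 PV_normF es) auto
  then show ?case by (simp add: subst_word_def fun_eq_iff PL2_inv del: word_val.simps(2))
next
  case (Cons x f)
  let ?e = "PV es [l]"
  have e: "?e \<in> PL2" using l by (intro normF_PL2 PV_normF es) auto
  have x: "[x] \<in> words 2" using Cons.prems by simp
  have fw: "f \<in> words 2" "fst x < 2" using Cons.prems by auto
  note IH = Cons.IH[OF fw(1)]
  have w: "S l x \<in> words 2" "subst_word S l f \<in> words 2" using conj_tableD(1)[OF S l fw(2)] IH by blast+
  have eq: "subst_word S l (x # f) = S l x @ subst_word S l f" by (simp add: subst_word_def)
  have "FV (subst_word S l (x # f)) = (?e \<circ> FV [x] \<circ> finv ?e) \<circ> (?e \<circ> FV f \<circ> finv ?e)"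
    unfolding eq FV_append[OF w] by (simp only: IH conj_tableD(2)[OF S l fw(2)])
  also have "\<dots> = ?e \<circ> (FV [x] \<circ> FV f) \<circ> finv ?e"
    by (simp add: fun_eq_iff PL2_inv[OF e] del: word_val.simps)
  also have "FV [x] \<circ> FV f = FV (x # f)" using FV_append[OF x fw(1)] by (simp only: append_Cons append_Nil)
  finally show ?case using w by (simp only: eq words_append simp_thms)
qed

text \<open>The group \<open>G\<close> of the theorem: stable letters that act on \<open>F\<close> as the
  normalizing elements \<open>phi\<close>.\<close>

locale F_extension =
  fixes n :: nat and wa wb :: "word list" and phi :: "(real \<Rightarrow> real) list"
  assumes len: "length phi = n"
    and phi: "\<And>e. e \<in> set phi \<Longrightarrow> normF e"
    and wa: "\<And>j. j < n \<Longrightarrow> wa ! j \<in> words 2" and wb: "\<And>j. j < n \<Longrightarrow> wb ! j \<in> words 2"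
    and wa_val: "\<And>j. j < n \<Longrightarrow> FV (wa ! j) = finv (phi ! j) \<circ> alpha \<circ> phi ! j"
    and wb_val: "\<And>j. j < n \<Longrightarrow> FV (wb ! j) = finv (phi ! j) \<circ> beta \<circ> phi ! j"
begin

definition R :: "word set" where "R = extension_relators n wa wb"
definition P :: "word set monoid" where "P = presented_group (n + 2) R"
definition ev :: "word \<Rightarrow> word set" where "ev = word_val P (pres_gens (n + 2) R)"
definition es :: "(real \<Rightarrow> real) list" where "es = alpha # beta # phi"

sublocale P: group P
  unfolding P_def by (rule group_presented_group)

lemma length_es [simp]: "length es = n + 2"
  by (simp add: es_def len)

lemma es_normF: "e \<in> set es \<Longrightarrow> normF e"
  using phi normF_F[OF alpha_F] normF_F[OF beta_F] by (auto simp: es_def)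

lemma words_2_sub: "w \<in> words 2 \<Longrightarrow> w \<in> words (n + 2)"
  by (rule words_mono) auto

lemma words_2_sub': "w \<in> words 2 \<Longrightarrow> w \<in> words (Suc (Suc n))"
  by (rule words_mono) auto

lemma ev_closed [simp]: "w \<in> words (n + 2) \<Longrightarrow> ev w \<in> carrier P"
  using P.word_val_closed[of "pres_gens (n + 2) R" w] pres_gens_closed[of "n + 2" R]
  by (simp add: ev_def P_def)

lemma ev_append: "u \<in> words (n + 2) \<Longrightarrow> v \<in> words (n + 2) \<Longrightarrow> ev (u @ v) = ev u \<otimes>\<^bsub>P\<^esub> ev v"
  using P.word_val_append[of "pres_gens (n + 2) R" u v] pres_gens_closed[of "n + 2" R]
  by (simp add: ev_def P_def)

lemma ev_winv: "w \<in> words (n + 2) \<Longrightarrow> ev (winv w) = inv\<^bsub>P\<^esub> ev w"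
  using P.word_val_winv[of "pres_gens (n + 2) R" w] pres_gens_closed[of "n + 2" R]
  by (simp add: ev_def P_def)

lemma ev_Nil [simp]: "ev [] = \<one>\<^bsub>P\<^esub>"
  by (simp add: ev_def)

lemma carrier_P: "carrier P = ev ` words (n + 2)"
  unfolding P_def ev_def presented_group_carrier
  by (rule image_cong) (simp_all add: word_val_presented_group)

lemma ev_eq_iff: "u \<in> words (n + 2) \<Longrightarrow> v \<in> words (n + 2) \<Longrightarrow> ev u = ev v \<longleftrightarrow> pres_eq (n + 2) R u v"
  unfolding ev_def P_def by (rule word_val_presented_group_eq_iff)

lemma R_words: "r \<in> R \<Longrightarrow> r \<in> words (n + 2)"
  unfolding R_def extension_relators_def F_relators_def Let_def wcomm_def
  by (auto intro: wa[THEN words_2_sub] wb[THEN words_2_sub] wa[THEN words_2_sub'] wb[THEN words_2_sub'])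

lemma ev_relator: "r \<in> R \<Longrightarrow> ev r = \<one>\<^bsub>P\<^esub>"
  using pres_eq.relator[of "[]" "n + 2" "[]" r R] R_words ev_eq_iff[of r "[]"] by simp

lemma PV_words_2: "w \<in> words 2 \<Longrightarrow> PV es w = FV w"
  using word_val_take[of w "[alpha, beta]" PL2_group phi] by (simp add: es_def numeral_2_eq_2)

lemma PV_gens: "PV es (gen 0) = alpha" "PV es (gen 1) = beta" "PV es (gen (Suc 0)) = beta"
    "j < n \<Longrightarrow> PV es (gen (j + 2)) = phi ! j"
  by (simp_all add: es_def gen_def)

lemma PV_relator:
  assumes "r \<in> R" shows "PV es r = id"
proof -
  have conj: "PV es (winv (gen (j + 2)) @ gen i @ gen (j + 2) @ winv w) = id"
    if "j < n" "i < 2" "w \<in> words 2" "FV w = finv (phi ! j) \<circ> PV es (gen i) \<circ> phi ! j" for i j w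
  proof -
    have ww: "w \<in> words (length es)" "gen (j + 2) \<in> words (length es)" "gen i \<in> words (length es)"
      using that words_2_sub by auto
    have "PV es (winv (gen (j + 2)) @ gen i @ gen (j + 2) @ winv w) =
        finv (phi ! j) \<circ> (PV es (gen i) \<circ> (phi ! j \<circ> finv (FV w)))"
      using ww by (simp only: PV_append[OF es_normF] PV_winv[OF es_normF] words_append winv_words
          PV_gens(4)[OF that(1)] PV_words_2[OF that(3)])
    also have "\<dots> = (finv (phi ! j) \<circ> PV es (gen i) \<circ> phi ! j) \<circ> finv (FV w)" by (simp only: comp_assoc)
    also have "\<dots> = FV w \<circ> finv (FV w)" by (simp only: that(4))
    also have "\<dots> = id" using PL2_inv[OF thompson_F_PL2[OF FV_F[OF that(3)]]] by (simp add: fun_eq_iff)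
    finally show ?thesis .
  qed
  consider "r \<in> F_relators" | j where "j < n" "r = winv (gen (j + 2)) @ gen 0 @ gen (j + 2) @ winv (wa ! j)"
    | j where "j < n" "r = winv (gen (j + 2)) @ gen 1 @ gen (j + 2) @ winv (wb ! j)"
    using assms unfolding R_def extension_relators_def by blast
  then show ?thesis
  proof cases
    case 1
    then have "r \<in> words 2" by (auto simp: F_relators_def Let_def wcomm_def)
    then show ?thesis using FV_relators[OF 1] by (simp add: PV_words_2)
  next
    case (2 j)
    then show ?thesis using conj[of j 0 "wa ! j"] wa wa_val by (simp add: PV_gens)
  next
    case (3 j)
    then show ?thesis using conj[of j 1 "wb ! j"] wb wb_val by (simp add: PV_gens)
  qed
qed

lemma PV_cong:
  assumes "u \<in> words (n + 2)" "v \<in> words (n + 2)" "ev u = ev v"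
  shows "PV es u = PV es v"
proof (rule PL2.word_val_pres_eq[of es R])
  show "set es \<subseteq> carrier PL2_group" using es_normF normF_PL2 by auto
  show "pres_eq (length es) R u v" using assms ev_eq_iff by simp
qed (simp add: PV_relator)

text \<open>Since the relators of \<open>F\<close> are among those of \<open>G\<close>, words in \<open>\<alpha>, \<beta>\<close> that
  represent the same homeomorphism are equal in \<open>G\<close>.\<close>

lemma ev_cong_F:
  assumes "u \<in> words 2" "v \<in> words 2" "FV u = FV v"
  shows "ev u = ev v"
proof -
  let ?gs = "pres_gens (n + 2) R"
  have gs: "?gs = [?gs ! 0, ?gs ! 1] @ drop 2 ?gs"
    by (rule nth_equalityI) (auto simp: nth_append less_2_cases_iff nth_Cons split: nat.split)
  have ev2: "word_val P [?gs ! 0, ?gs ! 1] w = ev w" if "w \<in> words 2" for w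
    using word_val_take[of w "[?gs ! 0, ?gs ! 1]" P "drop 2 ?gs"] that gs
    by (simp add: ev_def numeral_2_eq_2)
  have "set ?gs \<subseteq> carrier P" unfolding P_def by (rule pres_gens_closed)
  then have g: "?gs ! 0 \<in> carrier P" "?gs ! 1 \<in> carrier P" using nth_mem[of 0 ?gs] nth_mem[of 1 ?gs] by auto
  have uv: "u @ winv v \<in> words 2" using assms by simp
  have "FV (u @ winv v) = id"
    using assms PL2_inv[OF thompson_F_PL2[OF FV_F[OF assms(2)]]] by (simp add: FV_append FV_winv fun_eq_iff)
  then have "word_val P [?gs ! 0, ?gs ! 1] (u @ winv v) = \<one>\<^bsub>P\<^esub>"
  proof (rule F_relations_complete[OF P.is_group g _ uv, rotated])
    fix r assume r: "r \<in> F_relators"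
    then have "r \<in> words 2" by (auto simp: F_relators_def Let_def wcomm_def)
    moreover have "r \<in> R" using r by (simp add: R_def extension_relators_def)
    ultimately show "word_val P [?gs ! 0, ?gs ! 1] r = \<one>\<^bsub>P\<^esub>" by (simp only: ev2 ev_relator)
  qed
  then have "ev (u @ winv v) = \<one>\<^bsub>P\<^esub>" by (simp only: ev2[OF uv])
  then have "ev u \<otimes>\<^bsub>P\<^esub> inv\<^bsub>P\<^esub> ev v = \<one>\<^bsub>P\<^esub>"
    using words_2_sub[OF assms(1)] words_2_sub[OF assms(2)] by (simp only: ev_append ev_winv winv_words)
  then show ?thesis using P.inv_equality[of "ev u" "inv\<^bsub>P\<^esub> ev v"] assms words_2_sub by simp
qed

subsection \<open>The normal subgroup \<open>F\<close> of \<open>G\<close>\<close>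

text \<open>Moving a letter to the right past a word in \<open>\<alpha>, \<beta>\<close>. Only the value of the
  resulting word matters, by the preceding lemma.\<close>

definition passes :: "nat \<times> bool \<Rightarrow> word \<Rightarrow> bool" where
  "passes l f \<longleftrightarrow> (\<exists>f' \<in> words 2. ev [l] \<otimes>\<^bsub>P\<^esub> ev f = ev f' \<otimes>\<^bsub>P\<^esub> ev [l])"

lemma passes_value:
  assumes l: "fst l < n + 2" and f: "f \<in> words 2" "f' \<in> words 2" and eq: "ev [l] \<otimes>\<^bsub>P\<^esub> ev f = ev f' \<otimes>\<^bsub>P\<^esub> ev [l]"
  shows "FV f' = PV es [l] \<circ> FV f \<circ> finv (PV es [l])"
proof -
  have lw: "[l] \<in> words (n + 2)" "[l] \<in> words (length es)" using l by simp_all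
  have w: "f \<in> words (n + 2)" "f' \<in> words (n + 2)" using f words_2_sub by auto
  have "ev ([l] @ f) = ev (f' @ [l])" using eq by (simp only: ev_append lw w)
  then have "PV es ([l] @ f) = PV es (f' @ [l])" using lw(1) w by (intro PV_cong) auto
  then have e: "PV es [l] \<circ> FV f = FV f' \<circ> PV es [l]"
    using lw w f by (simp only: PV_append[OF es_normF] length_es PV_words_2)
  have "PV es [l] \<in> PL2" using lw by (intro normF_PL2 PV_normF es_normF) auto
  then show ?thesis unfolding e by (simp add: fun_eq_iff PL2_inv del: word_val.simps)
qed

lemma passes_append:
  assumes l: "fst l < n + 2" and f: "f \<in> words 2" "g \<in> words 2" and "passes l f" "passes l g"
  shows "passes l (f @ g)"
proof -
  obtain f' g' where f': "f' \<in> words 2" "ev [l] \<otimes>\<^bsub>P\<^esub> ev f = ev f' \<otimes>\<^bsub>P\<^esub> ev [l]"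
    and g': "g' \<in> words 2" "ev [l] \<otimes>\<^bsub>P\<^esub> ev g = ev g' \<otimes>\<^bsub>P\<^esub> ev [l]"
    using assms(4,5) unfolding passes_def by blast
  note cl = f(1)[THEN words_2_sub, THEN ev_closed] f(2)[THEN words_2_sub, THEN ev_closed]
    f'(1)[THEN words_2_sub, THEN ev_closed] g'(1)[THEN words_2_sub, THEN ev_closed]
  have lc: "ev [l] \<in> carrier P" using l by simp
  have "ev [l] \<otimes>\<^bsub>P\<^esub> ev (f @ g) = (ev [l] \<otimes>\<^bsub>P\<^esub> ev f) \<otimes>\<^bsub>P\<^esub> ev g"
    using f words_2_sub cl lc by (simp only: ev_append P.m_assoc)
  also have "\<dots> = ev f' \<otimes>\<^bsub>P\<^esub> (ev [l] \<otimes>\<^bsub>P\<^esub> ev g)" using f'(2) cl lc by (simp only: P.m_assoc)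
  also have "\<dots> = ev (f' @ g') \<otimes>\<^bsub>P\<^esub> ev [l]"
    using g'(2) f'(1) g'(1) words_2_sub cl lc by (simp only: ev_append P.m_assoc)
  finally show ?thesis unfolding passes_def using f'(1) g'(1) by (metis words_append)
qed

lemma passes_winv:
  assumes l: "fst l < n + 2" and f: "f \<in> words 2" and "passes l f"
  shows "passes l (winv f)"
proof -
  obtain f' where f': "f' \<in> words 2" "ev [l] \<otimes>\<^bsub>P\<^esub> ev f = ev f' \<otimes>\<^bsub>P\<^esub> ev [l]"
    using assms(3) unfolding passes_def by blast
  have cl: "ev f \<in> carrier P" "ev f' \<in> carrier P" "ev [l] \<in> carrier P" using f f'(1) l words_2_sub by auto
  have "inv\<^bsub>P\<^esub> ev f' \<otimes>\<^bsub>P\<^esub> (ev [l] \<otimes>\<^bsub>P\<^esub> ev f) \<otimes>\<^bsub>P\<^esub> inv\<^bsub>P\<^esub> ev f = inv\<^bsub>P\<^esub> ev f' \<otimes>\<^bsub>P\<^esub> (ev f' \<otimes>\<^bsub>P\<^esub> ev [l]) \<otimes>\<^bsub>P\<^esub> inv\<^bsub>P\<^esub> ev f"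
    using f'(2) by simp
  then have "inv\<^bsub>P\<^esub> ev f' \<otimes>\<^bsub>P\<^esub> ev [l] = ev [l] \<otimes>\<^bsub>P\<^esub> inv\<^bsub>P\<^esub> ev f"
    using cl by (simp add: P.m_assoc P.inv_mult_cancel)
  then have "ev [l] \<otimes>\<^bsub>P\<^esub> ev (winv f) = ev (winv f') \<otimes>\<^bsub>P\<^esub> ev [l]"
    using f f'(1) words_2_sub by (simp add: ev_winv)
  then show ?thesis unfolding passes_def using f'(1) by (metis winv_words)
qed

lemma passes_all:
  assumes l: "fst l < n + 2" and gens: "passes l (gen 0)" "passes l (gen 1)" and f: "f \<in> words 2"
  shows "passes l f"
  using f
proof (induction f)
  case Nil
  have "ev [l] \<in> carrier P" using l by simp
  then have "ev [l] \<otimes>\<^bsub>P\<^esub> ev [] = ev [] \<otimes>\<^bsub>P\<^esub> ev [l]" by simp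
  then show ?case unfolding passes_def using words_Nil by blast
next
  case (Cons x f)
  have x: "x = (0, True) \<or> x = (0, False) \<or> x = (1, True) \<or> x = (1, False)"
    using Cons.prems by (cases x; cases "snd x") auto
  have "winv (gen 0) = [(0, False)]" "winv (gen 1) = [(1, False)]" by (simp_all add: winv_def gen_def)
  then have "passes l [x]"
    using x gens passes_winv[OF l _ gens(1)] passes_winv[OF l _ gens(2)] by (auto simp: gen_def)
  then have "passes l ([x] @ f)" using Cons l by (intro passes_append) auto
  then show ?case by simp
qed

text \<open>The relators are instances of this for the two generators, and the words that the letter passes
  are closed under products and inverses.\<close>

lemma passes_inverse_stable_letter:
  assumes "j < n" "f \<in> words 2" shows "passes (j + 2, False) f"
proof (rule passes_all[OF _ _ _ assms(2)])
  show "fst (j + 2, False) < n + 2" using assms(1) by simp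
  have t: "gen (j + 2) \<in> words (n + 2)" "winv (gen (j + 2)) = [(j + 2, False)]"
    using assms(1) by (simp_all add: winv_def gen_def)
  have rel: "passes (j + 2, False) (gen i)"
    if i: "i < 2" and w: "w \<in> words 2" and r: "winv (gen (j + 2)) @ gen i @ gen (j + 2) @ winv w \<in> R" for i w
  proof -
    have ww: "gen i \<in> words (n + 2)" "w \<in> words (n + 2)" using i w words_2_sub by auto
    have cl: "ev (gen i) \<in> carrier P" "ev w \<in> carrier P" "ev (gen (j + 2)) \<in> carrier P" using ww t(1) by simp_all
    let ?s = "inv\<^bsub>P\<^esub> ev (gen (j + 2))"
    have "?s \<otimes>\<^bsub>P\<^esub> (ev (gen i) \<otimes>\<^bsub>P\<^esub> (ev (gen (j + 2)) \<otimes>\<^bsub>P\<^esub> inv\<^bsub>P\<^esub> ev w)) = \<one>\<^bsub>P\<^esub>"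
      using ev_relator[OF r] ww t(1) by (simp only: ev_append ev_winv words_append winv_words)
    then have "?s \<otimes>\<^bsub>P\<^esub> (ev (gen i) \<otimes>\<^bsub>P\<^esub> (ev (gen (j + 2)) \<otimes>\<^bsub>P\<^esub> inv\<^bsub>P\<^esub> ev w)) \<otimes>\<^bsub>P\<^esub> (ev w \<otimes>\<^bsub>P\<^esub> ?s) = ev w \<otimes>\<^bsub>P\<^esub> ?s"
      using cl by simp
    then have "?s \<otimes>\<^bsub>P\<^esub> ev (gen i) = ev w \<otimes>\<^bsub>P\<^esub> ?s" using cl by (simp add: P.m_assoc P.inv_mult_cancel)
    then show ?thesis unfolding passes_def using w t by (auto simp flip: ev_winv)
  qed
  have "winv (gen (j + 2)) @ gen 0 @ gen (j + 2) @ winv (wa ! j) \<in> R"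
    "winv (gen (j + 2)) @ gen 1 @ gen (j + 2) @ winv (wb ! j) \<in> R"
    unfolding R_def extension_relators_def using assms(1) by blast+
  moreover have "(0::nat) < 2" "(1::nat) < 2" by simp_all
  ultimately show "passes (j + 2, False) (gen 0)" "passes (j + 2, False) (gen 1)"
    using rel[of 0 "wa ! j"] rel[of 1 "wb ! j"] wa[OF assms(1)] wb[OF assms(1)] by blast+
qed

text \<open>Once a letter passes a word, the resulting word is determined by its homeomorphism and may be
  replaced by the one from the table.\<close>

lemma ev_subst_word:
  assumes S: "conj_table es S" and l: "fst l < n + 2" and f: "f \<in> words 2"
  shows "ev [l] \<otimes>\<^bsub>P\<^esub> ev f = ev (subst_word S l f) \<otimes>\<^bsub>P\<^esub> ev [l]"
proof -
  have l': "fst l < length es" using l by simp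
  have sub: "subst_word S l g \<in> words 2 \<and> FV (subst_word S l g) = PV es [l] \<circ> FV g \<circ> finv (PV es [l])"
    if "g \<in> words 2" for g
    by (rule subst_word[OF S _ l' that]) (rule es_normF)
  have lw: "[l] \<in> words (n + 2)" "[linv l] \<in> words (n + 2)" using l by simp_all
  have finish: "ev [l] \<otimes>\<^bsub>P\<^esub> ev f = ev (subst_word S l f) \<otimes>\<^bsub>P\<^esub> ev [l]"
    if "f' \<in> words 2" "ev [l] \<otimes>\<^bsub>P\<^esub> ev f = ev f' \<otimes>\<^bsub>P\<^esub> ev [l]" for f'
    using that ev_cong_F[of f' "subst_word S l f"] passes_value[OF l f that] sub[OF f] by simp
  show ?thesis
  proof (cases "fst l < 2")
    case True
    let ?f = "[l] @ f @ [linv l]"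
    have "?f \<in> words 2" using True f by simp
    moreover have "winv [l] = [linv l]" by (simp add: winv_Cons)
    then have "ev [linv l] = inv\<^bsub>P\<^esub> ev [l]" using ev_winv[OF lw(1)] by simp
    then have "ev [l] \<otimes>\<^bsub>P\<^esub> ev f = ev ?f \<otimes>\<^bsub>P\<^esub> ev [l]"
      using lw f words_2_sub by (simp only: ev_append words_append) (simp add: P.m_assoc)
    ultimately show ?thesis by (rule finish)
  next
    case False
    then obtain j where j: "fst l = j + 2" "j < n" using l by (metis add.commute add_less_cancel_right le_Suc_ex not_less)
    show ?thesis
    proof (cases "snd l")
      case False
      then have "l = (j + 2, False)" using j by (simp add: prod_eq_iff)
      then have "passes l f" using passes_inverse_stable_letter[OF j(2) f] by simp
      then show ?thesis unfolding passes_def using finish by blast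
    next
      case True
      \<comment> \<open>The inverse letter can be moved past the conjugated word, and there it undoes the
        conjugation.\<close>
      define s where "s = (j + 2, False)"
      have ls: "l = (j + 2, True)" "linv l = s" using True j by (simp_all add: prod_eq_iff s_def)
      have s: "fst s < n + 2" "[s] \<in> words (n + 2)" using j by (simp_all add: s_def)
      define g where "g = subst_word S l f"
      have g: "g \<in> words 2" "FV g = PV es [l] \<circ> FV f \<circ> finv (PV es [l])" using sub[OF f] by (simp_all add: g_def)
      obtain g' where g': "g' \<in> words 2" "ev [s] \<otimes>\<^bsub>P\<^esub> ev g = ev g' \<otimes>\<^bsub>P\<^esub> ev [s]"
        using passes_inverse_stable_letter[OF j(2) g(1)] unfolding passes_def s_def by blast
      have e: "PV es [l] \<in> PL2" using l' by (intro normF_PL2 PV_normF es_normF) auto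
      have winv_l: "winv [l] = [s]" using ls by (simp add: winv_Cons)
      have "PV es (winv [l]) = finv (PV es [l])" using l' by (intro PV_winv es_normF) auto
      then have "PV es [s] = finv (PV es [l])" by (simp only: winv_l)
      then have "FV g' = finv (PV es [l]) \<circ> FV g \<circ> finv (finv (PV es [l]))"
        using passes_value[OF s(1) g(1) g'] by (simp only:)
      also have "\<dots> = FV f"
        unfolding g(2) finv_finv[OF e] by (simp add: fun_eq_iff PL2_inv[OF e] del: word_val.simps)
      finally have "ev g' = ev f" using g'(1) f by (intro ev_cong_F)
      moreover have "ev [s] = inv\<^bsub>P\<^esub> ev [l]" using ev_winv[OF lw(1)] by (simp only: winv_l)
      ultimately have "inv\<^bsub>P\<^esub> ev [l] \<otimes>\<^bsub>P\<^esub> ev g = ev f \<otimes>\<^bsub>P\<^esub> inv\<^bsub>P\<^esub> ev [l]" using g'(2) by simp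
      then have "ev [l] \<otimes>\<^bsub>P\<^esub> (inv\<^bsub>P\<^esub> ev [l] \<otimes>\<^bsub>P\<^esub> ev g) \<otimes>\<^bsub>P\<^esub> ev [l] = ev [l] \<otimes>\<^bsub>P\<^esub> (ev f \<otimes>\<^bsub>P\<^esub> inv\<^bsub>P\<^esub> ev [l]) \<otimes>\<^bsub>P\<^esub> ev [l]"
        by simp
      then show ?thesis using lw(1) words_2_sub[OF f] words_2_sub[OF g(1)]
        by (simp add: P.m_assoc P.inv_mult_cancel flip: g_def)
    qed
  qed
qed

lemma ev_conj:
  assumes u: "u \<in> words (n + 2)" and f: "f \<in> words 2"
  obtains f' where "f' \<in> words 2" "ev u \<otimes>\<^bsub>P\<^esub> ev f = ev f' \<otimes>\<^bsub>P\<^esub> ev u"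
proof -
  obtain S where S: "conj_table es S" using conj_table_exists[OF es_normF] by blast
  have "\<exists>f' \<in> words 2. ev u \<otimes>\<^bsub>P\<^esub> ev f = ev f' \<otimes>\<^bsub>P\<^esub> ev u" using u
  proof (induction u)
    case Nil
    then show ?case using f words_2_sub by (intro bexI[of _ f]) auto
  next
    case (Cons l u)
    then obtain f' where f': "f' \<in> words 2" "ev u \<otimes>\<^bsub>P\<^esub> ev f = ev f' \<otimes>\<^bsub>P\<^esub> ev u" by auto
    have l: "fst l < n + 2" "[l] \<in> words (n + 2)" "u \<in> words (n + 2)" using Cons.prems by auto
    have g: "subst_word S l f' \<in> words 2" using subst_word[OF S es_normF _ f'(1), of l] l by simp
    have cl: "ev [l] \<in> carrier P" "ev u \<in> carrier P" "ev f \<in> carrier P" "ev f' \<in> carrier P"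
      "ev (subst_word S l f') \<in> carrier P" using l f f'(1) g words_2_sub by auto
    have lu: "ev (l # u) = ev [l] \<otimes>\<^bsub>P\<^esub> ev u" using ev_append[OF l(2,3)] by simp
    have "ev (l # u) \<otimes>\<^bsub>P\<^esub> ev f = ev [l] \<otimes>\<^bsub>P\<^esub> (ev f' \<otimes>\<^bsub>P\<^esub> ev u)"
      unfolding lu using cl f'(2) by (simp only: P.m_assoc)
    also have "\<dots> = (ev [l] \<otimes>\<^bsub>P\<^esub> ev f') \<otimes>\<^bsub>P\<^esub> ev u" using cl by (simp only: P.m_assoc)
    also have "\<dots> = ev (subst_word S l f') \<otimes>\<^bsub>P\<^esub> ev (l # u)"
      unfolding lu ev_subst_word[OF S l(1) f'(1)] using cl by (simp only: P.m_assoc)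
    finally show ?case using g by blast
  qed
  then show ?thesis using that by blast
qed

lemma PV_conj:
  assumes u: "u \<in> words (n + 2)" and f: "f \<in> words 2" "f' \<in> words 2"
    and eq: "ev u \<otimes>\<^bsub>P\<^esub> ev f = ev f' \<otimes>\<^bsub>P\<^esub> ev u"
  shows "PV es u \<circ> FV f = FV f' \<circ> PV es u"
proof -
  have w: "f \<in> words (n + 2)" "f' \<in> words (n + 2)" using f words_2_sub by auto
  have "ev (u @ f) = ev (f' @ u)" using eq u w by (simp only: ev_append)
  then have "PV es (u @ f) = PV es (f' @ u)" using u w by (intro PV_cong) auto
  then show ?thesis using u w f by (simp only: PV_append[OF es_normF] length_es PV_words_2)
qed

text \<open>The words in \<open>\<alpha>, \<beta>\<close> form a normal subgroup by \<open>ev_conj\<close>. It is a copy of \<open>F\<close>: \<open>ev_cong_F\<close> makes the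
  embedding well defined, and the action on the line makes it injective.\<close>

lemma extension: "extension_of F_group P"
proof -
  define N where "N = ev ` words 2"
  have N_sub: "N \<subseteq> carrier P" using words_2_sub by (auto simp: N_def)
  have "subgroup N P"
  proof (rule P.subgroupI)
    show "N \<noteq> {}" using words_Nil[of 2] unfolding N_def by blast
    show "inv\<^bsub>P\<^esub> x \<in> N" if x: "x \<in> N" for x
    proof -
      obtain w where w: "w \<in> words 2" "x = ev w" using x by (auto simp: N_def)
      have "inv\<^bsub>P\<^esub> x = ev (winv w)" using ev_winv[OF words_2_sub[OF w(1)]] w(2) by simp
      then show ?thesis unfolding N_def using w(1) by simp
    qed
    show "x \<otimes>\<^bsub>P\<^esub> y \<in> N" if x: "x \<in> N" and y: "y \<in> N" for x y
    proof -
      obtain w where w: "w \<in> words 2" "x = ev w" using x by (auto simp: N_def)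
      obtain v where v: "v \<in> words 2" "y = ev v" using y by (auto simp: N_def)
      have "x \<otimes>\<^bsub>P\<^esub> y = ev (w @ v)" using ev_append[OF words_2_sub[OF w(1)] words_2_sub[OF v(1)]] w(2) v(2) by simp
      then show ?thesis unfolding N_def using w(1) v(1) by simp
    qed
  qed (rule N_sub)
  moreover have "x \<otimes>\<^bsub>P\<^esub> h \<otimes>\<^bsub>P\<^esub> inv\<^bsub>P\<^esub> x \<in> N" if x: "x \<in> carrier P" and h: "h \<in> N" for x h
  proof -
    obtain u where u: "u \<in> words (n + 2)" "x = ev u" using x carrier_P by blast
    obtain f where f: "f \<in> words 2" "h = ev f" using h by (auto simp: N_def)
    obtain f' where f': "f' \<in> words 2" "ev u \<otimes>\<^bsub>P\<^esub> ev f = ev f' \<otimes>\<^bsub>P\<^esub> ev u" by (rule ev_conj[OF u(1) f(1)])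
    have "x \<otimes>\<^bsub>P\<^esub> h \<otimes>\<^bsub>P\<^esub> inv\<^bsub>P\<^esub> x = ev f'"
      using u f f' words_2_sub[OF f'(1)] by (simp add: P.m_assoc)
    then show ?thesis using f'(1) by (simp add: N_def)
  qed
  ultimately have normal: "N \<lhd> P" using P.normal_inv_iff by blast
  interpret N: normal N P by fact
  define i where "i f = ev (SOME w. w \<in> words 2 \<and> FV w = f)" for f
  have i_FV: "i (FV w) = ev w" if "w \<in> words 2" for w
  proof -
    have "(SOME v. v \<in> words 2 \<and> FV v = FV w) \<in> words 2 \<and> FV (SOME v. v \<in> words 2 \<and> FV v = FV w) = FV w"
      by (rule someI[of _ w]) (simp add: that)
    then show ?thesis unfolding i_def using that by (intro ev_cong_F) auto
  qed
  have i_N: "i ` thompson_F = N"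
  proof -
    have "thompson_F = FV ` words 2" using F_generated FV_F by blast
    then have "i ` thompson_F = i ` FV ` words 2" by (rule arg_cong)
    also have "\<dots> = (\<lambda>w. i (FV w)) ` words 2" by (rule image_image)
    finally have "i ` thompson_F = (\<lambda>w. i (FV w)) ` words 2" .
    then show ?thesis unfolding N_def using i_FV by simp
  qed
  have F: "carrier F_group = thompson_F" "f \<otimes>\<^bsub>F_group\<^esub> g = f \<circ> g" for f g
    by (simp_all add: F_group_def)
  have "i \<in> hom F_group P"
  proof (rule homI)
    show "i f \<in> carrier P" if "f \<in> carrier F_group" for f using that i_N N_sub F by blast
    fix f g assume "f \<in> carrier F_group" "g \<in> carrier F_group"
    then obtain u v where u: "u \<in> words 2" "FV u = f" and v: "v \<in> words 2" "FV v = g"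
      using F_generated F by metis
    then have "i (FV (u @ v)) = ev u \<otimes>\<^bsub>P\<^esub> ev v" using words_2_sub by (simp add: i_FV ev_append)
    then show "i (f \<otimes>\<^bsub>F_group\<^esub> g) = i f \<otimes>\<^bsub>P\<^esub> i g"
      using u v i_FV[OF u(1)] i_FV[OF v(1)] FV_append[OF u(1) v(1)] F by (simp del: o_apply)
  qed
  moreover have "inj_on i thompson_F"
  proof (rule inj_onI)
    fix f g assume fg: "f \<in> thompson_F" "g \<in> thompson_F" "i f = i g"
    obtain u where u: "u \<in> words 2" "FV u = f" using F_generated[OF fg(1)] by auto
    obtain v where v: "v \<in> words 2" "FV v = g" using F_generated[OF fg(2)] by auto
    have "ev u = ev v" using fg(3) i_FV[OF u(1)] i_FV[OF v(1)] u v by simp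
    then have "PV es u = PV es v" by (rule PV_cong[OF words_2_sub[OF u(1)] words_2_sub[OF v(1)]])
    then show "f = g" using u v by (simp add: PV_words_2)
  qed
  ultimately have mon: "i \<in> mon F_group P" by (simp add: mon_def F)
  define p where "p x = N #>\<^bsub>P\<^esub> x" for x
  have epi: "p \<in> epi P (P Mod N)"
    using N.r_coset_hom_Mod unfolding epi_def p_def by (auto simp: FactGroup_def RCOSETS_def)
  have ker: "kernel P (P Mod N) p = i ` carrier F_group"
  proof -
    have "N #>\<^bsub>P\<^esub> x = N \<longleftrightarrow> x \<in> N" if "x \<in> carrier P" for x
      using P.coset_join1[OF _ that N.subgroup_axioms] P.coset_join2[OF that N.subgroup_axioms] by blast
    then show ?thesis unfolding kernel_def p_def i_N F using N_sub by (auto simp: FactGroup_def)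
  qed
  show ?thesis
    unfolding extension_of_def using group_F P.is_group N.factorgroup_is_group mon epi ker by blast
qed

end

section \<open>The word problem\<close>

subsection \<open>The word problem of \<open>F\<close>\<close>

lemma finv_alpha: "finv alpha = (\<lambda>t. t + 1)"
  by (rule Hilbert_Choice.inv_equality) (auto simp: alpha_def)

lemma FV_letter:
  "FV [(0, True)] = alpha" "FV [(0, False)] = (\<lambda>t. t + 1)"
  "FV [(1, True)] = beta" "FV [(1, False)] = (\<lambda>t. if t \<le> 0 then t else if t \<le> 1 then 2 * t else t + 1)"
  by (simp_all add: alpha_beta_PL2 finv_alpha finv_beta)

lemma letter_cases:
  fixes l :: "nat \<times> bool"
  assumes "fst l < 2"
  obtains "l = (0, True)" | "l = (0, False)" | "l = (1, True)" | "l = (1, False)"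
proof -
  have "fst l = 0 \<or> fst l = 1" using assms by linarith
  then show ?thesis using that by (cases "snd l") (auto simp: prod_eq_iff)
qed

lemma FV_Cons: "fst l < 2 \<Longrightarrow> w \<in> words 2 \<Longrightarrow> FV (l # w) x = FV [l] (FV w x)"
  using FV_append[of "[l]" w] by (simp del: word_val.simps)

text \<open>A real number \<open>(a - b) / U\<close> is stored as \<open>(a, b, U)\<close>. Halving doubles the denominator \<open>U\<close>, so
  all steps are exact.\<close>

definition apply_letter :: "nat \<times> bool \<Rightarrow> nat \<times> nat \<times> nat \<Rightarrow> nat \<times> nat \<times> nat" where
  "apply_letter l p = (let a = fst p; b = fst (snd p); U = snd (snd p) in
     if fst l = 0 then (if snd l then (a, b + U, U) else (a + U, b, U))
     else if a \<le> b then p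
     else if snd l then (if a \<le> b + 2 * U then (a, b, 2 * U) else (a, b + U, U))
     else (if a \<le> b + U then (2 * a, 2 * b, U) else (a + U, b, U)))"

definition triple_val :: "nat \<times> nat \<times> nat \<Rightarrow> real" where
  "triple_val p = (real (fst p) - real (fst (snd p))) / real (snd (snd p))"

lemma apply_letter:
  assumes "fst l < 2" "snd (snd p) > 0"
  shows "snd (snd (apply_letter l p)) > 0 \<and> triple_val (apply_letter l p) = FV [l] (triple_val p)"
proof -
  obtain a b U where p: "p = (a, b, U)" by (cases p) auto
  have U: "real U > 0" using assms p by simp
  have le: "triple_val p \<le> 0 \<longleftrightarrow> a \<le> b" "triple_val p \<le> 1 \<longleftrightarrow> a \<le> b + U" "triple_val p \<le> 2 \<longleftrightarrow> a \<le> b + 2 * U"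
  proof -
    have "triple_val p \<le> 0 \<longleftrightarrow> real a \<le> real b" using U by (simp add: p triple_val_def divide_le_0_iff)
    then show "triple_val p \<le> 0 \<longleftrightarrow> a \<le> b" by simp
    have "triple_val p \<le> 1 \<longleftrightarrow> real a \<le> real (b + U)" using U by (auto simp: p triple_val_def divide_le_eq)
    then show "triple_val p \<le> 1 \<longleftrightarrow> a \<le> b + U" by (simp only: of_nat_le_iff)
    have "triple_val p \<le> 2 \<longleftrightarrow> real a \<le> real (b + 2 * U)" using U by (auto simp: p triple_val_def divide_le_eq)
    then show "triple_val p \<le> 2 \<longleftrightarrow> a \<le> b + 2 * U" by (simp only: of_nat_le_iff)
  qed
  have v: "triple_val p = (real a - real b) / real U" by (simp add: p triple_val_def)
  show ?thesis using assms(1)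
  proof (cases rule: letter_cases)
    case 1
    show ?thesis unfolding 1 FV_letter alpha_def v using U
      by (simp add: p apply_letter_def triple_val_def field_simps)
  next
    case 2
    show ?thesis unfolding 2 FV_letter v using U
      by (simp add: p apply_letter_def triple_val_def field_simps)
  next
    case 3
    then show ?thesis unfolding 3 FV_letter beta_def le v using U
      by (auto simp: p apply_letter_def triple_val_def field_simps)
  next
    case 4
    then show ?thesis unfolding 4 FV_letter le v using U
      by (auto simp: p apply_letter_def triple_val_def field_simps)
  qed
qed

lemma foldr_apply_letter:
  assumes "w \<in> words 2" "snd (snd p) > 0"
  shows "snd (snd (foldr apply_letter w p)) > 0 \<and> triple_val (foldr apply_letter w p) = FV w (triple_val p)"
  using assms(1)
proof (induction w)
  case Nil
  then show ?case using assms(2) by simp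
next
  case (Cons l w)
  then have l: "fst l < 2" "w \<in> words 2" by auto
  show ?case using Cons.IH[OF l(2)] apply_letter[OF l(1), of "foldr apply_letter w p"] FV_Cons[OF l]
    by (simp del: word_val.simps)
qed

text \<open>A word of length \<open>L\<close> is a translation outside \<open>[- L, L + 2]\<close> and affine on the cells of the
  mesh of size \<open>2 ^ (- L)\<close>, so it represents the identity iff it fixes the mesh points of that
  interval.\<close>

definition F_test :: "word \<Rightarrow> bool" where
  "F_test w = (\<forall>a < (length w + 2) * 2 ^ length w + 1. \<forall>b < (length w + 2) * 2 ^ length w + 1.
     fst (foldr apply_letter w (a, b, 2 ^ length w)) * 2 ^ length w + b * snd (snd (foldr apply_letter w (a, b, 2 ^ length w)))
     = a * snd (snd (foldr apply_letter w (a, b, 2 ^ length w))) + fst (snd (foldr apply_letter w (a, b, 2 ^ length w))) * 2 ^ length w)"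

lemma computable_apply_letter [computable_intros]:
  "computable l \<Longrightarrow> computable p \<Longrightarrow> computable (\<lambda>x. apply_letter (l x) (p x))"
  unfolding apply_letter_def Let_def by (intro computable_intros)

lemma computable_F_test: "computable F_test"
proof -
  have "computable (\<lambda>p::(word \<times> nat) \<times> nat. foldr apply_letter (fst (fst p)) (snd (fst p), snd p, 2 ^ length (fst (fst p))))"
    by (intro computable_foldr computable_apply_letter computable_Pair computable_power2 computable_length
        computable_fst computable_snd computable_id)
  note r = this
  show ?thesis unfolding F_test_def
    by (intro computable_all_less computable_eq computable_nat_arith(1,3) computable_power2 computable_length
        computable_fst[OF r] computable_snd[OF r] computable_fst computable_snd computable_id computable_const r)
qed

lemma F_test_iff_fixes:
  assumes w: "w \<in> words 2"
  shows "F_test w \<longleftrightarrow> (\<forall>a < (length w + 2) * 2 ^ length w + 1. \<forall>b < (length w + 2) * 2 ^ length w + 1.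
    FV w ((real a - real b) / 2 ^ length w) = (real a - real b) / 2 ^ length w)"
proof -
  have "fst r * 2 ^ length w + b * snd (snd r) = a * snd (snd r) + fst (snd r) * 2 ^ length w \<longleftrightarrow>
      FV w ((real a - real b) / 2 ^ length w) = (real a - real b) / 2 ^ length w"
    if r: "r = foldr apply_letter w (a, b, 2 ^ length w)" for a b r
  proof -
    have *: "snd (snd r) > 0" "triple_val r = FV w ((real a - real b) / 2 ^ length w)"
      using foldr_apply_letter[OF w, of "(a, b, 2 ^ length w)"] by (simp_all add: r triple_val_def)
    have "FV w ((real a - real b) / 2 ^ length w) = (real a - real b) / 2 ^ length w \<longleftrightarrow>
        (real (fst r) - real (fst (snd r))) * 2 ^ length w = (real a - real b) * real (snd (snd r))"
      unfolding *(2)[symmetric] using *(1) by (simp add: triple_val_def frac_eq_eq)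
    also have "\<dots> \<longleftrightarrow> real (fst r * 2 ^ length w + b * snd (snd r)) = real (a * snd (snd r) + fst (snd r) * 2 ^ length w)"
      by (auto simp: algebra_simps)
    finally show ?thesis by (simp only: of_nat_eq_iff)
  qed
  then show ?thesis unfolding F_test_def by simp
qed

lemma length_winv [simp]: "length (winv w) = length w"
  by (simp add: winv_def)

lemma FV_letter_integral:
  assumes "fst l < 2" "x * 2 ^ m \<in> \<int>"
  shows "FV [l] x * 2 ^ Suc m \<in> \<int>"
proof -
  have e: "(x - 1) * 2 ^ Suc m = 2 * (x * 2 ^ m) - 2 ^ Suc m" "(x + 1) * 2 ^ Suc m = 2 * (x * 2 ^ m) + 2 ^ Suc m"
    "x / 2 * 2 ^ Suc m = x * 2 ^ m" "x * 2 ^ Suc m = 2 * (x * 2 ^ m)" "2 * x * 2 ^ Suc m = 4 * (x * 2 ^ m)"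
    by (simp_all add: algebra_simps)
  have i: "(x - 1) * 2 ^ Suc m \<in> \<int>" "(x + 1) * 2 ^ Suc m \<in> \<int>" "x / 2 * 2 ^ Suc m \<in> \<int>"
    "x * 2 ^ Suc m \<in> \<int>" "2 * x * 2 ^ Suc m \<in> \<int>"
    unfolding e by (intro Ints_add Ints_diff Ints_mult Ints_power Ints_numeral assms(2))+
  show ?thesis using assms(1)
    by (cases rule: letter_cases) (use i in \<open>auto simp only: FV_letter alpha_def beta_def split: if_split\<close>)
qed

lemma FV_integral:
  assumes "x * 2 ^ m \<in> \<int>" "w \<in> words 2"
  shows "FV w x * 2 ^ (m + length w) \<in> \<int>"
  using assms(2)
proof (induction w)
  case Nil
  then show ?case using assms(1) by simp
next
  case (Cons l w)
  then have l: "fst l < 2" "w \<in> words 2" by auto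
  show ?case using FV_letter_integral[OF l(1) Cons.IH[OF l(2)]] FV_Cons[OF l]
    by (simp del: word_val.simps)
qed

lemma FV_letter_affine:
  assumes "fst l < 2" and nb: "\<And>p. p \<in> {0, 1, 2} \<Longrightarrow> \<not> (y < p \<and> p < z)"
  shows "\<exists>s t. \<forall>v. y \<le> v \<and> v \<le> z \<longrightarrow> FV [l] v = s * v + t"
proof -
  consider "z \<le> 0" | "0 \<le> y" "z \<le> 1" | "1 \<le> y" "z \<le> 2" | "2 \<le> y" | "z \<le> y"
    using nb[of 0] nb[of 1] nb[of 2] by fastforce
  then have yz: "z \<le> 0 \<or> (0 \<le> y \<and> z \<le> 1) \<or> (1 \<le> y \<and> z \<le> 2) \<or> 2 \<le> y \<or> z \<le> y" by cases auto
  have const: "\<exists>s t. \<forall>v. y \<le> v \<and> v \<le> z \<longrightarrow> FV [l] v = s * v + t" if "z \<le> y"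
  proof (rule exI[of _ 0], rule exI[of _ "FV [l] y"], intro allI impI)
    fix v assume "y \<le> v \<and> v \<le> z"
    then have "v = y" using that by linarith
    then show "FV [l] v = 0 * v + FV [l] y" by (simp del: word_val.simps)
  qed
  show ?thesis using assms(1)
  proof (cases rule: letter_cases)
    case 1
    then show ?thesis unfolding 1 FV_letter by (intro exI[of _ 1] exI[of _ "-1"]) (simp add: alpha_def)
  next
    case 2
    then show ?thesis unfolding 2 FV_letter by (intro exI[of _ 1] exI[of _ 1]) simp
  next
    case 3
    from yz consider "z \<le> 0" | "0 \<le> y \<and> z \<le> 2" | "2 \<le> y" | "z \<le> y" by fastforce
    then show ?thesis
    proof cases
      case 1
      then show ?thesis unfolding 3 FV_letter by (intro exI[of _ 1] exI[of _ 0]) (auto simp: beta_def)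
    next
      case 2
      then show ?thesis unfolding 3 FV_letter by (intro exI[of _ "1/2"] exI[of _ 0]) (auto simp: beta_def)
    next
      case b: 3
      then show ?thesis unfolding 3 FV_letter by (intro exI[of _ 1] exI[of _ "-1"]) (auto simp: beta_def)
    qed (rule const)
  next
    case 4
    from yz consider "z \<le> 0" | "0 \<le> y \<and> z \<le> 1" | "1 \<le> y" | "z \<le> y" by fastforce
    then show ?thesis
    proof cases
      case 1
      then show ?thesis unfolding 4 FV_letter by (intro exI[of _ 1] exI[of _ 0]) auto
    next
      case 2
      then show ?thesis unfolding 4 FV_letter by (intro exI[of _ 2] exI[of _ 0]) auto
    next
      case 3
      then show ?thesis unfolding 4 FV_letter by (intro exI[of _ 1] exI[of _ 1]) auto
    qed (rule const)
  qed
qed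

text \<open>Where \<open>w\<close> is affine on a mesh, the next letter can break only at preimages of 0, 1 and 2, which are
  points of the mesh: each letter adds at most one binary digit.\<close>

lemma FV_mesh_affine:
  assumes "w \<in> words 2"
  shows "\<exists>s t. \<forall>x. real_of_int c / 2 ^ length w \<le> x \<and> x \<le> (real_of_int c + 1) / 2 ^ length w \<longrightarrow> FV w x = s * x + t"
  using assms
proof (induction w arbitrary: c)
  case Nil
  then show ?case by (intro exI[of _ 1] exI[of _ 0]) simp
next
  case (Cons l w)
  then have l: "fst l < 2" "w \<in> words 2" by auto
  define y where "y = real_of_int c / 2 ^ Suc (length w)"
  define z where "z = (real_of_int c + 1) / 2 ^ Suc (length w)"
  have yz: "y < z" by (simp add: y_def z_def divide_strict_right_mono)
  have PL: "FV w \<in> PL2" "strict_mono (FV w)" using FV_F[OF l(2)] by (auto simp: thompson_F_def)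
  have mono: "FV w u < FV w v \<longleftrightarrow> u < v" "FV w u \<le> FV w v \<longleftrightarrow> u \<le> v" for u v
    using PL(2) by (simp_all add: strict_mono_less strict_mono_less_eq)
  obtain s t where st: "\<And>x. real_of_int (c div 2) / 2 ^ length w \<le> x \<Longrightarrow> x \<le> (real_of_int (c div 2) + 1) / 2 ^ length w \<Longrightarrow> FV w x = s * x + t"
    using Cons.IH[OF l(2), of "c div 2"] by blast
  have "2 * (c div 2) \<le> c" "c + 1 \<le> 2 * (c div 2 + 1)" by presburger+
  then have "real_of_int (2 * (c div 2)) \<le> real_of_int c" "real_of_int (c + 1) \<le> real_of_int (2 * (c div 2 + 1))"
    by (simp_all only: of_int_le_iff)
  then have half: "real_of_int (c div 2) \<le> real_of_int c / 2" "(real_of_int c + 1) / 2 \<le> real_of_int (c div 2) + 1"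
    by simp_all
  have in_cell: "real_of_int (c div 2) / 2 ^ length w \<le> y" "z \<le> (real_of_int (c div 2) + 1) / 2 ^ length w"
    using divide_right_mono[OF half(1), of "2 ^ length w"] divide_right_mono[OF half(2), of "2 ^ length w"]
    by (simp_all add: y_def z_def)
  have "\<not> (FV w y < p \<and> p < FV w z)" if "p \<in> {0, 1, 2}" for p
  proof
    assume p: "FV w y < p \<and> p < FV w z"
    \<comment> \<open>The preimage of the integer \<open>p\<close> is a point of the mesh.\<close>
    define x where "x = finv (FV w) p"
    have x: "FV w x = p" by (simp add: x_def PL2_inv[OF PL(1)])
    then have "y < x" "x < z" using p mono(1)[of y x] mono(1)[of x z] by auto
    have "p * 2 ^ 0 \<in> \<int>" using that by auto
    from FV_integral[OF this, of "winv w"] have "x * 2 ^ length w \<in> \<int>"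
      using l(2) by (simp add: FV_winv x_def)
    then obtain j where j: "x * 2 ^ length w = real_of_int j" by (auto elim: Ints_cases)
    have "real_of_int c < 2 * (x * 2 ^ length w)" "2 * (x * 2 ^ length w) < real_of_int c + 1"
      using \<open>y < x\<close> \<open>x < z\<close> by (simp_all add: y_def z_def field_simps)
    then have "real_of_int c < real_of_int (2 * j)" "real_of_int (2 * j) < real_of_int (c + 1)" by (simp_all add: j)
    then have "c < 2 * j" "2 * j < c + 1" by (simp_all only: of_int_less_iff)
    then show False by linarith
  qed
  from FV_letter_affine[OF l(1) this] obtain s' t' where
    st': "\<And>v. FV w y \<le> v \<Longrightarrow> v \<le> FV w z \<Longrightarrow> FV [l] v = s' * v + t'" by blast
  have "FV (l # w) x = (s' * s) * x + (s' * t + t')" if "y \<le> x" "x \<le> z" for x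
  proof -
    have "FV (l # w) x = s' * FV w x + t'"
      unfolding FV_Cons[OF l] using that by (intro st') (simp_all add: mono)
    also have "FV w x = s * x + t" using that in_cell by (intro st) auto
    finally show ?thesis by (simp add: algebra_simps)
  qed
  then show ?case unfolding y_def z_def list.size(4) add_Suc_right add_0_right by blast
qed

lemma FV_far:
  assumes "w \<in> words 2"
  shows "\<exists>j k. \<bar>j\<bar> \<le> real (length w) \<and> \<bar>k\<bar> \<le> real (length w) \<and> (\<forall>x. x \<le> - real (length w) \<longrightarrow> FV w x = x + j) \<and>
    (\<forall>x. real (length w) + 2 \<le> x \<longrightarrow> FV w x = x + k)"
  using assms
proof (induction w)
  case Nil
  then show ?case by (intro exI[of _ 0]) simp
next
  case (Cons l w)
  then have l: "fst l < 2" "w \<in> words 2" by auto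
  obtain j k where jk: "\<bar>j\<bar> \<le> real (length w)" "\<bar>k\<bar> \<le> real (length w)"
    "\<And>x. x \<le> - real (length w) \<Longrightarrow> FV w x = x + j" "\<And>x. real (length w) + 2 \<le> x \<Longrightarrow> FV w x = x + k"
    using Cons.IH[OF l(2)] by blast
  have "\<exists>e d. \<bar>e\<bar> \<le> 1 \<and> \<bar>d\<bar> \<le> 1 \<and> (\<forall>v. v \<le> 0 \<longrightarrow> FV [l] v = v + e) \<and> (\<forall>v. 2 \<le> v \<longrightarrow> FV [l] v = v + d)"
    using l(1)
  proof (cases rule: letter_cases)
    case 1
    then show ?thesis unfolding 1 FV_letter by (intro exI[of _ "-1"]) (auto simp: alpha_def)
  next
    case 2
    then show ?thesis unfolding 2 FV_letter by (intro exI[of _ 1]) auto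
  next
    case 3
    then show ?thesis unfolding 3 FV_letter by (intro exI[of _ 0] exI[of _ "-1"]) (auto simp: beta_def)
  next
    case 4
    then show ?thesis unfolding 4 FV_letter by (intro exI[of _ 0] exI[of _ 1]) auto
  qed
  then obtain e d where ed: "\<bar>e\<bar> \<le> 1" "\<bar>d\<bar> \<le> 1" "\<And>v. v \<le> 0 \<Longrightarrow> FV [l] v = v + e" "\<And>v. 2 \<le> v \<Longrightarrow> FV [l] v = v + d"
    by blast
  have "FV (l # w) x = x + (j + e)" if "x \<le> - real (length (l # w))" for x
  proof -
    have "FV w x = x + j" using that by (intro jk) simp
    moreover have "x + j \<le> 0" using that jk(1) by simp
    ultimately show ?thesis unfolding FV_Cons[OF l] using ed(3)[of "x + j"] by simp
  qed
  moreover have "FV (l # w) x = x + (k + d)" if "real (length (l # w)) + 2 \<le> x" for x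
  proof -
    have "FV w x = x + k" using that by (intro jk) simp
    moreover have "2 \<le> x + k" using that jk(2) by simp
    ultimately show ?thesis unfolding FV_Cons[OF l] using ed(4)[of "x + k"] by simp
  qed
  moreover have "\<bar>j + e\<bar> \<le> real (length (l # w))" "\<bar>k + d\<bar> \<le> real (length (l # w))" using jk ed by simp_all
  ultimately show ?case by blast
qed

lemma F_test_iff:
  assumes w: "w \<in> words 2"
  shows "F_test w \<longleftrightarrow> FV w = id"
proof
  assume "FV w = id"
  then show "F_test w" unfolding F_test_iff_fixes[OF w] by simp
next
  assume test: "F_test w"
  define L where "L = length w"
  define q :: real where "q = 2 ^ L"
  have q: "q > 0" by (simp add: q_def)
  have fixed: "FV w (real_of_int c / q) = real_of_int c / q" if "\<bar>c\<bar> \<le> int ((L + 2) * 2 ^ L)" for c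
  proof -
    have "nat c < (L + 2) * 2 ^ L + 1" "nat (- c) < (L + 2) * 2 ^ L + 1" using that by linarith+
    then have "FV w ((real (nat c) - real (nat (- c))) / 2 ^ L) = (real (nat c) - real (nat (- c))) / 2 ^ L"
      using test unfolding F_test_iff_fixes[OF w] L_def by blast
    moreover have "real (nat c) - real (nat (- c)) = real_of_int c" by linarith
    ultimately show ?thesis by (simp add: q_def)
  qed
  obtain j k where jk: "\<And>x. x \<le> - real L \<Longrightarrow> FV w x = x + j" "\<And>x. real L + 2 \<le> x \<Longrightarrow> FV w x = x + k"
    using FV_far[OF w] unfolding L_def by blast
  have Lq: "real_of_int (int ((L + 2) * 2 ^ L)) = (real L + 2) * q" "real_of_int (- int (L * 2 ^ L)) = - real L * q"
    by (simp_all add: q_def distrib_right)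
  have ends: "real_of_int (int ((L + 2) * 2 ^ L)) / q = real L + 2" "real_of_int (- int (L * 2 ^ L)) / q = - real L"
    unfolding Lq using q by simp_all
  have "\<bar>int ((L + 2) * 2 ^ L)\<bar> \<le> int ((L + 2) * 2 ^ L)" by simp
  from fixed[OF this] have "k = 0" using jk(2)[of "real L + 2"] unfolding ends by simp
  have "\<bar>- int (L * 2 ^ L)\<bar> \<le> int ((L + 2) * 2 ^ L)" by simp
  from fixed[OF this] have "j = 0" using jk(1)[of "- real L"] unfolding ends by simp
  have "FV w x = x" for x
  proof -
    consider "x \<le> - real L" | "real L + 2 \<le> x" | "- real L < x" "x < real L + 2" by linarith
    then show ?thesis
    proof cases
      case 3
      define c where "c = \<lfloor>x * q\<rfloor>"
      have c: "real_of_int c \<le> x * q" "x * q < real_of_int c + 1" by (simp_all add: c_def)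
      have "- real L * q < x * q" "x * q < (real L + 2) * q"
        using mult_strict_right_mono[OF 3(1) q] mult_strict_right_mono[OF 3(2) q] by simp_all
      then have "real_of_int (- int (L * 2 ^ L)) < real_of_int (c + 1)" "real_of_int c < real_of_int (int ((L + 2) * 2 ^ L))"
        unfolding Lq using c by simp_all
      then have "- int (L * 2 ^ L) \<le> c" "c < int ((L + 2) * 2 ^ L)" by (simp_all only: of_int_less_iff)
      then have range: "- int (L * 2 ^ L) \<le> c" "c + 1 \<le> int ((L + 2) * 2 ^ L)" by simp_all
      have "int (L * 2 ^ L) + 0 \<le> int ((L + 2) * 2 ^ L)" by simp
      then have "\<bar>c\<bar> \<le> int ((L + 2) * 2 ^ L)" "\<bar>c + 1\<bar> \<le> int ((L + 2) * 2 ^ L)" using range by linarith+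
      from this[THEN fixed] have fx: "FV w (real_of_int c / q) = real_of_int c / q"
        "FV w ((real_of_int c + 1) / q) = (real_of_int c + 1) / q" by simp_all
      obtain s t where st: "\<And>x. real_of_int c / q \<le> x \<Longrightarrow> x \<le> (real_of_int c + 1) / q \<Longrightarrow> FV w x = s * x + t"
        using FV_mesh_affine[OF w, of c] unfolding q_def L_def by blast
      have lt: "real_of_int c / q < (real_of_int c + 1) / q" using q by (simp add: divide_strict_right_mono)
      have "s = 1 \<and> t = 0" if "y < z" "y = s * y + t" "z = s * z + t" for y z :: real
      proof -
        have "(s - 1) * (z - y) = 0" using that(2,3) by (simp add: algebra_simps)
        then have "s = 1" using that(1) by simp
        then show ?thesis using that(2) by simp
      qed
      from this[OF lt] have st1: "s = 1" "t = 0"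
        using st[OF order_refl less_imp_le[OF lt], unfolded fx(1)] st[OF less_imp_le[OF lt] order_refl, unfolded fx(2)]
        by blast+
      moreover have "real_of_int c / q \<le> x" "x \<le> (real_of_int c + 1) / q" using c q by (simp_all add: field_simps)
      ultimately show ?thesis using st[of x] st1 by simp
    qed (use jk \<open>j = 0\<close> \<open>k = 0\<close> in simp_all)
  qed
  then show "FV w = id" by (simp add: fun_eq_iff)
qed

subsection \<open>The word problem of the extension\<close>

text \<open>The stable letters of a word are collected on the right and freely reduced there.\<close>

definition collect :: "(nat \<times> bool \<Rightarrow> nat \<times> bool \<Rightarrow> word) \<Rightarrow> nat \<times> bool \<Rightarrow> word \<times> word \<Rightarrow> word \<times> word" where
  "collect S l st = (if fst l \<le> 1 then (l # fst st, snd st) else (subst_word S l (fst st), push l (snd st)))"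

text \<open>An invariant of the elements of \<open>G\<close>, namely their image in the free quotient.\<close>

definition stable_part :: "word \<Rightarrow> word" where
  "stable_part w = fred (filter (\<lambda>l. \<not> fst l \<le> 1) w)"

lemma stable_part_cancel: "stable_part (u @ [(i, e), (i, \<not> e)] @ v) = stable_part (u @ v)"
  using fred_cancel[of "filter (\<lambda>l. \<not> fst l \<le> 1) u" i e "filter (\<lambda>l. \<not> fst l \<le> 1) v"]
  by (auto simp: stable_part_def)

lemma filter_words_2: "w \<in> words 2 \<Longrightarrow> filter (\<lambda>l. \<not> fst l \<le> Suc 0) w = []"
  by (induction w) auto

context F_extension
begin

lemma stable_part_relator:
  assumes "r \<in> R" shows "stable_part (u @ r @ v) = stable_part (u @ v)"
proof -
  let ?f = "filter (\<lambda>l. \<not> fst l \<le> Suc 0)"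
  have t: "?f (gen (j + 2)) = [(j + 2, True)]" "?f (winv (gen (j + 2))) = [(j + 2, False)]" for j
    by (simp_all add: gen_def winv_def)
  have g: "?f (gen 0) = []" "?f (gen 1) = []" by (simp_all add: gen_def)
  consider "r \<in> F_relators" | j where "j < n" "r = winv (gen (j + 2)) @ gen 0 @ gen (j + 2) @ winv (wa ! j)"
    | j where "j < n" "r = winv (gen (j + 2)) @ gen 1 @ gen (j + 2) @ winv (wb ! j)"
    using assms unfolding R_def extension_relators_def by blast
  then have "?f r = [] \<or> (\<exists>j. ?f r = [(j, False), (j, \<not> False)])"
  proof cases
    case 1
    then have "r \<in> words 2" by (auto simp: F_relators_def Let_def wcomm_def)
    then show ?thesis by (simp add: filter_words_2)
  next
    case (2 j)
    have "?f (winv (wa ! j)) = []" using wa[OF 2(1)] by (intro filter_words_2) simp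
    then show ?thesis unfolding 2(2) filter_append t g by simp
  next
    case (3 j)
    have "?f (winv (wb ! j)) = []" using wb[OF 3(1)] by (intro filter_words_2) simp
    then show ?thesis unfolding 3(2) filter_append t g by simp
  qed
  then show ?thesis
  proof
    assume "\<exists>j. ?f r = [(j, False), (j, \<not> False)]"
    then obtain j where "?f r = [(j, False), (j, \<not> False)]" by blast
    then show ?thesis using fred_cancel[of "?f u" j False "?f v"] by (simp add: stable_part_def)
  qed (simp add: stable_part_def)
qed

lemma collect:
  assumes S: "conj_table es S" and w: "w \<in> words (n + 2)"
  shows "fst (foldr (collect S) w ([], [])) \<in> words 2 \<and> snd (foldr (collect S) w ([], [])) = stable_part w \<and>
    stable_part w \<in> words (n + 2) \<and> ev w = ev (fst (foldr (collect S) w ([], []))) \<otimes>\<^bsub>P\<^esub> ev (stable_part w)"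
  using w
proof (induction w)
  case Nil
  then show ?case by (simp add: stable_part_def fred_def)
next
  case (Cons l w)
  define f where "f = fst (foldr (collect S) w ([], []))"
  define T where "T = stable_part w"
  have l: "fst l < n + 2" "w \<in> words (n + 2)" "[l] \<in> words (n + 2)" using Cons.prems by auto
  have IH: "f \<in> words 2" "snd (foldr (collect S) w ([], [])) = T" "T \<in> words (n + 2)" "ev w = ev f \<otimes>\<^bsub>P\<^esub> ev T"
    using Cons.IH[OF l(2)] by (simp_all add: f_def T_def)
  have fw: "f \<in> words (n + 2)" using IH(1) by (rule words_2_sub)
  have cl: "ev [l] \<in> carrier P" "ev f \<in> carrier P" "ev T \<in> carrier P" by (rule ev_closed[OF l(3)], rule ev_closed[OF fw], rule ev_closed[OF IH(3)])
  have ev_l: "ev (l # w) = ev [l] \<otimes>\<^bsub>P\<^esub> (ev f \<otimes>\<^bsub>P\<^esub> ev T)" using ev_append[OF l(3,2)] IH(4) by simp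
  have st: "foldr (collect S) (l # w) ([], []) = collect S l (f, T)" using IH(2) by (simp add: f_def flip: IH(2))
  show ?case
  proof (cases "fst l \<le> 1")
    case True
    have "ev (l # f) = ev [l] \<otimes>\<^bsub>P\<^esub> ev f" using ev_append[OF l(3) fw] by simp
    then have "ev (l # w) = ev (l # f) \<otimes>\<^bsub>P\<^esub> ev T" unfolding ev_l using cl by (simp only: P.m_assoc)
    moreover have "stable_part (l # w) = T" using True by (simp add: stable_part_def T_def)
    ultimately show ?thesis unfolding st using True IH(1,3) by (auto simp: collect_def)
  next
    case False
    have T': "stable_part (l # w) = push l T" using False by (simp add: stable_part_def T_def fred_def)
    have sub: "subst_word S l f \<in> words 2" using subst_word[OF S es_normF _ IH(1), of l] l(1) by simp
    have pw: "push l T \<in> words (n + 2)" using l(1) IH(3) by (rule push_words)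
    have lT: "l # T \<in> words (n + 2)" using l(1) IH(3) by simp
    have "ev (l # T) = ev (push l T)" using pres_eq_push[OF l(1) IH(3)] ev_eq_iff[OF lT pw] by blast
    then have push: "ev (push l T) = ev [l] \<otimes>\<^bsub>P\<^esub> ev T" using ev_append[OF l(3) IH(3)] by simp
    have "ev (l # w) = (ev [l] \<otimes>\<^bsub>P\<^esub> ev f) \<otimes>\<^bsub>P\<^esub> ev T" unfolding ev_l using cl by (simp only: P.m_assoc)
    also have "\<dots> = ev (subst_word S l f) \<otimes>\<^bsub>P\<^esub> ev (push l T)"
      unfolding ev_subst_word[OF S l(1) IH(1)] push using cl ev_closed[OF words_2_sub[OF sub]] by (simp only: P.m_assoc)
    finally show ?thesis unfolding st T' using False sub pw by (simp add: collect_def)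
  qed
qed

text \<open>After collection the word is a product of a word in \<open>\<alpha>, \<beta>\<close> and a reduced word in the stable letters.
  The latter is an invariant of the element of \<open>G\<close>, and the former is trivial in \<open>G\<close> iff it is so as a
  homeomorphism.\<close>

lemma ev_one_iff:
  assumes S: "conj_table es S" and w: "w \<in> words (n + 2)"
  shows "ev w = \<one>\<^bsub>P\<^esub> \<longleftrightarrow> snd (foldr (collect S) w ([], [])) = [] \<and> F_test (fst (foldr (collect S) w ([], [])))"
proof -
  define f where "f = fst (foldr (collect S) w ([], []))"
  have c: "f \<in> words 2" "snd (foldr (collect S) w ([], [])) = stable_part w" "ev w = ev f \<otimes>\<^bsub>P\<^esub> ev (stable_part w)"
    using collect[OF S w] by (simp_all add: f_def)
  have fc: "ev f \<in> carrier P" "f \<in> words (n + 2)" using words_2_sub[OF c(1)] by simp_all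
  show ?thesis unfolding c(2) f_def[symmetric]
  proof
    assume one: "ev w = \<one>\<^bsub>P\<^esub>"
    then have "pres_eq (n + 2) R w []" using ev_eq_iff[OF w words_Nil] by simp
    then have "stable_part w = stable_part []"
      by (rule pres_eq_invariant) (simp_all only: stable_part_cancel stable_part_relator)
    then have T: "stable_part w = []" by (simp add: stable_part_def fred_def)
    then have "ev f = ev []" using c(3) one fc by simp
    then have "PV es f = PV es []" using fc by (intro PV_cong) auto
    then have "FV f = id" using PV_words_2[OF c(1)] by simp
    then show "stable_part w = [] \<and> F_test f" using T F_test_iff[OF c(1)] by simp
  next
    assume *: "stable_part w = [] \<and> F_test f"
    then have "FV f = FV []" using F_test_iff[OF c(1)] by simp
    then have "ev f = ev []" using c(1) by (intro ev_cong_F) auto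
    then show "ev w = \<one>\<^bsub>P\<^esub>" using c(3) * by simp
  qed
qed

lemma word_problem: "word_problem_solvable P (pres_gens (n + 2) R)"
proof -
  obtain S where S: "conj_table es S" using conj_table_exists[OF es_normF] by blast
  have collect: "computable (\<lambda>w. foldr (collect S) w ([], []))"
    unfolding collect_def
    by (intro computable_foldr computable_if computable_nat_arith(4) computable_Pair computable_Cons computable_push
        computable_subst_word[OF S] computable_fst computable_snd computable_id computable_const)
  show ?thesis
  proof (rule word_problem_solvableI)
    show "computable (\<lambda>w. snd (foldr (collect S) w ([], [])) = [] \<and> F_test (fst (foldr (collect S) w ([], []))))"
      by (intro computable_conj computable_eq computable_snd[OF collect] computable_const
          computable_comp[OF computable_F_test] computable_fst[OF collect])
    show "(snd (foldr (collect S) w ([], [])) = [] \<and> F_test (fst (foldr (collect S) w ([], [])))) =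
        (word_val P (pres_gens (n + 2) R) w = \<one>\<^bsub>P\<^esub>)" if "w \<in> words (length (pres_gens (n + 2) R))" for w
      using ev_one_iff[OF S, of w] that by (simp add: ev_def)
  qed
qed

end

section \<open>Germs at infinity\<close>

text \<open>The filter \<open>F\<close> is one of the ends \<^term>\<open>at_top\<close> and \<^term>\<open>at_bot\<close> of the line. Eventual equality
  replaces the far unit intervals in the definition of the map to \<open>T \<times> T\<close> (\<open>pi_map_germs\<close>).\<close>

definition germ :: "real filter \<Rightarrow> (real \<Rightarrow> real) \<Rightarrow> (circle \<Rightarrow> circle) \<Rightarrow> bool" where
  "germ F e g \<longleftrightarrow> (\<forall>\<^sub>F x in F. g (to_circle x) = to_circle (e x))"

interpretation T: group T_group
  by (rule group_T)

lemma to_circle_shift: "to_circle (x + of_int n) = to_circle x"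
  by (simp add: to_circle_eq_iff)

lemma circle_point_at_end:
  assumes "F = at_top \<or> F = at_bot" "\<forall>\<^sub>F x in F. Q x"
  shows "\<exists>n. Q (y + real_of_int n)"
  using assms(1)
proof
  assume "F = at_top"
  then obtain K where K: "\<And>x. K \<le> x \<Longrightarrow> Q x" using assms(2) by (auto simp: eventually_at_top_linorder)
  show ?thesis by (rule exI[of _ "\<lceil>K - y\<rceil>"], rule K) linarith
next
  assume "F = at_bot"
  then obtain K where K: "\<And>x. x \<le> K \<Longrightarrow> Q x" using assms(2) by (auto simp: eventually_at_bot_linorder)
  show ?thesis by (rule exI[of _ "\<lfloor>K - y\<rfloor>"], rule K) linarith
qed

lemma germ_unique:
  assumes F: "F = at_top \<or> F = at_bot" and "germ F e g" "germ F e g'"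
  shows "g = g'"
proof
  fix z
  have "\<forall>\<^sub>F x in F. g (to_circle x) = g' (to_circle x)"
    using assms(2,3) unfolding germ_def by eventually_elim simp
  from circle_point_at_end[OF F this, of "rep_circle z"] show "g z = g' z" by (auto simp: to_circle_shift)
qed

text \<open>Near both ends every point of the circle has representatives \<open>y + n\<close>, and \<open>h (y + n)\<close> represents
  the same point as \<open>h y\<close>.\<close>

lemma germ_periodic:
  assumes h: "\<And>x. h (x + 1) = h x + 1" and "germ at_top h g" "germ at_bot h g'"
  shows "g = g'"
proof
  fix z
  define y where "y = rep_circle z"
  have z: "to_circle y = z" by (simp add: y_def)
  have eq: "to_circle (h (y + real_of_int n)) = to_circle (h y)" for n
    unfolding commute_int_shift[of h y n, OF h] by (rule to_circle_shift)
  obtain n where "g (to_circle (y + real_of_int n)) = to_circle (h (y + real_of_int n))"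
    using circle_point_at_end[OF _ assms(2)[unfolded germ_def], of y] by blast
  moreover obtain m where "g' (to_circle (y + real_of_int m)) = to_circle (h (y + real_of_int m))"
    using circle_point_at_end[OF _ assms(3)[unfolded germ_def], of y] by blast
  ultimately show "g z = g' z" unfolding eq to_circle_shift z by simp
qed

lemma PL2_end_preserving:
  assumes e: "e \<in> PL2" "strict_mono e" and F: "F = at_top \<or> F = at_bot"
  shows "filterlim e F F"
proof -
  have le: "finv e Z \<le> x \<longleftrightarrow> Z \<le> e x" "x \<le> finv e Z \<longleftrightarrow> e x \<le> Z" for Z x
    using strict_mono_less_eq[OF e(2), of "finv e Z" x] strict_mono_less_eq[OF e(2), of x "finv e Z"]
    by (simp_all add: PL2_inv[OF e(1)])
  have "filterlim e at_top at_top" unfolding filterlim_at_top eventually_at_top_linorder using le(1) by blast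
  moreover have "filterlim e at_bot at_bot" unfolding filterlim_at_bot eventually_at_bot_linorder using le(2) by blast
  ultimately show ?thesis using F by blast
qed

lemma germ_comp:
  assumes "e' \<in> PL2" "strict_mono e'" "F = at_top \<or> F = at_bot" "germ F e g" "germ F e' g'"
  shows "germ F (e \<circ> e') (g \<circ> g')"
proof -
  have "\<forall>\<^sub>F x in F. g (to_circle (e' x)) = to_circle (e (e' x))"
    using assms(4) PL2_end_preserving[OF assms(1-3)] unfolding germ_def by (rule eventually_compose_filterlim)
  then show ?thesis using assms(5) unfolding germ_def by eventually_elim simp
qed

lemma germ_inv:
  assumes e: "e \<in> PL2" "strict_mono e" and F: "F = at_top \<or> F = at_bot" and g: "g \<in> thompson_T" "germ F e g"
  shows "germ F (finv e) (inv\<^bsub>T_group\<^esub> g)"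
proof -
  have "(inv\<^bsub>T_group\<^esub> g) (g z) = z" for z
    using T.l_inv[of g] g(1) by (simp add: fun_eq_iff)
  note g' = this
  have "filterlim (finv e) F F"
    using PL2_end_preserving[OF PL2_inverse(1)[OF e(1)] strict_mono_inv_PL2[OF e] F] .
  then have "\<forall>\<^sub>F x in F. g (to_circle (finv e x)) = to_circle (e (finv e x))"
    using g(2) unfolding germ_def by (rule eventually_compose_filterlim[rotated])
  then show ?thesis unfolding germ_def
    by eventually_elim (simp add: PL2_inv[OF e(1)], metis g')
qed

lemma germ_word:
  assumes es: "\<And>i. i < length es \<Longrightarrow> es ! i \<in> PL2 \<and> strict_mono (es ! i)"
    and gs: "length gs = length es" "\<And>i. i < length es \<Longrightarrow> gs ! i \<in> thompson_T \<and> germ F (es ! i) (gs ! i)"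
    and F: "F = at_top \<or> F = at_bot" and w: "w \<in> words (length es)"
  shows "PV es w \<in> PL2 \<and> strict_mono (PV es w) \<and> germ F (PV es w) (word_val T_group gs w)"
  using w
proof (induction w)
  case Nil
  have "germ F id id" by (simp add: germ_def)
  moreover have "strict_mono (id :: real \<Rightarrow> real)" by (simp add: strict_mono_def)
  ultimately show ?case unfolding word_val.simps PL2_group_simps T_group_simps using PL2_id by blast
next
  case (Cons l w)
  then have l: "fst l < length es" "w \<in> words (length es)" by auto
  have e: "es ! fst l \<in> PL2" "strict_mono (es ! fst l)" "gs ! fst l \<in> thompson_T" "germ F (es ! fst l) (gs ! fst l)"
    using es[OF l(1)] gs(2)[OF l(1)] by auto
  define e' where "e' = (if snd l then es ! fst l else finv (es ! fst l))"
  define g' where "g' = (if snd l then gs ! fst l else inv\<^bsub>T_group\<^esub> (gs ! fst l))"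
  have e': "e' \<in> PL2" "strict_mono e'" "germ F e' g'"
    using e PL2_inverse(1)[OF e(1)] strict_mono_inv_PL2[OF e(1,2)] germ_inv[OF e(1,2) F e(3,4)]
    by (simp_all add: e'_def g'_def)
  have IH: "PV es w \<in> PL2" "strict_mono (PV es w)" "germ F (PV es w) (word_val T_group gs w)"
    using Cons.IH[OF l(2)] by auto
  have v: "PV es (l # w) = e' \<circ> PV es w" "word_val T_group gs (l # w) = g' \<circ> word_val T_group gs w"
    by (simp_all only: e'_def g'_def word_val.simps inv_PL2[OF e(1)] PL2_group_simps T_group_simps)
  show ?case unfolding v using PL2_comp(1)[OF e'(1) IH(1)] strict_mono_o[OF e'(2) IH(2)] germ_comp[OF IH(1,2) F e'(3) IH(3)]
    by blast
qed

subsection \<open>Existence of germs\<close>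

lemma unit_translation:
  fixes e :: "real \<Rightarrow> real" and k l :: int
  assumes "strict_mono e" and step: "\<And>i. int i < l \<Longrightarrow> e (x + real i + 1) = e (x + real i) + real_of_int k"
    and l: "e (x + real_of_int l) = e x + 1"
  shows "k = 1"
proof -
  have "e x < e (x + real_of_int l)" using l by simp
  then have "0 < l" using strict_mono_less[OF assms(1)] by simp
  have "e (x + real i) = e x + real i * real_of_int k" if "int i \<le> l" for i
    using that
  proof (induction i)
    case (Suc i)
    then show ?case using step[of i] by (simp add: algebra_simps)
  qed simp
  from this[of "nat l"] have "e (x + real_of_int l) = e x + real_of_int (l * k)" using \<open>0 < l\<close> by simp
  then have "real_of_int (l * k) = real_of_int 1" using l by simp
  then have "l * k = 1" by (simp only: of_int_eq_iff)
  then show "k = 1" using \<open>0 < l\<close> by (auto simp: zmult_eq_1_iff)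
qed

text \<open>Conjugation by \<open>e\<close> and by its inverse turns the unit translation into elements of \<open>F\<close>, that
  is, near either end of the line, into translations by integers \<open>k\<close> and \<open>l\<close>; these must satisfy
  \<open>k l = 1\<close>.\<close>

lemma normF_periodic:
  assumes e: "normF e" "strict_mono e"
  shows "\<exists>K. \<forall>x\<ge>K. e (x + 1) = e x + 1" "\<exists>K. \<forall>x\<le>K. e (x + 1) = e x + 1"
proof -
  have PL: "e \<in> PL2" using e(1) by (rule normF_PL2)
  have tau: "(\<lambda>t. t + 1) \<in> thompson_F" using thompson_F_inv[OF alpha_F] by (simp add: finv_alpha)
  have "e \<circ> (\<lambda>t. t + 1) \<circ> finv e \<in> thompson_F" "finv e \<circ> (\<lambda>t. t + 1) \<circ> e \<in> thompson_F"
    using e(1) tau unfolding normF_def by blast+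
  note ends = this[unfolded thompson_F_def mem_Collect_eq o_def]
  obtain M N k j where
    f: "\<And>x. x > M \<Longrightarrow> e (finv e x + 1) = x + real_of_int k" "\<And>x. x < N \<Longrightarrow> e (finv e x + 1) = x + real_of_int j"
    using ends(1) by blast
  obtain M' N' l i where
    h: "\<And>x. x > M' \<Longrightarrow> finv e (e x + 1) = x + real_of_int l" "\<And>x. x < N' \<Longrightarrow> finv e (e x + 1) = x + real_of_int i"
    using ends(2) by blast
  have less: "M < e x \<longleftrightarrow> finv e M < x" "e x < N \<longleftrightarrow> x < finv e N" for x
    using strict_mono_less[OF e(2), of "finv e M" x] strict_mono_less[OF e(2), of x "finv e N"]
    by (simp_all add: PL2_inv[OF PL])
  have up: "e (x + 1) = e x + real_of_int k" if "x > finv e M" for x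
    using f(1)[of "e x"] that less(1)[of x] by (simp add: PL2_inv[OF PL])
  have down: "e (x + 1) = e x + real_of_int j" if "x < finv e N" for x
    using f(2)[of "e x"] that less(2)[of x] by (simp add: PL2_inv[OF PL])
  have up': "e (x + real_of_int l) = e x + 1" if "x > M'" for x
    using arg_cong[OF h(1)[OF that], of e] by (simp add: PL2_inv[OF PL])
  have down': "e (x + real_of_int i) = e x + 1" if "x < N'" for x
    using arg_cong[OF h(2)[OF that], of e] by (simp add: PL2_inv[OF PL])
  define x where "x = max (finv e M) M' + 1"
  have "k = 1"
  proof (rule unit_translation[OF e(2), of l x])
    show "e (x + real a + 1) = e (x + real a) + real_of_int k" for a by (rule up) (simp add: x_def)
    show "e (x + real_of_int l) = e x + 1" by (rule up') (simp add: x_def)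
  qed
  then show "\<exists>K. \<forall>x\<ge>K. e (x + 1) = e x + 1" using up by (intro exI[of _ "finv e M + 1"]) auto
  define y where "y = min (finv e N) N' - 1 - real_of_int \<bar>i\<bar>"
  have "j = 1"
  proof (rule unit_translation[OF e(2), of i y])
    show "e (y + real a + 1) = e (y + real a) + real_of_int j" if "int a < i" for a
    proof (rule down)
      have "real_of_int (int a) < real_of_int i" using that by (simp only: of_int_less_iff)
      then show "y + real a < finv e N" by (simp add: y_def)
    qed
    show "e (y + real_of_int i) = e y + 1" by (rule down') (simp add: y_def)
  qed
  then show "\<exists>K. \<forall>x\<le>K. e (x + 1) = e x + 1" using down by (intro exI[of _ "finv e N - 1"]) auto
qed

text \<open>The values beyond \<open>K\<close> are continued to the left by periodicity. All local properties of \<open>f\<close> at \<open>x\<close> are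
  those of \<open>e\<close> at \<open>x + n\<close> for large \<open>n\<close>.\<close>

lemma periodic_extension_PL2:
  assumes e: "e \<in> PL2" "strict_mono e" and K: "\<And>x. K \<le> x \<Longrightarrow> e (x + 1) = e x + 1"
  shows "\<exists>f \<in> PL2. strict_mono f \<and> (\<forall>x. f (x + 1) = f x + 1) \<and> (\<forall>x\<ge>K. f x = e x)"
proof -
  have Kn: "e (x + real n) = e x + real n" if "K \<le> x" for x n
  proof (induction n)
    case (Suc n)
    then show ?case using K[of "x + real n"] that by (simp add: algebra_simps)
  qed simp
  define f where "f x = e (x + real (nat \<lceil>K - x\<rceil>)) - real (nat \<lceil>K - x\<rceil>)" for x
  have f: "f x = e (x + real n) - real n" if "K \<le> x + real n" for x n
  proof -
    define j where "j = nat \<lceil>K - x\<rceil>"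
    have j: "K \<le> x + real j" unfolding j_def by linarith
    have "e (x + real j + real n) = e (x + real j) + real n" "e (x + real n + real j) = e (x + real n) + real j"
      using Kn[OF j] Kn[OF that] by blast+
    moreover have "x + real j + real n = x + real n + real j" by simp
    ultimately show ?thesis unfolding f_def j_def[symmetric] by simp
  qed
  have big: "\<exists>n::nat. K \<le> x + real n" for x by (rule exI[of _ "nat \<lceil>K - x\<rceil>"]) linarith
  have far: "f x = e x" if "K \<le> x" for x using f[of x 0] that by simp
  have per: "f (x + 1) = f x + 1" for x
  proof -
    obtain n where n: "K \<le> x + real n" using big by blast
    have "f (x + 1) = e (x + real n + 1) - real n" using f[of "x + 1" n] n by (simp add: algebra_simps)
    then show ?thesis using K[OF n] f[OF n] by simp
  qed
  have mono: "strict_mono f"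
  proof (rule strict_monoI)
    fix x y :: real assume xy: "x < y"
    obtain n where n: "K \<le> x + real n" using big by blast
    then show "f x < f y" using f[OF n] f[of y n] strict_mono_less[OF e(2), of "x + real n" "y + real n"] xy by simp
  qed
  have "\<exists>x. f x = y" for y
  proof -
    obtain n :: nat where "e K - y \<le> real n" using real_arch_simple by blast
    then have n: "e K \<le> y + real n" by linarith
    define x where "x = finv e (y + real n) - real n"
    have "e K \<le> e (x + real n)" using n by (simp add: x_def PL2_inv[OF e(1)])
    then have "K \<le> x + real n" using strict_mono_less_eq[OF e(2)] by blast
    then have "f x = y" using f[of x n] by (simp add: x_def PL2_inv[OF e(1)])
    then show ?thesis by blast
  qed
  then have surj: "surj f" by (metis surjI)
  have bij: "bij f" using surj strict_mono_imp_inj_on[OF mono] by (simp add: bij_def)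
  have ff: "f (finv f x) = x" "finv f (f x) = x" for x
    using bij by (simp_all add: bij_is_surj surj_f_inv_f bij_is_inj)
  have "continuous_on UNIV f"
    using surj strict_mono_leD[OF mono] by (auto intro!: continuous_onI_mono)
  moreover have "continuous_on UNIV (finv f)"
  proof -
    have "surj (finv f)" using bij_imp_bij_inv[OF bij] by (rule bij_is_surj)
    then show ?thesis using strict_mono_leD[OF strict_mono_inverse[OF mono ff(1)]] by (auto intro!: continuous_onI_mono)
  qed
  ultimately have homeo: "homeomorphism UNIV UNIV f (finv f)"
    using surj bij_is_surj[OF bij_imp_bij_inv[OF bij]] ff by (simp add: homeomorphism_def)
  have fd: "f x \<in> dyadic \<longleftrightarrow> x \<in> dyadic" for x
  proof -
    obtain n where n: "K \<le> x + real n" using big by blast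
    have nd: "real n \<in> dyadic" using dyadic_of_int[of "int n"] by simp
    have "f x \<in> dyadic \<longleftrightarrow> e (x + real n) \<in> dyadic"
      using dyadic_add[OF _ nd, of "f x"] dyadic_diff[OF _ nd, of "e (x + real n)"] f[OF n] by auto
    also have "\<dots> \<longleftrightarrow> x + real n \<in> dyadic" by (rule PL2_dyadic_iff[OF e(1)])
    also have "\<dots> \<longleftrightarrow> x \<in> dyadic" using dyadic_add[OF _ nd, of x] dyadic_diff[OF _ nd, of "x + real n"] by auto
    finally show ?thesis .
  qed
  have dy: "f ` dyadic = dyadic"
  proof
    show "f ` dyadic \<subseteq> dyadic" by (auto simp: fd)
    show "dyadic \<subseteq> f ` dyadic"
    proof
      fix y :: real assume "y \<in> dyadic"
      then have "finv f y \<in> dyadic" using fd[of "finv f y"] by (simp add: ff)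
      then show "y \<in> f ` dyadic" by (rule image_eqI[rotated]) (simp add: ff)
    qed
  qed
  have aff: "dyadic_affine_at f x" if n: "K < x + real n" and nb: "x + real n \<notin> breakpoints e" for x n
  proof -
    obtain s b k where sb: "\<forall>\<^sub>F z in nhds (x + real n). e z = s * z + b" and k: "s = 2 powi k \<or> s = - (2 powi k)"
      by (rule dyadic_affine_atE[OF dyadic_affine_at_PL2[OF e(1) nb]])
    have "filterlim (\<lambda>y. y + real n) (nhds (x + real n)) (nhds x)"
      by (rule continuous_on_UNIV_filterlim) (intro continuous_intros)
    with sb have "\<forall>\<^sub>F y in nhds x. e (y + real n) = s * (y + real n) + b" by (rule eventually_compose_filterlim)
    moreover have "\<forall>\<^sub>F y in nhds x. y \<in> {K - real n<..}" using n by (intro eventually_nhds_in_open) auto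
    ultimately have "\<forall>\<^sub>F y in nhds x. f y = s * y + (s * real n + b - real n)"
    proof eventually_elim
      case (elim y)
      then show ?case using f[of y n] by (simp add: algebra_simps)
    qed
    with k show ?thesis unfolding dyadic_affine_at_def by blast
  qed
  define S where "S = {x. \<not> dyadic_affine_at f x}"
  have S_sub: "x + real n \<in> breakpoints e" if "x \<in> S" "K < x + real n" for x n
    using aff[OF that(2)] that(1) unfolding S_def by blast
  have big': "\<exists>n::nat. K < x + real n" for x by (rule exI[of _ "nat \<lceil>K - x\<rceil> + 1"]) (simp, linarith)
  have "S \<subseteq> dyadic"
  proof
    fix x assume x: "x \<in> S"
    obtain n where n: "K < x + real n" using big' by blast
    have "x + real n \<in> dyadic" using S_sub[OF x n] e(1) unfolding PL2_def by blast
    moreover have "real n \<in> dyadic" using dyadic_of_int[of "int n"] by simp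
    ultimately show "x \<in> dyadic" using dyadic_diff[of "x + real n" "real n"] by simp
  qed
  moreover have "finite (S \<inter> {a..b})" for a b
  proof -
    obtain n where n: "K < a + real n" using big' by blast
    have "S \<inter> {a..b} \<subseteq> (\<lambda>z. z - real n) ` (breakpoints e \<inter> {a + real n..b + real n})"
    proof
      fix x assume x: "x \<in> S \<inter> {a..b}"
      then have "x + real n \<in> breakpoints e \<inter> {a + real n..b + real n}" using S_sub[of x n] n by auto
      then show "x \<in> (\<lambda>z. z - real n) ` (breakpoints e \<inter> {a + real n..b + real n})"
        by (rule image_eqI[rotated]) simp
    qed
    moreover have "finite (breakpoints e \<inter> {a + real n..b + real n})" using e(1) by (simp add: PL2_def)
    ultimately show ?thesis by (meson finite_imageI finite_subset)
  qed
  moreover have "dyadic_affine_at f x" if "x \<notin> S" for x using that by (simp add: S_def)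
  ultimately have "f \<in> PL2" using PL2I(1)[OF homeo dy] by blast
  with mono per far show ?thesis by blast
qed

lemma uminus_PL2: "(uminus :: real \<Rightarrow> real) \<in> PL2"
proof (rule PL2I(1)[of uminus uminus "{}"])
  show "homeomorphism UNIV UNIV uminus (uminus :: real \<Rightarrow> real)"
    unfolding homeomorphism_def by (auto intro!: continuous_intros)
  show "uminus ` dyadic = dyadic"
    using dyadic_minus by (force intro: image_eqI[of _ uminus "- _"])
  fix x :: real
  have "\<forall>\<^sub>F y in nhds x. - y = (- (2 powi 0)) * y + 0" by simp
  then show "dyadic_affine_at uminus x" unfolding dyadic_affine_at_def by blast
qed auto

text \<open>The case of the negative end is reduced to the other one by the reflection of the line.\<close>

lemma periodic_extension_PL2_neg:
  assumes e: "e \<in> PL2" "strict_mono e" and K: "\<And>x. x \<le> K \<Longrightarrow> e (x + 1) = e x + 1"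
  shows "\<exists>f \<in> PL2. strict_mono f \<and> (\<forall>x. f (x + 1) = f x + 1) \<and> (\<exists>K'. \<forall>x\<le>K'. f x = e x)"
proof -
  define e' where "e' = uminus \<circ> (e \<circ> uminus)"
  have e': "e' \<in> PL2" unfolding e'_def by (intro PL2_comp(1) uminus_PL2 e)
  have mono: "strict_mono e'" using strict_mono_less[OF e(2)] by (auto simp: strict_mono_def e'_def)
  have K': "e' (x + 1) = e' x + 1" if "1 - K \<le> x" for x
    using K[of "- x - 1"] that by (simp add: e'_def)
  obtain f where f: "f \<in> PL2" "strict_mono f" "\<And>x. f (x + 1) = f x + 1" "\<And>x. 1 - K \<le> x \<Longrightarrow> f x = e' x"
    using periodic_extension_PL2[OF e' mono K'] by blast
  have "uminus \<circ> (f \<circ> uminus) \<in> PL2" by (intro PL2_comp(1) uminus_PL2 f)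
  moreover have "strict_mono (uminus \<circ> (f \<circ> uminus))" using strict_mono_less[OF f(2)] by (auto simp: strict_mono_def)
  moreover have "(uminus \<circ> (f \<circ> uminus)) (x + 1) = (uminus \<circ> (f \<circ> uminus)) x + 1" for x
    using f(3)[of "- x - 1"] by simp
  moreover have "(uminus \<circ> (f \<circ> uminus)) x = e x" if "x \<le> K - 1" for x
    using f(4)[of "- x"] that by (simp add: e'_def)
  ultimately show ?thesis by blast
qed

lemma thompson_T_of_lift:
  assumes "f \<in> PL2" "strict_mono f" "\<And>x. f (x + 1) = f x + 1"
  shows "\<exists>g \<in> thompson_T. \<forall>x. g (to_circle x) = to_circle (f x)"
proof -
  have "to_circle (f (rep_circle (to_circle x))) = to_circle (f x)" for x
    by (rule to_circle_cong) (simp_all add: assms(3))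
  then show ?thesis using assms unfolding thompson_T_def
    by (intro bexI[of _ "\<lambda>z. to_circle (f (rep_circle z))"]) auto
qed

lemma germ_exists:
  assumes e: "normF e" "strict_mono e" and F: "F = at_top \<or> F = at_bot"
  shows "\<exists>g \<in> thompson_T. germ F e g"
  using F
proof
  assume F: "F = at_top"
  obtain K where "\<And>x. K \<le> x \<Longrightarrow> e (x + 1) = e x + 1" using normF_periodic(1)[OF e] by blast
  from periodic_extension_PL2[OF normF_PL2[OF e(1)] e(2) this] obtain f where
    f: "f \<in> PL2" "strict_mono f" "\<And>x. f (x + 1) = f x + 1" "\<And>x. K \<le> x \<Longrightarrow> f x = e x" by blast
  obtain g where g: "g \<in> thompson_T" "\<And>x. g (to_circle x) = to_circle (f x)" using thompson_T_of_lift[OF f(1-3)] by blast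
  have "germ F e g" unfolding germ_def F eventually_at_top_linorder using g(2) f(4) by (intro exI[of _ K]) auto
  with g(1) show ?thesis by blast
next
  assume F: "F = at_bot"
  obtain K where "\<And>x. x \<le> K \<Longrightarrow> e (x + 1) = e x + 1" using normF_periodic(2)[OF e] by blast
  from periodic_extension_PL2_neg[OF normF_PL2[OF e(1)] e(2) this] obtain f K' where
    f: "f \<in> PL2" "strict_mono f" "\<And>x. f (x + 1) = f x + 1" "\<And>x. x \<le> K' \<Longrightarrow> f x = e x" by blast
  obtain g where g: "g \<in> thompson_T" "\<And>x. g (to_circle x) = to_circle (f x)" using thompson_T_of_lift[OF f(1-3)] by blast
  have "germ F e g" unfolding germ_def F eventually_at_bot_linorder using g(2) f(4) by (intro exI[of _ K']) auto
  with g(1) show ?thesis by blast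
qed

lemma pi_map_germs:
  assumes "e \<in> Aut_plus_F" "pi_map e = (g, h)"
  shows "g \<in> thompson_T" "germ at_bot e g" "h \<in> thompson_T" "germ at_top e h"
proof -
  have e: "normF e" "strict_mono e" using assms(1) normF_normalizer by (auto simp: Aut_plus_F_def)
  have "(\<exists>K::int. \<forall>k\<le>K. \<forall>x \<in> {of_int k - 1<..of_int k}. g' (to_circle x) = to_circle (e x)) \<longleftrightarrow> germ at_bot e g'" for g'
    unfolding germ_def eventually_at_bot_linorder
  proof
    assume "\<exists>K::int. \<forall>k\<le>K. \<forall>x \<in> {of_int k - 1<..of_int k}. g' (to_circle x) = to_circle (e x)"
    then obtain K :: int where K: "\<And>k x. k \<le> K \<Longrightarrow> x \<in> {of_int k - 1<..of_int k} \<Longrightarrow> g' (to_circle x) = to_circle (e x)" by blast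
    have "g' (to_circle x) = to_circle (e x)" if "x \<le> of_int K" for x
      using that by (intro K[of "\<lceil>x\<rceil>"]) (auto simp: ceiling_le_iff, linarith)
    then show "\<exists>N. \<forall>n\<le>N. g' (to_circle n) = to_circle (e n)" by blast
  next
    assume "\<exists>N. \<forall>n\<le>N. g' (to_circle n) = to_circle (e n)"
    then obtain N where N: "\<And>x. x \<le> N \<Longrightarrow> g' (to_circle x) = to_circle (e x)" by blast
    have "g' (to_circle x) = to_circle (e x)" if "k \<le> \<lfloor>N\<rfloor>" "x \<in> {of_int k - 1<..of_int k}" for k :: int and x
      using that by (intro N) (auto simp: le_floor_iff)
    then show "\<exists>K::int. \<forall>k\<le>K. \<forall>x \<in> {of_int k - 1<..of_int k}. g' (to_circle x) = to_circle (e x)" by blast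
  qed
  then have minus: "pi_minus e = (THE g. g \<in> thompson_T \<and> germ at_bot e g)" unfolding pi_minus_def by simp
  have "(\<exists>L::int. \<forall>l\<ge>L. \<forall>x \<in> {of_int l..<of_int l + 1}. g' (to_circle x) = to_circle (e x)) \<longleftrightarrow> germ at_top e g'" for g'
    unfolding germ_def eventually_at_top_linorder
  proof
    assume "\<exists>L::int. \<forall>l\<ge>L. \<forall>x \<in> {of_int l..<of_int l + 1}. g' (to_circle x) = to_circle (e x)"
    then obtain L :: int where L: "\<And>l x. L \<le> l \<Longrightarrow> x \<in> {of_int l..<of_int l + 1} \<Longrightarrow> g' (to_circle x) = to_circle (e x)" by blast
    have "g' (to_circle x) = to_circle (e x)" if "of_int L \<le> x" for x
      using that by (intro L[of "\<lfloor>x\<rfloor>"]) (auto simp: le_floor_iff)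
    then show "\<exists>N. \<forall>n\<ge>N. g' (to_circle n) = to_circle (e n)" by blast
  next
    assume "\<exists>N. \<forall>n\<ge>N. g' (to_circle n) = to_circle (e n)"
    then obtain N where N: "\<And>x. N \<le> x \<Longrightarrow> g' (to_circle x) = to_circle (e x)" by blast
    have "g' (to_circle x) = to_circle (e x)" if "\<lceil>N\<rceil> \<le> l" "x \<in> {of_int l..<of_int l + 1}" for l :: int and x
      using that by (intro N) (auto simp: ceiling_le_iff)
    then show "\<exists>L::int. \<forall>l\<ge>L. \<forall>x \<in> {of_int l..<of_int l + 1}. g' (to_circle x) = to_circle (e x)" by blast
  qed
  then have plus: "pi_plus e = (THE g. g \<in> thompson_T \<and> germ at_top e g)" unfolding pi_plus_def by simp
  have the: "(THE g. g \<in> thompson_T \<and> germ F e g) \<in> thompson_T \<and> germ F e (THE g. g \<in> thompson_T \<and> germ F e g)"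
    if F: "F = at_top \<or> F = at_bot" for F
  proof -
    obtain g' where g': "g' \<in> thompson_T" "germ F e g'" using germ_exists[OF e F] by blast
    have "\<exists>!g. g \<in> thompson_T \<and> germ F e g"
    proof (rule ex1I[of _ g'])
      show "g' \<in> thompson_T \<and> germ F e g'" using g' by (rule conjI)
      fix g'' assume "g'' \<in> thompson_T \<and> germ F e g''"
      then show "g'' = g'" by (intro germ_unique[OF F _ g'(2)]) (rule conjunct2)
    qed
    then show ?thesis by (rule theI')
  qed
  show "g \<in> thompson_T" "germ at_bot e g" using the[of at_bot] assms(2) unfolding pi_map_def minus by auto
  show "h \<in> thompson_T" "germ at_top e h" using the[of at_top] assms(2) unfolding pi_map_def plus by auto
qed

section \<open>Ping-pong on the circle\<close>

text \<open>The four quarters of the circle, labelled by the letters \<open>v, u, v\<^sup>-\<^sup>1, u\<^sup>-\<^sup>1\<close> (in this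
  order) of words in \<open>u\<close> (number 0) and \<open>v\<close> (number 1). Each letter maps the three quarters other
  than that of its inverse into its own quarter.\<close>

definition quarter :: "circle \<Rightarrow> nat \<times> bool" where
  "quarter z = (let t = frac (rep_circle z) in
     if t < 1/4 then (1, True) else if t < 1/2 then (0, True) else if t < 3/4 then (1, False) else (0, False))"

lemma quarter_to_circle:
  assumes "0 \<le> t" "t < 1"
  shows "quarter (to_circle t) =
    (if t < 1/4 then (1, True) else if t < 1/2 then (0, True) else if t < 3/4 then (1, False) else (0, False))"
proof -
  have "rep_circle (to_circle t) - t \<in> \<int>" using to_circle_eq_iff[of "rep_circle (to_circle t)" t] by simp
  then have "frac (rep_circle (to_circle t)) = frac t" by (rule frac_cong_Ints)
  also have "\<dots> = t" using assms by (simp add: frac_eq)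
  finally show ?thesis by (simp add: quarter_def)
qed

lemma circle_cases: obtains t where "0 \<le> t" "t < 1" "z = to_circle t"
proof (rule that[of "frac (rep_circle z)"])
  have "frac (rep_circle z) - rep_circle z \<in> \<int>" by (simp add: frac_def)
  then have "to_circle (frac (rep_circle z)) = to_circle (rep_circle z)" unfolding to_circle_eq_iff .
  then show "z = to_circle (frac (rep_circle z))" by simp
qed (auto simp: frac_lt_1)

lemma T_A_to_circle:
  assumes "0 \<le> t" "t < 1"
  shows "t \<le> 1/2 \<Longrightarrow> T_A (to_circle t) = to_circle (t / 2)"
    "1/2 \<le> t \<Longrightarrow> t < 3/4 \<Longrightarrow> T_A (to_circle t) = to_circle (t - 1/4)"
proof -
  have f: "frac t = t" using assms by (simp add: frac_eq)
  show "T_A (to_circle t) = to_circle (t / 2)" if "t \<le> 1/2" using that by (simp add: T_A.abs_eq f)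
  show "T_A (to_circle t) = to_circle (t - 1/4)" if "1/2 \<le> t" "t < 3/4"
  proof (cases "t = 1/2")
    case True
    show ?thesis using f unfolding True by (simp add: T_A.abs_eq)
  next
    case False
    then show ?thesis using that by (simp add: T_A.abs_eq f)
  qed
qed

lemma T_C_to_circle:
  assumes "0 \<le> t" "t < 1"
  shows "t < 1/2 \<Longrightarrow> T_C (to_circle t) = to_circle (t / 2 + 3/4)"
    "1/2 \<le> t \<Longrightarrow> t < 3/4 \<Longrightarrow> T_C (to_circle t) = to_circle (2 * t - 1)"
    "3/4 \<le> t \<Longrightarrow> T_C (to_circle t) = to_circle (t - 1/4)"
proof -
  have f: "frac t = t" using assms by (simp add: frac_eq)
  show "T_C (to_circle t) = to_circle (t / 2 + 3/4)" if "t < 1/2" using that by (simp add: T_C.abs_eq f)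
  show "T_C (to_circle t) = to_circle (2 * t - 1)" if "1/2 \<le> t" "t < 3/4"
  proof (cases "t = 1/2")
    case True
    have "to_circle 1 = to_circle 0" by (simp add: to_circle_eq_iff)
    then show ?thesis using f unfolding True by (simp add: T_C.abs_eq)
  next
    case False
    then show ?thesis using that by (simp add: T_C.abs_eq f)
  qed
  show "T_C (to_circle t) = to_circle (t - 1/4)" if "3/4 \<le> t"
  proof (cases "t = 3/4")
    case True
    show ?thesis using f unfolding True by (simp add: T_C.abs_eq)
  next
    case False
    then show ?thesis using that by (simp add: T_C.abs_eq f)
  qed
qed

lemma T_uv_apply: "T_u z = T_A (T_C (T_C (T_A z)))" "T_v z = T_A (T_A (T_C (T_C z)))"
  by (simp_all add: T_u_def T_v_def numeral_2_eq_2 T_A_mem T_C_mem)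

lemma T_uv_mem: "T_u \<in> thompson_T" "T_v \<in> thompson_T"
  unfolding T_u_def T_v_def
  using T.m_closed T.nat_pow_closed T_A_mem T_C_mem by (simp_all only: T_group_simps)

lemma quarter_u: "quarter z \<noteq> (0, False) \<Longrightarrow> quarter (T_u z) = (0, True)"
proof -
  assume q: "quarter z \<noteq> (0, False)"
  obtain t where t: "0 \<le> t" "t < 1" "z = to_circle t" by (rule circle_cases)
  have lt: "t < 3/4" using q t by (auto simp: quarter_to_circle split: if_splits)
  show ?thesis
  proof (cases "t < 1/2")
    case True
    have "T_A z = to_circle (t / 2)" unfolding t(3) using True t(1) by (intro T_A_to_circle) auto
    moreover have "T_C (to_circle (t / 2)) = to_circle (t / 2 / 2 + 3/4)" using True t(1) by (intro T_C_to_circle) auto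
    moreover have "T_C (to_circle (t / 2 / 2 + 3/4)) = to_circle (t / 2 / 2 + 3/4 - 1/4)"
      using True t(1) by (intro T_C_to_circle) auto
    moreover have "T_A (to_circle (t / 2 / 2 + 3/4 - 1/4)) = to_circle (t / 2 / 2 + 3/4 - 1/4 - 1/4)"
      using True t(1) by (intro T_A_to_circle) auto
    moreover have "t / 2 / 2 + 3/4 - 1/4 - 1/4 = t / 4 + 1/4" by simp
    ultimately have "T_u z = to_circle (t / 4 + 1/4)" unfolding T_uv_apply by (simp only:)
    then show ?thesis using True t(1) by (simp add: quarter_to_circle)
  next
    case False
    have "T_A z = to_circle (t - 1/4)" unfolding t(3) using False lt t(1,2) by (intro T_A_to_circle) auto
    moreover have "T_C (to_circle (t - 1/4)) = to_circle ((t - 1/4) / 2 + 3/4)" using False lt by (intro T_C_to_circle) auto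
    moreover have "T_C (to_circle ((t - 1/4) / 2 + 3/4)) = to_circle ((t - 1/4) / 2 + 3/4 - 1/4)"
      using False lt by (intro T_C_to_circle) (simp_all add: field_simps)
    moreover have "T_A (to_circle ((t - 1/4) / 2 + 3/4 - 1/4)) = to_circle ((t - 1/4) / 2 + 3/4 - 1/4 - 1/4)"
      using False lt by (intro T_A_to_circle) (simp_all add: field_simps)
    moreover have "(t - 1/4) / 2 + 3/4 - 1/4 - 1/4 = t / 2 + 1/8" by (simp add: field_simps)
    ultimately have "T_u z = to_circle (t / 2 + 1/8)" unfolding T_uv_apply by (simp only:)
    then show ?thesis using False lt t(1) by (simp add: quarter_to_circle)
  qed
qed

lemma quarter_v: "quarter z \<noteq> (1, False) \<Longrightarrow> quarter (T_v z) = (1, True)"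
proof -
  assume q: "quarter z \<noteq> (1, False)"
  obtain t where t: "0 \<le> t" "t < 1" "z = to_circle t" by (rule circle_cases)
  have lt: "t < 1/2 \<or> 3/4 \<le> t" using q t by (auto simp: quarter_to_circle split: if_splits)
  show ?thesis
  proof (cases "t < 1/2")
    case True
    have "T_C z = to_circle (t / 2 + 3/4)" unfolding t(3) using True t(1) by (intro T_C_to_circle) auto
    moreover have "T_C (to_circle (t / 2 + 3/4)) = to_circle (t / 2 + 3/4 - 1/4)" using True t(1) by (intro T_C_to_circle) auto
    moreover have "T_A (to_circle (t / 2 + 3/4 - 1/4)) = to_circle (t / 2 + 3/4 - 1/4 - 1/4)"
      using True t(1) by (intro T_A_to_circle) auto
    moreover have "T_A (to_circle (t / 2 + 3/4 - 1/4 - 1/4)) = to_circle ((t / 2 + 3/4 - 1/4 - 1/4) / 2)"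
      using True t(1) by (intro T_A_to_circle) auto
    moreover have "(t / 2 + 3/4 - 1/4 - 1/4) / 2 = t / 4 + 1/8" by (simp add: field_simps)
    ultimately have "T_v z = to_circle (t / 4 + 1/8)" unfolding T_uv_apply by (simp only:)
    then show ?thesis using True t(1) by (simp add: quarter_to_circle)
  next
    case False
    then have "3/4 \<le> t" using lt by simp
    note le = this
    have "T_C z = to_circle (t - 1/4)" unfolding t(3) using le t(1,2) by (intro T_C_to_circle) auto
    moreover have "T_C (to_circle (t - 1/4)) = to_circle (2 * (t - 1/4) - 1)" using le t(2) by (intro T_C_to_circle) auto
    moreover have "T_A (to_circle (2 * (t - 1/4) - 1)) = to_circle ((2 * (t - 1/4) - 1) / 2)"
      using le t(2) by (intro T_A_to_circle) auto
    moreover have "T_A (to_circle ((2 * (t - 1/4) - 1) / 2)) = to_circle ((2 * (t - 1/4) - 1) / 2 / 2)"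
      using le t(2) by (intro T_A_to_circle) auto
    moreover have "(2 * (t - 1/4) - 1) / 2 / 2 = t / 2 - 3/8" by (simp add: field_simps)
    ultimately have "T_v z = to_circle (t / 2 - 3/8)" unfolding T_uv_apply by (simp only:)
    then show ?thesis using le t(2) by (simp add: quarter_to_circle)
  qed
qed

lemma other_generator: "i < 2 \<Longrightarrow> 1 - i \<noteq> (i :: nat)" "i < 2 \<Longrightarrow> i \<noteq> 1 - (i :: nat)"
  by (auto simp: less_Suc_eq numeral_2_eq_2)

definition act :: "nat \<times> bool \<Rightarrow> circle \<Rightarrow> circle" where
  "act l = word_val T_group [T_u, T_v] [l]"

lemma act_simps: "act (0, True) = T_u" "act (1, True) = T_v"
    "act (0, False) = inv\<^bsub>T_group\<^esub> T_u" "act (1, False) = inv\<^bsub>T_group\<^esub> T_v"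
  by (simp_all add: act_def fun_eq_iff)

lemma T_inv_apply:
  assumes "g \<in> thompson_T"
  shows "(inv\<^bsub>T_group\<^esub> g) (g z) = z" "g ((inv\<^bsub>T_group\<^esub> g) z) = z"
  using T.l_inv[of g] T.r_inv[of g] assms by (simp_all add: fun_eq_iff)

lemma act_inverse: "fst l < 2 \<Longrightarrow> act (linv l) (act l z) = z"
  by (erule letter_cases) (simp_all add: act_simps T_inv_apply T_uv_mem flip: One_nat_def)

lemma quarter_act:
  assumes "fst l < 2" "quarter z \<noteq> linv l"
  shows "quarter (act l z) = l"
proof -
  have inv: "quarter ((inv\<^bsub>T_group\<^esub> g) z) = (i, False)"
    if "g \<in> thompson_T" "\<And>y. quarter y \<noteq> (i, False) \<Longrightarrow> quarter (g y) = (i, True)" "quarter z \<noteq> (i, True)" for g i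
    using that(2)[of "(inv\<^bsub>T_group\<^esub> g) z"] that(3) T_inv_apply(2)[OF that(1)] by auto
  show ?thesis using assms(1)
  proof (cases rule: letter_cases)
    case 1
    then show ?thesis using assms(2) quarter_u by (simp add: act_simps)
  next
    case 2
    then show ?thesis using assms(2) inv[OF T_uv_mem(1) quarter_u] by (simp add: act_simps)
  next
    case 3
    then show ?thesis using assms(2) quarter_v[of z] unfolding 3 act_simps by simp
  next
    case 4
    then show ?thesis using assms(2) inv[OF T_uv_mem(2) quarter_v] unfolding 4 act_simps by simp
  qed
qed

text \<open>The generators \<open>a, b\<close> and \<open>c, d\<close> of the theorem. In terms of \<open>u, v\<close> a word in \<open>a, b\<close> doubles each of
  its letters, while in a word in \<open>c, d\<close> each letter becomes the other one, conjugated by the positive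
  letter of its index.\<close>

definition T_ab :: "(circle \<Rightarrow> circle) list" where
  "T_ab = [T_u \<circ> T_u, T_v \<circ> T_v]"

definition T_cd :: "(circle \<Rightarrow> circle) list" where
  "T_cd = [T_u \<circ> (T_v \<circ> inv\<^bsub>T_group\<^esub> T_u), T_v \<circ> (T_u \<circ> inv\<^bsub>T_group\<^esub> T_v)]"

lemma T_ab_cd_mem: "set T_ab \<subseteq> thompson_T" "set T_cd \<subseteq> thompson_T"
proof -
  have "inv\<^bsub>T_group\<^esub> T_u \<in> thompson_T" "inv\<^bsub>T_group\<^esub> T_v \<in> thompson_T"
    using T.inv_closed[of T_u] T.inv_closed[of T_v] T_uv_mem by simp_all
  with T_uv_mem show "set T_ab \<subseteq> thompson_T" "set T_cd \<subseteq> thompson_T"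
    by (auto simp: T_ab_def T_cd_def simp del: o_apply intro!: thompson_T_comp)
qed

lemma T_ab_Cons:
  assumes "fst l < 2"
  shows "word_val T_group T_ab (l # p) z = act l (act l (word_val T_group T_ab p z))"
proof -
  have "inv\<^bsub>T_group\<^esub> (g \<circ> g) = inv\<^bsub>T_group\<^esub> g \<circ> inv\<^bsub>T_group\<^esub> g" if "g \<in> thompson_T" for g
    using T.inv_mult_group[of g g] that by simp
  note inv = this
  show ?thesis using assms
    by (cases rule: letter_cases) (simp_all add: T_ab_def act_simps inv T_uv_mem flip: One_nat_def)
qed

lemma T_cd_Cons:
  assumes "fst l < 2"
  shows "word_val T_group T_cd (l # p) z =
    act (fst l, True) (act (1 - fst l, snd l) (act (fst l, False) (word_val T_group T_cd p z)))"
proof -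
  have inv: "inv\<^bsub>T_group\<^esub> (g \<circ> (h \<circ> inv\<^bsub>T_group\<^esub> g)) = g \<circ> (inv\<^bsub>T_group\<^esub> h \<circ> inv\<^bsub>T_group\<^esub> g)"
    if "g \<in> thompson_T" "h \<in> thompson_T" for g h
  proof -
    have "inv\<^bsub>T_group\<^esub> (g \<otimes>\<^bsub>T_group\<^esub> (h \<otimes>\<^bsub>T_group\<^esub> inv\<^bsub>T_group\<^esub> g)) =
        g \<otimes>\<^bsub>T_group\<^esub> (inv\<^bsub>T_group\<^esub> h \<otimes>\<^bsub>T_group\<^esub> inv\<^bsub>T_group\<^esub> g)"
      using that[folded T_group_simps(1)] by (simp add: T.inv_mult_group T.m_assoc del: T_group_simps)
    then show ?thesis by (simp only: T_group_simps)
  qed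
  show ?thesis using assms
    by (cases rule: letter_cases) (simp_all add: T_cd_def act_simps inv T_uv_mem flip: One_nat_def)
qed

text \<open>The image is described before its last letter is applied: then it lies in the quarter of that
  letter already.\<close>

lemma T_ab_ping_pong:
  assumes "p \<in> words 2" "reduced p" "p \<noteq> []" "quarter z \<noteq> linv (last p)"
  shows "\<exists>y. word_val T_group T_ab p z = act (hd p) y \<and> quarter y = hd p"
  using assms
proof (induction p)
  case (Cons l p)
  define y where "y = word_val T_group T_ab p z"
  have l: "fst l < 2" "p \<in> words 2" using Cons.prems by auto
  have "quarter y \<noteq> linv l"
  proof (cases "p = []")
    case True
    then show ?thesis using Cons.prems(4) by (simp add: y_def)
  next
    case False
    then obtain y' where y': "y = act (hd p) y'" "quarter y' = hd p"
      using Cons.IH[OF l(2)] Cons.prems by (auto simp: reduced_Cons y_def)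
    have "fst (hd p) < 2" using l(2) False by (cases p) auto
    then have "quarter y = hd p" unfolding y'(1) using y'(2) by (intro quarter_act) (auto simp: prod_eq_iff)
    then show ?thesis using Cons.prems(2) False by (simp add: reduced_Cons)
  qed
  then have "quarter (act l y) = l" using l(1) by (rule quarter_act[rotated])
  then show ?case using T_ab_Cons[OF l(1), of p z] by (auto simp: y_def)
qed simp

text \<open>If the inverse conjugating letter cancels against the previous factor, the point returns to the
  quarter of the middle letter of that factor. This is not the inverse of the new middle letter, since the
  word is reduced. As above, the image is described before its last letter is applied.\<close>

lemma T_cd_ping_pong:
  assumes "q \<in> words 2" "reduced q" "q \<noteq> []" "quarter z \<noteq> (fst (last q), True)"
  shows "\<exists>y. word_val T_group T_cd q z = act (fst (hd q), True) y \<and> quarter y = (1 - fst (hd q), snd (hd q))"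
  using assms
proof (induction q)
  case (Cons l q)
  obtain i e where ie: "l = (i, e)" by (cases l)
  have l: "fst l < 2" "q \<in> words 2" "i < 2" using Cons.prems ie by auto
  define w where "w = word_val T_group T_cd q z"
  define x where "x = act (i, False) w"
  have x: "quarter x \<noteq> (1 - i, \<not> e)"
  proof (cases "quarter w = (i, True)")
    case False
    then have "quarter x = (i, False)" unfolding x_def using l(3) by (intro quarter_act) auto
    then show ?thesis using other_generator[OF l(3)] by auto
  next
    case True
    have "q \<noteq> []" using True Cons.prems(4) ie by (auto simp: w_def)
    then obtain y where y: "w = act (fst (hd q), True) y" "quarter y = (1 - fst (hd q), snd (hd q))"
      using Cons.IH[OF l(2)] Cons.prems by (auto simp: reduced_Cons w_def)
    have "fst (hd q) < 2" using l(2) \<open>q \<noteq> []\<close> by (cases q) auto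
    then have "quarter w = (fst (hd q), True)" unfolding y(1) using y(2) other_generator[OF \<open>fst (hd q) < 2\<close>]
      by (intro quarter_act) auto
    then have j: "fst (hd q) = i" using True by simp
    then have "x = y" using y(1) act_inverse[of "(i, True)" y] l(3) by (simp add: x_def)
    moreover have "hd q \<noteq> (i, \<not> e)" using Cons.prems(2) \<open>q \<noteq> []\<close> ie by (auto simp: reduced_Cons)
    then have "snd (hd q) = e" using j by (auto simp: prod_eq_iff)
    ultimately show ?thesis using y(2) j by simp
  qed
  have "quarter (act (1 - i, e) x) = (1 - i, e)" using x l(3) by (intro quarter_act) auto
  moreover have "word_val T_group T_cd (l # q) z = act (i, True) (act (1 - i, e) x)"
    using T_cd_Cons[OF l(1), of q z] by (simp add: ie w_def x_def)
  ultimately show ?case using ie by auto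
qed simp

lemma quarter_avoids: "\<exists>z. quarter z \<noteq> l \<and> quarter z \<noteq> l'"
proof -
  have "quarter (to_circle 0) = (1, True)" "quarter (to_circle (1/4)) = (0, True)" "quarter (to_circle (1/2)) = (1, False)"
    by (simp_all add: quarter_to_circle)
  then show ?thesis by (metis prod.inject zero_neq_one)
qed

text \<open>Some quarter contains a point with which both words can be played. Two images in the same quarter
  have equal last letters, and equal images then agree before that letter as well. But there they lie in
  the quarters of different letters: \<open>a, b\<close> repeat the last letter, \<open>c, d\<close> do not.\<close>

lemma T_ab_cd_reduced:
  assumes p: "p \<in> words 2" "reduced p" and q: "q \<in> words 2" "reduced q"
    and eq: "word_val T_group T_ab p = word_val T_group T_cd q"
  shows "p = [] \<and> q = []"
proof (rule ccontr)
  assume ne: "\<not> (p = [] \<and> q = [])"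
  have hp: "p \<noteq> [] \<Longrightarrow> fst (hd p) < 2" "q \<noteq> [] \<Longrightarrow> fst (hd q) < 2"
    using p(1) q(1) by (cases p; cases q; auto)+
  obtain z where z: "quarter z \<noteq> (if p = [] then (fst (hd q), True) else linv (last p))"
    "quarter z \<noteq> (if q = [] then hd p else (fst (last q), True))" using quarter_avoids by blast
  have eqz: "word_val T_group T_ab p z = word_val T_group T_cd q z" by (simp only: eq)
  have P: "\<exists>y. word_val T_group T_ab p z = act (hd p) y \<and> quarter y = hd p" if "p \<noteq> []"
    using T_ab_ping_pong[OF p that] z that by simp
  have Q: "\<exists>y. word_val T_group T_cd q z = act (fst (hd q), True) y \<and> quarter y = (1 - fst (hd q), snd (hd q))" if "q \<noteq> []"
    using T_cd_ping_pong[OF q that] z that by simp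
  have P': "quarter (word_val T_group T_ab p z) = hd p" if pn: "p \<noteq> []"
  proof -
    obtain y where "word_val T_group T_ab p z = act (hd p) y" "quarter y = hd p" using P[OF pn] by blast
    then show ?thesis using quarter_act[OF hp(1)[OF pn], of y] by (simp add: prod_eq_iff)
  qed
  have Q': "quarter (word_val T_group T_cd q z) = (fst (hd q), True)" if qn: "q \<noteq> []"
  proof -
    obtain y where y: "word_val T_group T_cd q z = act (fst (hd q), True) y" "quarter y = (1 - fst (hd q), snd (hd q))"
      using Q[OF qn] by blast
    show ?thesis unfolding y(1) using y(2) hp(2)[OF qn] other_generator[OF hp(2)[OF qn]] by (intro quarter_act) auto
  qed
  show False
  proof (cases "p = []")
    case True
    then have "q \<noteq> []" using ne by simp
    then show False using Q' eqz z True by simp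
  next
    case pne: False
    show False
    proof (cases "q = []")
      case True
      then show False using P'[OF pne] eqz z pne by simp
    next
      case False
      obtain y where y: "word_val T_group T_ab p z = act (hd p) y" "quarter y = hd p" using P[OF pne] by blast
      obtain y' where y': "word_val T_group T_cd q z = act (fst (hd q), True) y'" "quarter y' = (1 - fst (hd q), snd (hd q))"
        using Q[OF False] by blast
      have hd: "hd p = (fst (hd q), True)" using P'[OF pne] Q'[OF False] eqz by simp
      then have "act (hd p) y = act (hd p) y'" using y(1) y'(1) eqz by simp
      then have "act (linv (hd p)) (act (hd p) y) = act (linv (hd p)) (act (hd p) y')" by (rule arg_cong)
      then have "y = y'" unfolding act_inverse[OF hp(1)[OF pne]] .
      then have "fst (hd q) = 1 - fst (hd q)" using y(2) y'(2) hd by simp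
      then show False using other_generator[OF hp(2)[OF False]] by simp
    qed
  qed
qed

lemma T_ab_cd_words:
  assumes p: "p \<in> words 2" and q: "q \<in> words 2" and eq: "word_val T_group T_ab p = word_val T_group T_cd q"
  shows "pres_eq 2 R p [] \<and> pres_eq 2 R q []"
proof -
  have len: "length T_ab = 2" "length T_cd = 2" by (simp_all add: T_ab_def T_cd_def)
  have "word_val T_group T_ab (fred p) = word_val T_group T_ab p" "word_val T_group T_cd (fred q) = word_val T_group T_cd q"
    using T_ab_cd_mem p q by (auto intro!: T.word_val_fred simp only: len T_group_simps)
  then have "word_val T_group T_ab (fred p) = word_val T_group T_cd (fred q)" using eq by (simp only:)
  then have "fred p = [] \<and> fred q = []"
    by (rule T_ab_cd_reduced[OF fred_words[OF p] reduced_fred fred_words[OF q] reduced_fred])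
  then show ?thesis using pres_eq_fred[OF p, of R] pres_eq_fred[OF q, of R] by simp
qed

section \<open>Substitution in words\<close>

definition subst :: "(nat \<Rightarrow> word) \<Rightarrow> word \<Rightarrow> word" where
  "subst s w = concat (map (\<lambda>(i, e). if e then s i else winv (s i)) w)"

lemma subst_simps [simp]: "subst s [] = []"
  "subst s (l # w) = (if snd l then s (fst l) else winv (s (fst l))) @ subst s w"
  by (simp_all add: subst_def case_prod_beta)

lemma subst_words:
  assumes "\<And>i. i < k \<Longrightarrow> s i \<in> words l" "w \<in> words k" shows "subst s w \<in> words l"
  using assms(2) by (induction w) (use assms(1) in auto)

context group
begin

lemma word_val_subst:
  assumes gs: "set gs \<subseteq> carrier G"
    and s: "\<And>i. i < length hs \<Longrightarrow> s i \<in> words (length gs) \<and> hs ! i = word_val G gs (s i)"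
    and w: "w \<in> words (length hs)"
  shows "word_val G hs w = word_val G gs (subst s w)"
  using w
proof (induction w)
  case (Cons l w)
  then have l: "fst l < length hs" "w \<in> words (length hs)" by auto
  have sw: "s (fst l) \<in> words (length gs)" "winv (s (fst l)) \<in> words (length gs)" "subst s w \<in> words (length gs)"
    using s[OF l(1)] subst_words[OF conjunct1[OF s] l(2)] by auto
  show ?case
  proof (cases "snd l")
    case True
    then show ?thesis using Cons.IH[OF l(2)] s[OF l(1)] word_val_append[OF gs sw(1,3)] by simp
  next
    case False
    then show ?thesis using Cons.IH[OF l(2)] s[OF l(1)] word_val_append[OF gs sw(2,3)] word_val_winv[OF gs sw(1)] by simp
  qed
qed simp

lemma word_val_one: "set gs \<subseteq> {\<one>} \<Longrightarrow> w \<in> words (length gs) \<Longrightarrow> word_val G gs w = \<one>"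
proof (induction w)
  case (Cons l w)
  then have "gs ! fst l = \<one>" using nth_mem[of "fst l" gs] by (auto simp del: nth_mem)
  with Cons show ?case by simp
qed simp

lemma inv_commute:
  assumes "x \<in> carrier G" "y \<in> carrier G" "x \<otimes> y = y \<otimes> x"
  shows "x \<otimes> inv y = inv y \<otimes> x"
proof -
  have "inv y \<otimes> (x \<otimes> y) \<otimes> inv y = inv y \<otimes> (y \<otimes> x) \<otimes> inv y" using assms(3) by simp
  then show ?thesis using assms(1,2) by (simp add: m_assoc inv_solve_left)
qed

lemma word_val_commute_elt:
  assumes x: "x \<in> carrier G" and gs: "set gs \<subseteq> carrier G" "\<And>g. g \<in> set gs \<Longrightarrow> x \<otimes> g = g \<otimes> x" and w: "w \<in> words (length gs)"
  shows "x \<otimes> word_val G gs w = word_val G gs w \<otimes> x"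
  using w
proof (induction w)
  case Nil
  then show ?case using x by simp
next
  case (Cons l w)
  then have l: "fst l < length gs" "w \<in> words (length gs)" by auto
  define g where "g = (if snd l then gs ! fst l else inv (gs ! fst l))"
  have gl: "gs ! fst l \<in> carrier G" "x \<otimes> gs ! fst l = gs ! fst l \<otimes> x" using gs l(1) nth_mem by auto
  have g: "g \<in> carrier G" "x \<otimes> g = g \<otimes> x" using gl inv_commute[OF x gl] by (auto simp: g_def)
  have W: "word_val G gs w \<in> carrier G" using gs(1) l(2) by simp
  have "x \<otimes> (g \<otimes> word_val G gs w) = (x \<otimes> g) \<otimes> word_val G gs w" using x g(1) W by (simp add: m_assoc)
  also have "\<dots> = g \<otimes> (x \<otimes> word_val G gs w)" unfolding g(2) using x g(1) W by (simp add: m_assoc)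
  also have "\<dots> = (g \<otimes> word_val G gs w) \<otimes> x" unfolding Cons.IH[OF l(2)] using x g(1) W by (simp add: m_assoc)
  finally show ?case by (simp add: g_def)
qed

lemma word_val_commute:
  assumes gs: "set gs \<subseteq> carrier G" and hs: "set hs \<subseteq> carrier G"
    and comm: "\<And>g h. g \<in> set gs \<Longrightarrow> h \<in> set hs \<Longrightarrow> g \<otimes> h = h \<otimes> g"
    and u: "u \<in> words (length gs)" and v: "v \<in> words (length hs)"
  shows "word_val G gs u \<otimes> word_val G hs v = word_val G hs v \<otimes> word_val G gs u"
proof -
  have V: "word_val G hs v \<in> carrier G" using hs v by simp
  have "g \<otimes> word_val G hs v = word_val G hs v \<otimes> g" if "g \<in> set gs" for g
    using word_val_commute_elt[OF _ hs comm[OF that] v] that gs by blast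
  then show ?thesis using word_val_commute_elt[OF V gs _ u] by simp
qed

lemma word_val_mult:
  assumes gs: "set gs \<subseteq> carrier G" and hs: "set hs \<subseteq> carrier G" and len: "length gs = length hs"
    and comm: "\<And>g h. g \<in> set gs \<Longrightarrow> h \<in> set hs \<Longrightarrow> g \<otimes> h = h \<otimes> g"
    and w: "w \<in> words (length hs)"
  shows "word_val G (map2 (\<otimes>) gs hs) w = word_val G gs w \<otimes> word_val G hs w"
  using w
proof (induction w)
  case (Cons l w)
  then have l: "fst l < length hs" "fst l < length gs" "w \<in> words (length hs)" "w \<in> words (length gs)" using len by auto
  define g where "g = (if snd l then gs ! fst l else inv (gs ! fst l))"
  define h where "h = (if snd l then hs ! fst l else inv (hs ! fst l))"
  have mem: "gs ! fst l \<in> set gs" "hs ! fst l \<in> set hs" using l by auto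
  have gl: "gs ! fst l \<in> carrier G" "hs ! fst l \<in> carrier G" using gs hs mem by auto
  have c: "g \<in> carrier G" "h \<in> carrier G" "word_val G gs w \<in> carrier G" "word_val G hs w \<in> carrier G"
    using gl gs hs l by (auto simp: g_def h_def)
  have "word_val G gs w \<otimes> word_val G hs [l] = word_val G hs [l] \<otimes> word_val G gs w"
    using l by (intro word_val_commute[OF gs hs comm]) auto
  moreover have "word_val G hs [l] = h" using c(2) by (simp add: h_def)
  ultimately have hW: "h \<otimes> word_val G gs w = word_val G gs w \<otimes> h" by simp
  have "(if snd l then map2 (\<otimes>) gs hs ! fst l else inv (map2 (\<otimes>) gs hs ! fst l)) = g \<otimes> h"
    using l gl comm[OF mem] by (simp add: g_def h_def inv_mult_group)
  then have "word_val G (map2 (\<otimes>) gs hs) (l # w) = (g \<otimes> h) \<otimes> (word_val G gs w \<otimes> word_val G hs w)"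
    using Cons.IH[OF l(3)] by simp
  also have "\<dots> = g \<otimes> ((h \<otimes> word_val G gs w) \<otimes> word_val G hs w)" using c by (simp add: m_assoc)
  also have "\<dots> = (g \<otimes> word_val G gs w) \<otimes> (h \<otimes> word_val G hs w)" unfolding hW using c by (simp add: m_assoc)
  finally show ?case by (simp add: g_def h_def)
qed simp

lemma conj_solve: "x \<in> carrier G \<Longrightarrow> y \<in> carrier G \<Longrightarrow> g \<in> carrier G \<Longrightarrow> y = inv g \<otimes> x \<otimes> g \<longleftrightarrow> g \<otimes> y = x \<otimes> g"
  by (metis inv_solve_left m_assoc m_closed inv_closed)

lemma conj_solve_inv:
  "x \<in> carrier G \<Longrightarrow> y \<in> carrier G \<Longrightarrow> g \<in> carrier G \<Longrightarrow> y = inv (inv g) \<otimes> x \<otimes> inv g \<longleftrightarrow> g \<otimes> x = y \<otimes> g"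
  by (simp add: inv_solve_right eq_commute)

lemma conj_drop_commuting:
  assumes "A \<in> carrier G" "U \<in> carrier G" "X \<in> carrier G" "A \<otimes> U = U \<otimes> A" "A \<otimes> X = X \<otimes> A"
  shows "(A \<otimes> U) \<otimes> (X \<otimes> inv (A \<otimes> U)) = U \<otimes> (X \<otimes> inv U)"
proof -
  have inv_AU: "inv (A \<otimes> U) = inv A \<otimes> inv U" unfolding assms(4) using assms(1,2) by (rule inv_mult_group[rotated])
  have "(A \<otimes> U) \<otimes> (X \<otimes> inv (A \<otimes> U)) = U \<otimes> ((A \<otimes> X) \<otimes> (inv A \<otimes> inv U))"
    using assms(1-3) by (simp add: inv_AU) (simp add: assms(4) m_assoc)
  also have "\<dots> = U \<otimes> (X \<otimes> ((A \<otimes> inv A) \<otimes> inv U))"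
    unfolding assms(5) using assms(1-3) by (simp only: m_assoc m_closed inv_closed)
  also have "\<dots> = U \<otimes> (X \<otimes> inv U)" using assms(1-3) by simp
  finally show ?thesis .
qed

end

section \<open>The conjugacy problem of the extension\<close>

lemma germ_alpha_beta:
  assumes "F = at_top \<or> F = at_bot" shows "germ F alpha id" "germ F beta id"
proof -
  have shift: "to_circle x = to_circle (x - 1)" for x by (simp add: to_circle_eq_iff)
  show "germ F alpha id" unfolding germ_def alpha_def using shift by simp
  have "\<forall>\<^sub>F x in at_top. to_circle x = to_circle (beta x)"
    using eventually_gt_at_top[of 2] by eventually_elim (simp add: beta_def shift[symmetric])
  moreover have "\<forall>\<^sub>F x in at_bot. to_circle x = to_circle (beta x)"
    using eventually_le_at_bot[of 0] by eventually_elim (simp add: beta_def)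
  ultimately show "germ F beta id" unfolding germ_def using assms by auto
qed

lemma strict_mono_alpha_beta: "strict_mono alpha" "strict_mono beta"
  by (auto simp: strict_mono_def alpha_def beta_def)

text \<open>The situation of the theorem, with the hypotheses on the lifts expressed by germs.\<close>

locale fibre_extension =
  F_extension "length Rs + 2" wa wb "map (PV [ch, dh]) Rs @ [ah \<circ> ch, bh \<circ> dh]"
  for Rs :: "word list" and wa wb ah bh ch dh +
  assumes Rs: "set Rs \<subseteq> words 2"
    and norm: "\<And>e. e \<in> {ah, bh, ch, dh} \<Longrightarrow> normF e \<and> strict_mono e"
    and bot: "germ at_bot ah (T_ab ! 0)" "germ at_bot bh (T_ab ! 1)" "germ at_bot ch id" "germ at_bot dh id"
    and top: "germ at_top ah id" "germ at_top bh id" "germ at_top ch (T_cd ! 0)" "germ at_top dh (T_cd ! 1)"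
    and comm: "\<And>x y. x \<in> {ah, bh} \<Longrightarrow> y \<in> {ch, dh} \<Longrightarrow> x \<circ> y = y \<circ> x"
begin

abbreviation E :: "word \<Rightarrow> real \<Rightarrow> real" where "E \<equiv> PV [ch, dh]"

abbreviation Q :: "word set monoid" where "Q \<equiv> presented_group 2 (set Rs)"

lemma cd_normF: "e \<in> set [ch, dh] \<Longrightarrow> normF e"
  using norm by auto

lemma E_PL2: "w \<in> words 2 \<Longrightarrow> E w \<in> PL2"
  by (rule normF_PL2, rule PV_normF) (auto simp: numeral_2_eq_2 intro: cd_normF)

lemma E_append: "u \<in> words 2 \<Longrightarrow> v \<in> words 2 \<Longrightarrow> E (u @ v) = E u \<circ> E v"
  by (rule PV_append) (auto simp: numeral_2_eq_2 intro: cd_normF)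

lemma es_append:
  "u \<in> words (length Rs + 2 + 2) \<Longrightarrow> v \<in> words (length Rs + 2 + 2) \<Longrightarrow> PV es (u @ v) = PV es u \<circ> PV es v"
  by (rule PV_append) (auto simp del: o_apply intro: es_normF)

lemma es_winv: "u \<in> words (length Rs + 2 + 2) \<Longrightarrow> PV es (winv u) = finv (PV es u)"
  by (rule PV_winv) (auto simp del: o_apply intro: es_normF)

text \<open>The last two stable letters act as \<open>ah \<circ> ch\<close> and \<open>bh \<circ> dh\<close>, so these words act as the diagonal of the
  direct product of the two groups.\<close>

definition theta :: "word \<Rightarrow> word" where
  "theta = subst (\<lambda>i. gen (length Rs + 2 + i))"

lemma theta_words: "w \<in> words 2 \<Longrightarrow> theta w \<in> words (length Rs + 2 + 2)"
  unfolding theta_def by (rule subst_words[of 2]) simp_all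

lemma PL2_gens: "set [ah, bh] \<subseteq> carrier PL2_group" "set [ch, dh] \<subseteq> carrier PL2_group" "set es \<subseteq> carrier PL2_group"
  using norm normF_PL2 es_normF by auto

lemma PV_theta:
  assumes w: "w \<in> words 2" shows "PV es (theta w) = PV [ah, bh] w \<circ> E w"
proof -
  have nth: "es ! (length Rs + 2) = ah \<circ> ch" "es ! (length Rs + 3) = bh \<circ> dh"
    by (simp_all add: es_def nth_append numeral_3_eq_3)
  have "PV [ah \<circ> ch, bh \<circ> dh] w = PV es (theta w)" unfolding theta_def
  proof (rule PL2.word_val_subst[OF PL2_gens(3)])
    fix i assume i: "i < length [ah \<circ> ch, bh \<circ> dh]"
    then have "i = 0 \<or> i = 1" by auto
    then show "gen (length Rs + 2 + i) \<in> words (length es) \<and> [ah \<circ> ch, bh \<circ> dh] ! i = PV es (gen (length Rs + 2 + i))"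
      using nth PL2.word_val_gen[OF PL2_gens(3), of "length Rs + 2 + i"] by (auto simp: eval_nat_numeral)
  qed (use w in \<open>simp add: numeral_2_eq_2\<close>)
  moreover have "map2 (\<otimes>\<^bsub>PL2_group\<^esub>) [ah, bh] [ch, dh] = [ah \<circ> ch, bh \<circ> dh]" by (simp del: o_apply)
  moreover have "PV (map2 (\<otimes>\<^bsub>PL2_group\<^esub>) [ah, bh] [ch, dh]) w = PV [ah, bh] w \<otimes>\<^bsub>PL2_group\<^esub> E w"
    using comm w by (intro PL2.word_val_mult[OF PL2_gens(1,2)]) (auto simp: numeral_2_eq_2 simp del: o_apply)
  ultimately show ?thesis by (simp only: PL2_group_simps)
qed

text \<open>The product \<open>E (u r v) \<circ> E (u v)\<^sup>-\<^sup>1\<close> is the conjugate of \<open>E r\<close> by \<open>E u\<close>, hence by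
  \<open>theta u\<close>, because words in \<open>ah\<close>, \<open>bh\<close> commute with words in \<open>ch\<close>, \<open>dh\<close>. This is how \<open>G\<close> sees the
  relations of \<open>Q\<close>.\<close>

lemma pres_eq_realised:
  assumes "pres_eq 2 (set Rs) w w'"
  shows "\<exists>g \<in> words (length Rs + 2 + 2). PV es g = E w \<circ> finv (E w')"
  using assms
proof (induction rule: pres_eq.induct)
  case (refl w)
  have "E w \<circ> finv (E w) = id" using PL2_inv[OF E_PL2[OF refl]] by (simp add: fun_eq_iff)
  then show ?case by (intro bexI[of _ "[]"]) (simp_all del: o_apply)
next
  case (sym w w')
  then obtain g where g: "g \<in> words (length Rs + 2 + 2)" "PV es g = E w \<circ> finv (E w')" by blast
  have PL: "E w \<in> PL2" "E w' \<in> PL2" using E_PL2 pres_eq_words[OF sym.hyps] by auto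
  have "PV es (winv g) = finv (E w \<circ> finv (E w'))" by (simp only: es_winv[OF g(1)] g(2))
  also have "\<dots> = E w' \<circ> finv (E w)" using PL by (simp only: finv_comp PL2_inverse(1) finv_finv)
  finally show ?case using g(1) by (intro bexI[of _ "winv g"]) (simp_all del: o_apply)
next
  case (trans w w' w'')
  then obtain g g' where g: "g \<in> words (length Rs + 2 + 2)" "PV es g = E w \<circ> finv (E w')"
    and g': "g' \<in> words (length Rs + 2 + 2)" "PV es g' = E w' \<circ> finv (E w'')" by blast
  have PL: "E w' \<in> PL2" using E_PL2 pres_eq_words[OF trans.hyps(1)] by auto
  have "PV es (g @ g') = (E w \<circ> finv (E w')) \<circ> (E w' \<circ> finv (E w''))"
    by (simp only: es_append[OF g(1) g'(1)] g(2) g'(2))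
  also have "\<dots> = E w \<circ> finv (E w'')" using PL2_inv[OF PL] by (simp add: fun_eq_iff)
  finally show ?case using g(1) g'(1) by (intro bexI[of _ "g @ g'"]) (simp_all del: o_apply)
next
  case (cancel u v i e)
  have ws: "[(i, e), (i, \<not> e)] \<in> words 2" "u @ v \<in> words 2" using cancel by auto
  have "E (u @ [(i, e), (i, \<not> e)] @ v) = E (u @ v)"
    using cancel PL2.word_val_pres_eq[OF PL2_gens(2), of "{}" "u @ [(i, e), (i, \<not> e)] @ v" "u @ v"]
      pres_eq.cancel[of u 2 v i "{}" e] by (simp add: numeral_2_eq_2 del: word_val.simps)
  moreover have "E (u @ v) \<circ> finv (E (u @ v)) = id" using PL2_inv[OF E_PL2[OF ws(2)]] by (simp add: fun_eq_iff)
  ultimately show ?case by (intro bexI[of _ "[]"]) (simp_all del: o_apply append.simps)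
next
  case (relator u v r)
  then obtain j where j: "j < length Rs" "Rs ! j = r" by (auto simp: in_set_conv_nth)
  define A where "A = PV [ah, bh] u"
  have PL: "E u \<in> PL2" "E v \<in> PL2" "E r \<in> PL2" using relator E_PL2 by auto
  have A: "A \<in> PL2" using PL2.word_val_closed[OF PL2_gens(1), of u] relator(1) by (simp add: A_def numeral_2_eq_2)
  have cm: "A \<circ> E x = E x \<circ> A" if "x \<in> words 2" for x
  proof -
    have "A \<otimes>\<^bsub>PL2_group\<^esub> E x = E x \<otimes>\<^bsub>PL2_group\<^esub> A" unfolding A_def
      using comm that relator(1) by (intro PL2.word_val_commute[OF PL2_gens(1,2)]) (auto simp: numeral_2_eq_2 simp del: o_apply)
    then show ?thesis by (simp only: PL2_group_simps)
  qed
  define g where "g = theta u @ gen (j + 2) @ winv (theta u)"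
  have gw: "theta u \<in> words (length Rs + 2 + 2)" "gen (j + 2) \<in> words (length Rs + 2 + 2)"
    "winv (theta u) \<in> words (length Rs + 2 + 2)" "gen (j + 2) @ winv (theta u) \<in> words (length Rs + 2 + 2)" using theta_words relator(1) j by auto
  have t: "PV es (gen (j + 2)) = E r" using j by (subst PV_gens(4)) (simp_all add: nth_append del: o_apply)
  have "PV es g = (A \<circ> E u) \<circ> (E r \<circ> finv (A \<circ> E u))"
    unfolding g_def A_def es_append[OF gw(1,4)] es_append[OF gw(2,3)] es_winv[OF gw(1)] PV_theta[OF relator(1)] t ..
  also have "\<dots> = E u \<circ> (E r \<circ> finv (E u))"
    using PL2.conj_drop_commuting[of A "E u" "E r"] A PL cm[OF relator(1)] cm[OF relator(4)] PL2_comp(1)[OF A PL(1)]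
    by (simp del: o_apply)
  also have "\<dots> = E (u @ r @ v) \<circ> finv (E (u @ v))"
  proof -
    have eq: "E (u @ r @ v) = E u \<circ> (E r \<circ> E v)" "finv (E (u @ v)) = finv (E v) \<circ> finv (E u)"
      using relator E_append finv_comp[OF PL(1,2)] by simp_all
    show ?thesis unfolding eq by (simp add: fun_eq_iff PL2_inv[OF PL(2)])
  qed
  finally show ?case using gw by (intro bexI[of _ g]) (simp_all add: g_def del: o_apply)
qed

subsection \<open>Germs of the elements of the extension\<close>

text \<open>The germs at the two ends of the homeomorphism of each generator of \<open>G\<close>, as words in \<open>a, b\<close> at the
  negative end and in \<open>c, d\<close> at the positive end. In \<open>Q\<close> they differ by relators only.\<close>

definition bot_word :: "nat \<Rightarrow> word" where
  "bot_word i = (if i < length Rs + 2 then [] else gen (i - (length Rs + 2)))"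

definition top_word :: "nat \<Rightarrow> word" where
  "top_word i = (if i < 2 then [] else if i < length Rs + 2 then Rs ! (i - 2) else gen (i - (length Rs + 2)))"

lemma end_words: "i < length Rs + 2 + 2 \<Longrightarrow> bot_word i \<in> words 2" "i < length Rs + 2 + 2 \<Longrightarrow> top_word i \<in> words 2"
  using Rs by (auto simp: bot_word_def top_word_def subset_iff)

lemma T_lists: "set T_ab \<subseteq> carrier T_group" "set T_cd \<subseteq> carrier T_group" "length T_ab = 2" "length T_cd = 2"
  using T_ab_cd_mem by (simp_all add: T_ab_def T_cd_def)

lemma E_germs:
  assumes w: "w \<in> words 2"
  shows "germ at_bot (E w) id" "germ at_top (E w) (word_val T_group T_cd w)" "strict_mono (E w)"
proof -
  have es: "[ch, dh] ! i \<in> PL2 \<and> strict_mono ([ch, dh] ! i)" if "i < length [ch, dh]" for i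
    using norm[of "[ch, dh] ! i"] normF_PL2 nth_mem[OF that] by auto
  have lt: "i < length [ch, dh] \<Longrightarrow> i = 0 \<or> i = 1" for i by auto
  have gb: "[id, id] ! i \<in> thompson_T \<and> germ at_bot ([ch, dh] ! i) ([id, id] ! i)" if "i < length [ch, dh]" for i
    using lt[OF that] bot(3,4) id_T by auto
  have gt: "T_cd ! i \<in> thompson_T \<and> germ at_top ([ch, dh] ! i) (T_cd ! i)" if "i < length [ch, dh]" for i
    using lt[OF that] top(3,4) T_lists(2,4) nth_mem[of i T_cd] by auto
  have w': "w \<in> words (length [ch, dh])" using w by (simp add: numeral_2_eq_2)
  have "word_val T_group [id, id] w = id" using T.word_val_one[of "[id, id]" w] w' by simp
  then show "germ at_bot (E w) id" using germ_word[OF es _ gb _ w'] by simp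
  show "germ at_top (E w) (word_val T_group T_cd w)" "strict_mono (E w)" using germ_word[OF es _ gt _ w'] T_lists(4) by simp_all
qed

lemma es_cases:
  assumes "i < length Rs + 2 + 2"
  obtains "i = 0" | "i = 1" | j where "i = j + 2" "j < length Rs" | "i = length Rs + 2" | "i = length Rs + 2 + 1"
proof -
  have "i = 0 \<or> i = 1 \<or> (\<exists>j < length Rs. i = j + 2) \<or> i = length Rs + 2 \<or> i = length Rs + 2 + 1"
  proof (cases "i < 2 \<or> length Rs + 2 \<le> i")
    case False
    then show ?thesis by (intro disjI2 disjI1 exI[of _ "i - 2"]) auto
  qed (use assms in linarith)
  then show ?thesis using that by blast
qed

lemma es_germs:
  assumes i: "i < length Rs + 2 + 2"
  shows "es ! i \<in> PL2 \<and> strict_mono (es ! i)" "germ at_bot (es ! i) (word_val T_group T_ab (bot_word i))"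
    "germ at_top (es ! i) (word_val T_group T_cd (top_word i))"
proof -
  have gab: "word_val T_group T_ab (gen j) = T_ab ! j" "word_val T_group T_cd (gen j) = T_cd ! j" if "j < 2" for j
    using T.word_val_gen[OF T_lists(1)] T.word_val_gen[OF T_lists(2)] that T_lists by auto
  have PL: "es ! i \<in> PL2" using es_normF[of "es ! i"] normF_PL2 i nth_mem[of i es] by simp
  have P4: "ah \<in> PL2" "bh \<in> PL2" "ch \<in> PL2" "dh \<in> PL2" and S4: "strict_mono ah" "strict_mono bh" "strict_mono ch" "strict_mono dh"
    using norm normF_PL2 by auto
  have "strict_mono (es ! i) \<and> germ at_bot (es ! i) (word_val T_group T_ab (bot_word i)) \<and>
    germ at_top (es ! i) (word_val T_group T_cd (top_word i))"
    using i
  proof (cases rule: es_cases)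
    case 1
    then show ?thesis using germ_alpha_beta(1) strict_mono_alpha_beta by (simp add: es_def bot_word_def top_word_def)
  next
    case 2
    then show ?thesis using germ_alpha_beta(2) strict_mono_alpha_beta by (simp add: es_def bot_word_def top_word_def)
  next
    case (3 j)
    have "es ! i = E (Rs ! j)" using 3 by (simp add: es_def nth_append)
    then show ?thesis using 3 E_germs[OF subsetD[OF Rs nth_mem[of j Rs]]]
      by (auto simp: bot_word_def top_word_def simp del: o_apply)
  next
    case 4
    have "es ! i = ah \<circ> ch" using 4 by (simp add: es_def nth_append)
    then show ?thesis using 4 gab[of 0] germ_comp[OF P4(3) S4(3) _ bot(1) bot(3)] germ_comp[OF P4(3) S4(3) _ top(1) top(3)]
        strict_mono_o[OF S4(1) S4(3)] by (simp add: bot_word_def top_word_def del: o_apply)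
  next
    case 5
    have "es ! i = bh \<circ> dh" using 5 by (simp add: es_def nth_append)
    then show ?thesis using 5 gab[of 1] germ_comp[OF P4(4) S4(4) _ bot(2) bot(4)] germ_comp[OF P4(4) S4(4) _ top(2) top(4)]
        strict_mono_o[OF S4(2) S4(4)] by (simp add: bot_word_def top_word_def del: o_apply)
  qed
  with PL show "es ! i \<in> PL2 \<and> strict_mono (es ! i)" "germ at_bot (es ! i) (word_val T_group T_ab (bot_word i))"
    "germ at_top (es ! i) (word_val T_group T_cd (top_word i))" by auto
qed

lemma PV_germs:
  assumes g: "g \<in> words (length Rs + 2 + 2)"
  shows "germ at_bot (PV es g) (word_val T_group T_ab (subst bot_word g))"
    "germ at_top (PV es g) (word_val T_group T_cd (subst top_word g))"
proof -
  have g': "g \<in> words (length es)" using g by simp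
  define bs where "bs = map (\<lambda>i. word_val T_group T_ab (bot_word i)) [0..<length es]"
  define ts where "ts = map (\<lambda>i. word_val T_group T_cd (top_word i)) [0..<length es]"
  have len: "length bs = length es" "length ts = length es" by (simp_all add: bs_def ts_def)
  have es: "\<And>i. i < length es \<Longrightarrow> es ! i \<in> PL2 \<and> strict_mono (es ! i)" using es_germs(1) by simp
  have b: "bs ! i \<in> thompson_T \<and> germ at_bot (es ! i) (bs ! i)" if "i < length es" for i
    using that es_germs(2)[of i] end_words(1)[of i] T.word_val_closed[OF T_lists(1), of "bot_word i"] T_lists(3) by (simp add: bs_def del: upt_Suc)
  have t: "ts ! i \<in> thompson_T \<and> germ at_top (es ! i) (ts ! i)" if "i < length es" for i
    using that es_germs(3)[of i] end_words(2)[of i] T.word_val_closed[OF T_lists(2), of "top_word i"] T_lists(4) by (simp add: ts_def del: upt_Suc)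
  have "word_val T_group bs g = word_val T_group T_ab (subst bot_word g)"
    by (rule T.word_val_subst[OF T_lists(1)]) (use end_words(1) g len T_lists(3) in \<open>auto simp: bs_def simp del: upt_Suc\<close>)
  then show "germ at_bot (PV es g) (word_val T_group T_ab (subst bot_word g))" using germ_word[OF es len(1) b _ g'] by simp
  have "word_val T_group ts g = word_val T_group T_cd (subst top_word g)"
    by (rule T.word_val_subst[OF T_lists(2)]) (use end_words(2) g len T_lists(4) in \<open>auto simp: ts_def simp del: upt_Suc\<close>)
  then show "germ at_top (PV es g) (word_val T_group T_cd (subst top_word g))" using germ_word[OF es len(2) t _ g'] by simp
qed

lemma end_words_Q:
  assumes g: "g \<in> words (length Rs + 2 + 2)"
  shows "word_val Q (pres_gens 2 (set Rs)) (subst bot_word g) = word_val Q (pres_gens 2 (set Rs)) (subst top_word g)"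
proof -
  interpret Q: group Q by (rule group_presented_group)
  define hs where "hs = map (\<lambda>i. word_val Q (pres_gens 2 (set Rs)) (bot_word i)) [0..<length Rs + 2 + 2]"
  have eq: "word_val Q (pres_gens 2 (set Rs)) (bot_word i) = word_val Q (pres_gens 2 (set Rs)) (top_word i)"
    if "i < length Rs + 2 + 2" for i
  proof (cases "2 \<le> i \<and> i < length Rs + 2")
    case True
    then have r: "Rs ! (i - 2) \<in> set Rs" by (intro nth_mem) linarith
    then have "pres_eq 2 (set Rs) (Rs ! (i - 2)) []" using pres_eq.relator[of "[]" 2 "[]" "Rs ! (i - 2)" "set Rs"] Rs by auto
    then show ?thesis using True r Rs word_val_presented_group_eq_iff[of "Rs ! (i - 2)" 2 "[]" "set Rs"]
      by (auto simp: bot_word_def top_word_def)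
  next
    case False
    then show ?thesis by (auto simp: bot_word_def top_word_def)
  qed
  have len: "length hs = length Rs + 2 + 2" by (simp add: hs_def)
  have "word_val Q hs g = word_val Q (pres_gens 2 (set Rs)) (subst bot_word g)"
    by (rule Q.word_val_subst[OF pres_gens_closed]) (use end_words(1) g len in \<open>auto simp: hs_def simp del: upt_Suc\<close>)
  moreover have "word_val Q hs g = word_val Q (pres_gens 2 (set Rs)) (subst top_word g)"
    by (rule Q.word_val_subst[OF pres_gens_closed]) (use end_words(2) g len eq in \<open>auto simp: hs_def simp del: upt_Suc\<close>)
  ultimately show ?thesis by simp
qed

text \<open>Both germs of the periodic map agree, so ping-pong makes the word in \<open>a, b\<close> and the word in \<open>c, d\<close>
  freely trivial. Up to \<open>w\<close> they are the same word in \<open>Q\<close>.\<close>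

lemma periodic_trivial:
  assumes g: "g \<in> words (length Rs + 2 + 2)" and w: "w \<in> words 2"
    and per: "\<And>x. (PV es g \<circ> E w) (x + 1) = (PV es g \<circ> E w) x + 1"
  shows "word_val Q (pres_gens 2 (set Rs)) w = \<one>\<^bsub>Q\<^esub>"
proof -
  interpret Q: group Q by (rule group_presented_group)
  let ?v = "word_val Q (pres_gens 2 (set Rs))"
  have sw: "subst bot_word g \<in> words 2" "subst top_word g \<in> words 2" using subst_words end_words g by blast+
  have "germ at_bot (PV es g \<circ> E w) (word_val T_group T_ab (subst bot_word g) \<circ> id)"
    "germ at_top (PV es g \<circ> E w) (word_val T_group T_cd (subst top_word g) \<circ> word_val T_group T_cd w)"
    using germ_comp[OF E_PL2[OF w] E_germs(3)[OF w]] PV_germs[OF g] E_germs[OF w] by blast+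
  from germ_periodic[OF per this(2,1)]
  have "word_val T_group T_ab (subst bot_word g) = word_val T_group T_cd (subst top_word g @ w)"
    using T.word_val_append[OF T_lists(2), of "subst top_word g" w] sw w T_lists(4) by (simp del: o_apply)
  then have "pres_eq 2 (set Rs) (subst bot_word g) [] \<and> pres_eq 2 (set Rs) (subst top_word g @ w) []"
    using sw w by (intro T_ab_cd_words) auto
  then have "?v (subst bot_word g) = \<one>\<^bsub>Q\<^esub>" "?v (subst top_word g @ w) = \<one>\<^bsub>Q\<^esub>"
    using word_val_presented_group_one_iff sw w by auto
  moreover have "?v (subst top_word g @ w) = ?v (subst top_word g) \<otimes>\<^bsub>Q\<^esub> ?v w"
    using sw w by (intro Q.word_val_append pres_gens_closed) auto
  moreover have "?v w \<in> carrier Q" using w by (intro Q.word_val_closed pres_gens_closed) simp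
  ultimately show ?thesis using end_words_Q[OF g] by simp
qed

subsection \<open>The reduction\<close>

text \<open>A word for the conjugate of \<open>\<alpha>\<close> by \<open>E w\<close>.\<close>

definition conj_alpha :: "(nat \<times> bool \<Rightarrow> nat \<times> bool \<Rightarrow> word) \<Rightarrow> word \<Rightarrow> word" where
  "conj_alpha S w = foldr (subst_word S) w (gen 0)"

lemma conj_alpha:
  assumes S: "conj_table [ch, dh] S" and w: "w \<in> words 2"
  shows "conj_alpha S w \<in> words 2 \<and> FV (conj_alpha S w) = E w \<circ> alpha \<circ> finv (E w)"
  using w
proof (induction w)
  case Nil
  have "FV (gen 0) = alpha" using PV_gens(1) PV_words_2[of "gen 0"] by simp
  then show ?case by (simp add: conj_alpha_def del: o_apply) (simp add: fun_eq_iff)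
next
  case (Cons l w)
  then have l: "fst l < 2" "fst l < length [ch, dh]" "w \<in> words 2" "[l] \<in> words 2" by auto
  have step: "conj_alpha S (l # w) = subst_word S l (conj_alpha S w)" by (simp add: conj_alpha_def)
  note IH = Cons.IH[OF l(3)]
  have app: "E (l # w) = E [l] \<circ> E w" using E_append[OF l(4,3)] by (simp del: word_val.simps o_apply)
  note PL = E_PL2[OF l(4)] E_PL2[OF l(3)]
  show ?case unfolding step app finv_comp[OF PL]
    using subst_word[OF S cd_normF l(2) conjunct1[OF IH]] IH by (simp only: comp_assoc)
qed

text \<open>If \<open>w = 1\<close> in \<open>Q\<close>, an element of \<open>G\<close> that acts as \<open>E w\<close> is a conjugator. Conversely, a conjugator acts as
  some \<open>V\<close> for which \<open>V \<circ> E w\<close> commutes with \<open>\<alpha>\<close>.\<close>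

lemma conj_alpha_conjugate_iff:
  assumes S: "conj_table [ch, dh] S" and w: "w \<in> words 2"
  shows "word_val Q (pres_gens 2 (set Rs)) w = \<one>\<^bsub>Q\<^esub> \<longleftrightarrow>
    (\<exists>g \<in> carrier P. ev (conj_alpha S w) = inv\<^bsub>P\<^esub> g \<otimes>\<^bsub>P\<^esub> ev (gen 0) \<otimes>\<^bsub>P\<^esub> g)"
proof
  have y: "conj_alpha S w \<in> words 2" "FV (conj_alpha S w) = E w \<circ> alpha \<circ> finv (E w)" using conj_alpha[OF S w] by auto
  have a: "gen 0 \<in> words 2" "FV (gen 0) = alpha" using PV_gens(1) PV_words_2[of "gen 0"] by simp_all
  note ya = words_2_sub[OF y(1)] words_2_sub[OF a(1)]
  note e = E_PL2[OF w]
  {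
    assume "word_val Q (pres_gens 2 (set Rs)) w = \<one>\<^bsub>Q\<^esub>"
    then have "pres_eq 2 (set Rs) w []" using word_val_presented_group_one_iff[OF w] by blast
    from pres_eq_realised[OF this] obtain G where G: "G \<in> words (length Rs + 2 + 2)" "PV es G = E w" by auto
    obtain f' where f': "f' \<in> words 2" "ev G \<otimes>\<^bsub>P\<^esub> ev (gen 0) = ev f' \<otimes>\<^bsub>P\<^esub> ev G" using ev_conj[OF G(1) a(1)] by blast
    have "E w \<circ> alpha = FV f' \<circ> E w" using PV_conj[OF G(1) a(1) f'] unfolding a(2) G(2) .
    then have "E w \<circ> alpha \<circ> finv (E w) = FV f' \<circ> (E w \<circ> finv (E w))" by (simp only: comp_assoc)
    also have "\<dots> = FV f'" using PL2_inv[OF e] by (simp add: fun_eq_iff)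
    finally have "ev (conj_alpha S w) = ev f'" using ev_cong_F[OF y(1) f'(1)] y(2) by simp
    then have "ev G \<otimes>\<^bsub>P\<^esub> ev (gen 0) = ev (conj_alpha S w) \<otimes>\<^bsub>P\<^esub> ev G" using f'(2) by simp
    then have "ev (conj_alpha S w) = inv\<^bsub>P\<^esub> (inv\<^bsub>P\<^esub> ev G) \<otimes>\<^bsub>P\<^esub> ev (gen 0) \<otimes>\<^bsub>P\<^esub> inv\<^bsub>P\<^esub> ev G"
      by (subst P.conj_solve_inv[OF ev_closed[OF ya(2)] ev_closed[OF ya(1)] ev_closed[OF G(1)]])
    then show "\<exists>g \<in> carrier P. ev (conj_alpha S w) = inv\<^bsub>P\<^esub> g \<otimes>\<^bsub>P\<^esub> ev (gen 0) \<otimes>\<^bsub>P\<^esub> g"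
      using P.inv_closed[OF ev_closed[OF G(1)]] by (rule bexI)
  next
    assume "\<exists>g \<in> carrier P. ev (conj_alpha S w) = inv\<^bsub>P\<^esub> g \<otimes>\<^bsub>P\<^esub> ev (gen 0) \<otimes>\<^bsub>P\<^esub> g"
    then obtain G where G: "G \<in> words (length Rs + 2 + 2)"
      "ev (conj_alpha S w) = inv\<^bsub>P\<^esub> ev G \<otimes>\<^bsub>P\<^esub> ev (gen 0) \<otimes>\<^bsub>P\<^esub> ev G" by (auto simp only: carrier_P)
    have "ev G \<otimes>\<^bsub>P\<^esub> ev (conj_alpha S w) = ev (gen 0) \<otimes>\<^bsub>P\<^esub> ev G"
      using G(2) by (subst P.conj_solve[symmetric, OF ev_closed[OF ya(2)] ev_closed[OF ya(1)] ev_closed[OF G(1)]])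
    from PV_conj[OF G(1) y(1) a(1) this]
    have eq: "PV es G \<circ> (E w \<circ> alpha \<circ> finv (E w)) = alpha \<circ> PV es G" unfolding y(2) a(2) .
    have "(PV es G \<circ> E w) (x + 1) = (PV es G \<circ> E w) x + 1" for x
      using fun_cong[OF eq, of "E w (x + 1)"] by (simp add: alpha_def PL2_inv[OF e])
    then show "word_val Q (pres_gens 2 (set Rs)) w = \<one>\<^bsub>Q\<^esub>" by (rule periodic_trivial[OF G(1) w])
  }
qed

lemma word_problem_from_conjugacy:
  assumes "conjugacy_problem_solvable P (pres_gens (length Rs + 2 + 2) R)"
  shows "word_problem_solvable Q (pres_gens 2 (set Rs))"
proof -
  obtain S where S: "conj_table [ch, dh] S" using conj_table_exists[OF cd_normF] by blast
  show ?thesis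
  proof (rule word_problem_solvable_if_conjugacy[OF assms])
    show "computable (conj_alpha S)" unfolding conj_alpha_def
      by (intro computable_foldr computable_subst_word[OF S] computable_intros)
    show "gen 0 \<in> words (length (pres_gens (length Rs + 2 + 2) R))" by simp
    fix w assume "w \<in> words (length (pres_gens 2 (set Rs)))"
    then have w: "w \<in> words 2" by simp
    show "conj_alpha S w \<in> words (length (pres_gens (length Rs + 2 + 2) R))"
      using words_2_sub[OF conjunct1[OF conj_alpha[OF S w]]] by simp
    show "word_val Q (pres_gens 2 (set Rs)) w = \<one>\<^bsub>Q\<^esub> \<longleftrightarrow>
        (\<exists>g \<in> carrier P. word_val P (pres_gens (length Rs + 2 + 2) R) (conj_alpha S w) =
          inv\<^bsub>P\<^esub> g \<otimes>\<^bsub>P\<^esub> word_val P (pres_gens (length Rs + 2 + 2) R) (gen 0) \<otimes>\<^bsub>P\<^esub> g)"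
      using conj_alpha_conjugate_iff[OF S w] unfolding ev_def .
  qed
qed

end

text \<open>The factors \<open>(1, y)\<close> and \<open>(x, 1)\<close> of the product can be multiplied in either order.\<close>

lemma direct_product_commute:
  assumes iso: "(\<lambda>(x, y). x \<otimes>\<^bsub>G\<^esub> y) \<in> iso (G\<lparr>carrier := A\<rparr> \<times>\<times> G\<lparr>carrier := B\<rparr>) (G\<lparr>carrier := C\<rparr>)"
    and G: "group G" and AB: "A \<subseteq> carrier G" "B \<subseteq> carrier G" "\<one>\<^bsub>G\<^esub> \<in> A" "\<one>\<^bsub>G\<^esub> \<in> B" and xy: "x \<in> A" "y \<in> B"
  shows "x \<otimes>\<^bsub>G\<^esub> y = y \<otimes>\<^bsub>G\<^esub> x"
proof -
  interpret group G by (rule G)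
  have c: "x \<in> carrier G" "y \<in> carrier G" using AB xy by auto
  have "(\<lambda>(x, y). x \<otimes>\<^bsub>G\<^esub> y) ((\<one>\<^bsub>G\<^esub>, y) \<otimes>\<^bsub>G\<lparr>carrier := A\<rparr> \<times>\<times> G\<lparr>carrier := B\<rparr>\<^esub> (x, \<one>\<^bsub>G\<^esub>)) =
      (\<lambda>(x, y). x \<otimes>\<^bsub>G\<^esub> y) (\<one>\<^bsub>G\<^esub>, y) \<otimes>\<^bsub>G\<lparr>carrier := C\<rparr>\<^esub> (\<lambda>(x, y). x \<otimes>\<^bsub>G\<^esub> y) (x, \<one>\<^bsub>G\<^esub>)"
    using iso AB xy by (intro hom_mult) (auto simp: iso_def)
  then show ?thesis using c by simp
qed

theorem mainTheorem3:
  fixes Rs :: "word list" and m n :: nat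
    and a b c d :: "circle \<Rightarrow> circle"
    and ah bh ch dh :: "real \<Rightarrow> real"
    and phi :: "(real \<Rightarrow> real) list"
    and wa wb :: "word list"
  assumes "length Rs = m" and "set Rs \<subseteq> words 2"
    and "\<not> word_problem_solvable (presented_group 2 (set Rs)) (pres_gens 2 (set Rs))"
    and "n = m + 2"
    and "a = T_u [^]\<^bsub>T_group\<^esub> (2::nat)"
    and "b = T_v [^]\<^bsub>T_group\<^esub> (2::nat)"
    and "c = T_u \<otimes>\<^bsub>T_group\<^esub> T_v \<otimes>\<^bsub>T_group\<^esub> inv\<^bsub>T_group\<^esub> T_u"
    and "d = T_v \<otimes>\<^bsub>T_group\<^esub> T_u \<otimes>\<^bsub>T_group\<^esub> inv\<^bsub>T_group\<^esub> T_v"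
    and "{ah, bh, ch, dh} \<subseteq> Aut_plus_F"
    and "pi_map ah = (a, \<one>\<^bsub>T_group\<^esub>)"
    and "pi_map bh = (b, \<one>\<^bsub>T_group\<^esub>)"
    and "pi_map ch = (\<one>\<^bsub>T_group\<^esub>, c)"
    and "pi_map dh = (\<one>\<^bsub>T_group\<^esub>, d)"
    and "free_basis PL2_group [ah, bh]"
    and "free_basis PL2_group [ch, dh]"
    and "(\<lambda>(x, y). x \<otimes>\<^bsub>PL2_group\<^esub> y) \<in>
           iso (PL2_group\<lparr>carrier := generate PL2_group {ah, bh}\<rparr> \<times>\<times>
                PL2_group\<lparr>carrier := generate PL2_group {ch, dh}\<rparr>)
               (PL2_group\<lparr>carrier := generate PL2_group {ah, bh, ch, dh}\<rparr>)"
    and "phi = map (word_val PL2_group [ch, dh]) Rs @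
           [ah \<otimes>\<^bsub>PL2_group\<^esub> ch, bh \<otimes>\<^bsub>PL2_group\<^esub> dh]"
    and "length wa = n" and "set wa \<subseteq> words 2"
    and "length wb = n" and "set wb \<subseteq> words 2"
    and "\<forall>j<n. word_val PL2_group [alpha, beta] (wa ! j) =
           inv\<^bsub>PL2_group\<^esub> (phi ! j) \<otimes>\<^bsub>PL2_group\<^esub> alpha \<otimes>\<^bsub>PL2_group\<^esub> phi ! j"
    and "\<forall>j<n. word_val PL2_group [alpha, beta] (wb ! j) =
           inv\<^bsub>PL2_group\<^esub> (phi ! j) \<otimes>\<^bsub>PL2_group\<^esub> beta \<otimes>\<^bsub>PL2_group\<^esub> phi ! j"
  shows "let R = extension_relators n wa wb;
             G = presented_group (n + 2) R;
             gs = pres_gens (n + 2) R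
         in extension_of F_group G \<and>
            word_problem_solvable G gs \<and>
            \<not> conjugacy_problem_solvable G gs"
proof -
  let ?phi = "map (PV [ch, dh]) Rs @ [ah \<circ> ch, bh \<circ> dh]"
  note ab = assms(5-8)
  have phi_eq: "phi = ?phi" using assms(17) by (simp del: o_apply)
  have m: "m = length Rs" and n: "n = length Rs + 2" using assms(1,4) by simp_all
  have norm: "normF e \<and> strict_mono e" if "e \<in> {ah, bh, ch, dh}" for e
    using that assms(9) normF_normalizer by (auto simp: Aut_plus_F_def)
  have T_ab: "a = T_ab ! 0" "b = T_ab ! 1"
    unfolding ab T_ab_def using T_uv_mem by (simp_all add: numeral_2_eq_2 T.nat_pow_Suc del: o_apply)
  have T_cd: "c = T_cd ! 0" "d = T_cd ! 1"
    unfolding ab T_cd_def by (simp_all add: comp_assoc del: o_apply)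
  have mem: "ah \<in> Aut_plus_F" "bh \<in> Aut_plus_F" "ch \<in> Aut_plus_F" "dh \<in> Aut_plus_F" using assms(9) by auto
  note germs = pi_map_germs[OF mem(1) assms(10)] pi_map_germs[OF mem(2) assms(11)]
    pi_map_germs[OF mem(3) assms(12)] pi_map_germs[OF mem(4) assms(13)]
  have PL: "{ah, bh, ch, dh} \<subseteq> carrier PL2_group" using norm normF_PL2 by auto
  have comm: "x \<circ> y = y \<circ> x" if "x \<in> {ah, bh}" "y \<in> {ch, dh}" for x y
  proof -
    have "x \<otimes>\<^bsub>PL2_group\<^esub> y = y \<otimes>\<^bsub>PL2_group\<^esub> x"
    proof (rule direct_product_commute[OF assms(16) group_PL2])
      show "generate PL2_group {ah, bh} \<subseteq> carrier PL2_group" "generate PL2_group {ch, dh} \<subseteq> carrier PL2_group"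
        using PL by (intro PL2.generate_incl; simp)+
    qed (use that in \<open>auto intro: generate.incl generate.one simp del: PL2_group_simps\<close>)
    then show ?thesis by (simp only: PL2_group_simps)
  qed
  have phi_norm: "normF e" if e: "e \<in> set ?phi" for e
  proof -
    have "normF (PV [ch, dh] r)" if "r \<in> set Rs" for r
      by (rule PV_normF) (use norm assms(2) that in \<open>auto simp: numeral_2_eq_2\<close>)
    moreover have "normF (ah \<circ> ch)" "normF (bh \<circ> dh)" using norm by (auto intro!: normF_comp simp del: o_apply)
    ultimately show ?thesis using e by (auto simp del: o_apply)
  qed
  have phi_j: "phi ! j \<in> PL2" if "j < n" for j
    using phi_norm[of "phi ! j"] nth_mem[of j phi] that normF_PL2 n by (simp add: phi_eq)
  have vals: "FV (wa ! j) = finv (phi ! j) \<circ> alpha \<circ> phi ! j" "FV (wb ! j) = finv (phi ! j) \<circ> beta \<circ> phi ! j"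
    if "j < n" for j
    using assms(22,23) that inv_PL2[OF phi_j[OF that]] by (simp_all del: o_apply)
  interpret fibre_extension Rs wa wb ah bh ch dh
  proof unfold_locales
    show "wa ! j \<in> words 2" if "j < length Rs + 2" for j using that assms(18,19) n nth_mem[of j wa] by auto
    show "wb ! j \<in> words 2" if "j < length Rs + 2" for j using that assms(20,21) n nth_mem[of j wb] by auto
    show "FV (wa ! j) = finv (?phi ! j) \<circ> alpha \<circ> ?phi ! j" if "j < length Rs + 2" for j
      using vals(1)[of j] that n unfolding phi_eq by blast
    show "FV (wb ! j) = finv (?phi ! j) \<circ> beta \<circ> ?phi ! j" if "j < length Rs + 2" for j
      using vals(2)[of j] that n unfolding phi_eq by blast
    show "germ at_bot ah (T_ab ! 0)" "germ at_bot bh (T_ab ! 1)" "germ at_bot ch id" "germ at_bot dh id"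
      "germ at_top ah id" "germ at_top bh id" "germ at_top ch (T_cd ! 0)" "germ at_top dh (T_cd ! 1)"
      using germs by (simp_all only: T_ab T_cd T_group_simps)
  qed (use phi_norm norm comm assms(2) in \<open>simp_all del: o_apply\<close>)
  have "\<not> conjugacy_problem_solvable P (pres_gens (length Rs + 2 + 2) R)"
    using word_problem_from_conjugacy assms(3) by blast
  then show ?thesis using extension word_problem unfolding Let_def n P_def R_def by blast
qed

end
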